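(* Let $n\geq 2$ be an integer, let $f$ be a transcendental meromorphic function in $\mathbb{C}$ with $N(r,f)=S(r,f)$, and let $P(f)$ be a differential polynomial in $f$ of degree $n-1$ whose coefficients are small functions of $f$. Let $\alpha$ be any entire function and let $R$ be any small function of $f$. If $f$ is a solution of the equation $$f^{n}+P(f)=R(z)e^{\alpha(z)},$$ then $f$ has the form $$f(z)=s(z)e^{\alpha(z)/n}+\gamma(z),$$ where $s$ and $\gamma$ are small functions of $f$ with $s^{n}=R$.
   Context: Standard Nevanlinna theory notation is used: $T(r,f)$, $m(r,f)$, $N(r,f)$ are the characteristic, proximity and (integrated) counting functions of a meromorphic function $f$ on $\mathbb{C}$. $S(r,f)$ denotes any quantity with $S(r,f)=o(T(r,f))$ as $r\to\infty$, possibly outside a set of finite linear measure (not necessarily the same at each occurrence). A meromorphic function $a(z)$ on $\mathbb{C}$ is a small function of $f$ if $T(r,a)=S(r,f)$. A differential polynomial in $f$ is a finite sum of terms $a_\lambda f^{l_0}(f')^{l_1}\cdots(f^{(k)})^{l_k}$ with meromorphic coefficients $a_\lambda$ (here small functions of $f$) and nonnegative integers $l_j$; its degree is the maximum of $l_0+l_1+\cdots+l_k$ over its terms. *)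

theory Defs
  imports "HOL-Complex_Analysis.Complex_Analysis" "HOL-Library.Landau_Symbols"
begin

text \<open>
  As usual for \<open>meromorphic_on\<close>, a meromorphic function on the plane is represented by a total
  function whose values on a sparse set (in particular at its poles) are irrelevant. Identities
  between meromorphic functions are therefore stated with \<open>\<forall>\<^sub>\<approx>z\<close>, i.e. off a
  closed discrete set. All notions below are insensitive to changes on such a set.
\<close>

definition log_plus :: "real \<Rightarrow> real" where
  "log_plus x = (if x \<le> 1 then 0 else ln x)"

definition nev_m :: "real \<Rightarrow> (complex \<Rightarrow> complex) \<Rightarrow> real" where
  "nev_m r f = 1 / (2 * pi) * integral {0..2 * pi} (\<lambda>t. log_plus (norm (f (rcis r t))))"

text \<open>The number of poles in the closed disc of radius \<open>t\<close>, with multiplicity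
  (\<open>zorder\<close> is minus the multiplicity at a pole).\<close>
definition nev_n :: "real \<Rightarrow> (complex \<Rightarrow> complex) \<Rightarrow> nat" where
  "nev_n t f = (\<Sum>z\<in>{z \<in> cball 0 t. is_pole f z}. nat (- zorder f z))"

definition nev_N :: "real \<Rightarrow> (complex \<Rightarrow> complex) \<Rightarrow> real" where
  "nev_N r f = integral {0..r} (\<lambda>t. (real (nev_n t f) - real (nev_n 0 f)) / t)
               + real (nev_n 0 f) * ln r"

definition nev_T :: "real \<Rightarrow> (complex \<Rightarrow> complex) \<Rightarrow> real" where
  "nev_T r f = nev_m r f + nev_N r f"

text \<open>\<open>nev_S g f\<close> states that \<open>g r = S(r, f)\<close>; the exceptional set may depend on \<open>g\<close>.\<close>
definition nev_S :: "(real \<Rightarrow> real) \<Rightarrow> (complex \<Rightarrow> complex) \<Rightarrow> bool" where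
  "nev_S g f \<longleftrightarrow>
     (\<exists>E. E \<in> lmeasurable \<and> g \<in> o[inf at_top (principal (- E))](\<lambda>r. nev_T r f))"

definition small_function :: "(complex \<Rightarrow> complex) \<Rightarrow> (complex \<Rightarrow> complex) \<Rightarrow> bool" where
  "small_function a f \<longleftrightarrow> a meromorphic_on UNIV \<and> nev_S (\<lambda>r. nev_T r a) f"

definition transcendental_meromorphic :: "(complex \<Rightarrow> complex) \<Rightarrow> bool" where
  "transcendental_meromorphic f \<longleftrightarrow> f meromorphic_on UNIV \<and>
     \<not> (\<exists>p q :: complex poly. q \<noteq> 0 \<and> (\<forall>\<^sub>\<approx>z. f z = poly p z / poly q z))"

text \<open>A differential polynomial is a finite list of terms; the pair \<open>(a, [l\<^sub>0, \<dots>, l\<^sub>k])\<close>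
  stands for \<open>a f\<^bsup>l\<^sub>0\<^esup> (f')\<^bsup>l\<^sub>1\<^esup> \<cdots> (f\<^bsup>(k)\<^esup>)\<^bsup>l\<^sub>k\<^esup>\<close>. Coefficients may vanish and monomials may be repeated;
  the degree is that of the formal expression.\<close>
type_synonym diff_poly = "((complex \<Rightarrow> complex) \<times> nat list) list"

definition dp_eval :: "diff_poly \<Rightarrow> (complex \<Rightarrow> complex) \<Rightarrow> complex \<Rightarrow> complex" where
  "dp_eval P f z =
     (\<Sum>(a, l)\<leftarrow>P. a z * (\<Prod>j<length l. ((deriv ^^ j) f z) ^ (l ! j)))"

text \<open>The element \<open>0\<close> only serves to give the empty sum degree \<open>0\<close>.\<close>
definition dp_degree :: "diff_poly \<Rightarrow> nat" where
  "dp_degree P = Max (insert 0 ((\<lambda>(a, l). sum_list l) ` set P))"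

end

theory Submission
  imports Defs
begin

text \<open>
  Write \<open>G = f\<^sup>n + P(f) = R e\<^sup>\<alpha>\<close> and \<open>A = G'/G = R'/R + \<alpha>'\<close>. By the lemma on the logarithmic
  derivative, \<open>A\<close> is small. Comparing \<open>G' = A G\<close> with the derivative of \<open>f\<^sup>n + P(f)\<close> gives
  \<open>f\<^sup>n\<^sup>-\<^sup>1 (n f' - A f) = A P(f) - P(f)'\<close>, so \<open>n f' - A f\<close> is small by Clunie's argument. Hence \<open>f\<close>
  satisfies a linear first-order equation over the small functions, and \<open>P(f)\<close> is an ordinary
  polynomial \<open>b f\<^sup>n\<^sup>-\<^sup>1 + \<cdots>\<close> in \<open>f\<close> with small coefficients. As \<open>f\<close> is not algebraic over the small
  functions, coefficients may be compared in \<open>G' = A G\<close>; with \<open>\<gamma> = -b/n\<close> this yields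
  \<open>n (f - \<gamma>)' = A (f - \<gamma>)\<close>, so \<open>(f - \<gamma>)\<^sup>n = c R e\<^sup>\<alpha>\<close>, and comparing leading coefficients once more
  shows \<open>c = 1\<close>.

  Since only finite exceptional measure matters, all Nevanlinna theory is carried out on circles
  on which the functions involved have neither zeros nor poles. The lemma on the logarithmic
  derivative is obtained from the Poisson-Jensen formula and Borel's growth lemma.
\<close>


subsection \<open>Exceptional sets\<close>

text \<open>Every error term must be small against T(r, f) although it arises from other functions.
  \<open>bw d g\<close> forces T(r, g) to be at most (d + 2) T(r, f) off an exceptional set, so the
  error in the lemma on the logarithmic derivative of \<open>g\<close> is of order ln T(r, f) + ln
  r. The first part is S(r, f) because T(r, f) tends to infinity, the second because T(r, f) / ln r
  does; this is where transcendence enters. That A is small rests on both of its descriptions: as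
  G'/G it has a small proximity function, as R'/R + \<alpha>' it has few poles, since \<alpha>' is
  entire. Clunie's argument bounds proximity functions only; N(r, f) = S(r, f) controls the poles of
  all differential polynomials in f, so that it yields small functions. Non-algebraicity of f is
  used in this form: the leading coefficient of a vanishing polynomial relation is zero, as
  otherwise Clunie's argument would make f small with respect to itself. All exceptional sets are
  packed into one filter, so finitely many conditions on r combine without naming their
  sets.\<close>

definition exc_filter :: "real filter" where
  "exc_filter = (INF E\<in>lmeasurable. inf at_top (principal (- E)))"

lemma eventually_exc_filter:
  "eventually P exc_filter \<longleftrightarrow> (\<exists>E\<in>lmeasurable. eventually P (inf at_top (principal (- E))))"
  unfolding exc_filter_def
proof (rule eventually_INF_base)
  show "(lmeasurable :: real set set) \<noteq> {}"
    by (metis emptyE fmeasurable.empty_sets)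
  fix a b :: "real set" assume "a \<in> lmeasurable" "b \<in> lmeasurable"
  then have "a \<union> b \<in> lmeasurable" by (rule fmeasurable.Un)
  moreover have "inf at_top (principal (- (a \<union> b))) \<le> inf (inf at_top (principal (- a))) (inf at_top (principal (- b)))"
    by (simp add: le_infI2 le_infI1 principal_le_iff)
  ultimately show "\<exists>x\<in>lmeasurable. inf at_top (principal (- x))
         \<le> inf (inf at_top (principal (- a))) (inf at_top (principal (- b)))" by blast
qed

lemma exc_filterI:
  assumes "E \<in> lmeasurable" "\<And>r. r \<ge> a \<Longrightarrow> r \<notin> E \<Longrightarrow> P r"
  shows "eventually P exc_filter"
  unfolding eventually_exc_filter eventually_inf_principal
  using assms by (intro bexI[of _ E] eventually_at_top_linorderI[of a]) auto

text \<open>A set of finite measure contains no half-line. This is what turns an eventual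
  contradiction into \<open>False\<close>.\<close>

lemma exc_filter_neq_bot [simp]: "exc_filter \<noteq> bot"
proof
  assume "exc_filter = bot"
  then have "eventually (\<lambda>_. False) exc_filter" by simp
  then obtain E :: "real set" where E: "E \<in> lmeasurable" and "eventually (\<lambda>r. r \<notin> - E) at_top"
    unfolding eventually_exc_filter eventually_inf_principal by auto
  then obtain a where a: "{a..} \<subseteq> E"
    unfolding eventually_at_top_linorder by auto
  define M where "M = \<bar>measure lebesgue E\<bar> + 1"
  have "{a..a+M} \<subseteq> E" using a by auto
  then have "measure lebesgue {a..a+M} \<le> measure lebesgue E"
    using E by (intro measure_mono_fmeasurable) auto
  then show False by (simp add: M_def)
qed

lemma exc_filter_le_at_top: "exc_filter \<le> at_top"
proof -
  have "exc_filter \<le> inf at_top (principal (- {}))"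
    unfolding exc_filter_def by (rule INF_lower) simp
  then show ?thesis by simp
qed

lemma eventually_at_top_imp_exc: "eventually P at_top \<Longrightarrow> eventually P exc_filter"
  using exc_filter_le_at_top filter_leD by blast

lemma eventually_exc_ge: "eventually (\<lambda>r. r \<ge> c) exc_filter"
  by (intro eventually_at_top_imp_exc eventually_ge_at_top)

lemma countable_exc:
  assumes "countable B"
  shows "eventually (\<lambda>r. r \<notin> B) exc_filter"
proof (rule exc_filterI)
  show "B \<in> lmeasurable"
    using assms by (simp add: countable_imp_null_set_lborel null_sets_completionI null_setsD2 fmeasurableI_null_sets)
qed auto

text \<open>A sparse set is countable, so the moduli of its points form a null set of radii. Hence
  circles carrying zeros, poles or irregular values can always be discarded.\<close>

lemma eventually_sphere_exc:
  fixes P :: "complex \<Rightarrow> bool"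
  assumes "eventually P (cosparse UNIV)"
  shows "eventually (\<lambda>r. \<forall>z\<in>sphere 0 r. P z) exc_filter"
proof -
  have "countable (norm ` {z::complex. \<not> P z})"
    using sparse_imp_countable[of UNIV "{z. \<not> P z}"] assms
    by (auto simp: eventually_cosparse)
  then have "eventually (\<lambda>r. r \<notin> norm ` {z::complex. \<not> P z}) exc_filter"
    by (rule countable_exc)
  then show ?thesis by eventually_elim auto
qed

text \<open>Continuity of measure from above: the tails of \<open>E\<close> decrease to the empty
  set.\<close>

lemma lmeasurable_tail:
  fixes E :: "real set"
  assumes "E \<in> lmeasurable" "\<epsilon> > 0"
  shows "\<exists>x. measure lebesgue (E \<inter> {x..}) < (\<epsilon>::real)"
proof -
  have fm: "E \<inter> {x..} \<in> lmeasurable" for x :: real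
    using assms(1) by (intro fmeasurable_Int_fmeasurable) auto
  have "(\<lambda>n. measure lebesgue (E \<inter> {real n..})) \<longlonglongrightarrow> measure lebesgue (\<Inter>n. E \<inter> {real n..})"
  proof (rule Lim_measure_decseq)
    show "range (\<lambda>n. E \<inter> {real n..}) \<subseteq> sets lebesgue" using fmeasurableD[OF fm] by blast
    show "emeasure lebesgue (E \<inter> {real n..}) \<noteq> \<infinity>" for n
      unfolding infinity_ennreal_def by (rule fmeasurableD2[OF fm])
  qed (auto simp: decseq_def)
  also have "(\<Inter>n. E \<inter> {real n..}) = {}"
    by (auto simp: not_le) (meson not_le reals_Archimedean2)
  finally have "\<forall>\<^sub>F n in sequentially. measure lebesgue (E \<inter> {real n..}) < \<epsilon>"
    using assms(2) by (intro order_tendstoD) auto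
  then show ?thesis by (meson eventually_happens trivial_limit_sequentially)
qed

text \<open>The exceptional sets for the countably many constants \<open>1/(n+1)\<close> are cut off so far out
  that their union still has finite measure.\<close>
lemma nev_S_iff: "nev_S g f \<longleftrightarrow> g \<in> o[exc_filter](\<lambda>r. nev_T r f)"
proof
  assume "nev_S g f"
  then obtain E where E: "E \<in> lmeasurable" "g \<in> o[inf at_top (principal (- E))](\<lambda>r. nev_T r f)"
    by (auto simp: nev_S_def)
  moreover have "exc_filter \<le> inf at_top (principal (- E))"
    unfolding exc_filter_def using E(1) by (rule INF_lower)
  ultimately show "g \<in> o[exc_filter](\<lambda>r. nev_T r f)" using landau_o.small.filter_mono by blast
next
  assume o: "g \<in> o[exc_filter](\<lambda>r. nev_T r f)"
  have "\<exists>E a. E \<in> lmeasurable \<and> (\<forall>r\<ge>a. r \<notin> E \<longrightarrow> \<bar>g r\<bar> \<le> 1 / real (Suc n) * \<bar>nev_T r f\<bar>)" for n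
    using landau_o.smallD[OF o, of "1 / real (Suc n)"]
    unfolding eventually_exc_filter eventually_inf_principal eventually_at_top_linorder by auto
  then obtain E a where E: "\<And>n. E n \<in> lmeasurable"
    "\<And>n r. r \<ge> a n \<Longrightarrow> r \<notin> E n \<Longrightarrow> \<bar>g r\<bar> \<le> 1 / real (Suc n) * \<bar>nev_T r f\<bar>" by metis
  have "\<exists>x. measure lebesgue (E n \<inter> {x..}) < (1/2) ^ n" for n
    by (rule lmeasurable_tail[OF E(1)]) simp
  then obtain x where x: "\<And>n. measure lebesgue (E n \<inter> {x n..}) < (1/2) ^ n" by metis
  define F where "F = (\<Union>n. E n \<inter> {x n..})"
  have fm: "E n \<inter> {x n..} \<in> lmeasurable" for n
    using E(1) by (intro fmeasurable_Int_fmeasurable) auto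
  have "F \<in> lmeasurable" unfolding F_def
  proof (rule fmeasurable_UN_bound)
    fix J :: "nat set" assume J: "finite J"
    have "measure lebesgue (\<Union>n\<in>J. E n \<inter> {x n..}) \<le> (\<Sum>n\<in>J. measure lebesgue (E n \<inter> {x n..}))"
      using J fm by (intro measure_UNION_le) auto
    also have "\<dots> \<le> (\<Sum>n\<in>J. (1/2) ^ n)" using x by (intro sum_mono less_imp_le)
    also have "\<dots> \<le> (\<Sum>n. (1/2) ^ n)"
      using J by (intro sum_le_suminf summable_geometric) auto
    finally show "measure lebesgue (\<Union>n\<in>J. E n \<inter> {x n..}) \<le> (\<Sum>n. (1/2) ^ n)" .
  qed (use fm in auto)
  moreover have "g \<in> o[inf at_top (principal (- F))](\<lambda>r. nev_T r f)"
  proof (rule landau_o.smallI)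
    fix c :: real assume "c > 0"
    then obtain n where n: "1 / real (Suc n) < c" using nat_approx_posE by blast
    have "\<bar>g r\<bar> \<le> c * \<bar>nev_T r f\<bar>" if "r \<ge> max (a n) (x n)" "r \<notin> F" for r
    proof -
      have "\<bar>g r\<bar> \<le> 1 / real (Suc n) * \<bar>nev_T r f\<bar>" using that by (intro E(2)) (auto simp: F_def)
      also have "\<dots> \<le> c * \<bar>nev_T r f\<bar>" using n by (intro mult_right_mono) auto
      finally show ?thesis .
    qed
    then show "\<forall>\<^sub>F r in inf at_top (principal (- F)). norm (g r) \<le> c * norm (nev_T r f)"
      unfolding eventually_inf_principal eventually_at_top_linorder
      by (intro exI[of _ "max (a n) (x n)"]) auto
  qed
  ultimately show "nev_S g f" unfolding nev_S_def by blast
qed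

lemma nev_S_mono:
  assumes "nev_S g f" "eventually (\<lambda>r. \<bar>h r\<bar> \<le> C * \<bar>g r\<bar>) exc_filter"
  shows "nev_S h f"
proof -
  have "h \<in> O[exc_filter](g)" using assms(2) by (intro bigoI[of _ C]) simp
  then show ?thesis using assms(1) landau_o.big_small_trans unfolding nev_S_iff by blast
qed

lemma nev_S_add: "nev_S g f \<Longrightarrow> nev_S h f \<Longrightarrow> nev_S (\<lambda>r. g r + h r) f"
  unfolding nev_S_iff by (rule sum_in_smallo)

lemma nev_S_cmult: "nev_S g f \<Longrightarrow> nev_S (\<lambda>r. c * g r) f"
  unfolding nev_S_iff by simp

lemma nev_S_eventually_le:
  "nev_S g f \<Longrightarrow> c > 0 \<Longrightarrow> eventually (\<lambda>r. \<bar>g r\<bar> \<le> c * \<bar>nev_T r f\<bar>) exc_filter"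
  unfolding nev_S_iff using landau_o.smallD[of g exc_filter "\<lambda>r. nev_T r f" c] by simp

subsection \<open>Means over circles\<close>

text \<open>Normalised as in \<open>nev_m\<close>, but with values in any Banach space, so that
  Cauchy's formula for complex functions and inequalities for real ones concern the same
  mean.\<close>

definition cmean :: "real \<Rightarrow> (complex \<Rightarrow> 'a::banach) \<Rightarrow> 'a" where
  "cmean r u = integral {0..2*pi} (\<lambda>t. u (rcis r t)) /\<^sub>R (2 * pi)"

lemma continuous_rcis [continuous_intros]:
  assumes "continuous_on A f"
  shows "continuous_on A (\<lambda>x. rcis r (f x))"
  unfolding rcis_def by (intro continuous_intros assms)

lemma cmean_continuous_on:
  assumes "continuous_on (sphere 0 r) u" "r \<ge> 0"
  shows "continuous_on A (\<lambda>t. u (rcis r t))"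
  by (rule continuous_on_compose2[OF assms(1)]) (auto intro!: continuous_intros simp: assms(2))

lemma cmean_integrable:
  fixes u :: "complex \<Rightarrow> 'a::banach"
  assumes "continuous_on (sphere 0 r) u" "r \<ge> 0"
  shows "(\<lambda>t. u (rcis r t)) integrable_on {0..2*pi}"
  by (intro integrable_continuous_interval cmean_continuous_on assms)

lemma cmean_cong: "r \<ge> 0 \<Longrightarrow> (\<And>z. norm z = r \<Longrightarrow> u z = v z) \<Longrightarrow> cmean r u = cmean r v"
  unfolding cmean_def by (rule arg_cong[of _ _ "\<lambda>x. x /\<^sub>R _"], rule integral_cong) auto

lemma cmean_const [simp]: "cmean r (\<lambda>_. c) = c"
  by (simp add: cmean_def)

lemma cmean_add:
  assumes "r \<ge> 0" "continuous_on (sphere 0 r) u" "continuous_on (sphere 0 r) v"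
  shows "cmean r (\<lambda>z. u z + v z) = cmean r u + cmean r v"
  unfolding cmean_def using cmean_integrable[OF assms(2,1)] cmean_integrable[OF assms(3,1)]
  by (simp add: integral_add scaleR_add_right)

lemma cmean_diff:
  assumes "r \<ge> 0" "continuous_on (sphere 0 r) u" "continuous_on (sphere 0 r) v"
  shows "cmean r (\<lambda>z. u z - v z) = cmean r u - cmean r v"
  unfolding cmean_def using cmean_integrable[OF assms(2,1)] cmean_integrable[OF assms(3,1)]
  by (simp add: integral_diff scaleR_diff_right)

lemma cmean_cmult: "cmean r (\<lambda>z. c * u z) = c * cmean r u" for c :: "'a :: {real_normed_field, banach}"
  unfolding cmean_def by simp

lemma cmean_sum:
  assumes "r \<ge> 0" "\<And>a. a \<in> A \<Longrightarrow> continuous_on (sphere 0 r) (u a)"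
  shows "cmean r (\<lambda>z. \<Sum>a\<in>A. u a z) = (\<Sum>a\<in>A. cmean r (u a))"
  using assms(2)
proof (induction A rule: infinite_finite_induct)
  case (insert x F)
  then show ?case using assms(1) by (simp add: cmean_add continuous_on_sum)
qed auto

lemma cmean_mono:
  fixes u v :: "complex \<Rightarrow> real"
  assumes "r \<ge> 0" "continuous_on (sphere 0 r) u" "continuous_on (sphere 0 r) v"
    "\<And>z. norm z = r \<Longrightarrow> u z \<le> v z"
  shows "cmean r u \<le> cmean r v"
proof -
  have "integral {0..2*pi} (\<lambda>t. u (rcis r t)) \<le> integral {0..2*pi} (\<lambda>t. v (rcis r t))"
    by (rule integral_le[OF cmean_integrable[OF assms(2,1)] cmean_integrable[OF assms(3,1)]])
       (use assms in auto)
  then show ?thesis unfolding cmean_def by (simp add: divide_right_mono)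
qed

lemma cmean_nonneg:
  fixes u :: "complex \<Rightarrow> real"
  assumes "r \<ge> 0" "continuous_on (sphere 0 r) u" "\<And>z. norm z = r \<Longrightarrow> u z \<ge> 0"
  shows "cmean r u \<ge> 0"
  using cmean_mono[of r "\<lambda>_. 0" u] assms by auto

lemma cmean_bounded_linear:
  assumes "r \<ge> 0" "continuous_on (sphere 0 r) u" "bounded_linear F"
  shows "cmean r (\<lambda>z. F (u z)) = F (cmean r u)"
proof -
  have "integral {0..2*pi} (F \<circ> (\<lambda>t. u (rcis r t))) = F (integral {0..2*pi} (\<lambda>t. u (rcis r t)))"
    using integral_linear[OF cmean_integrable[OF assms(2,1)] assms(3)] .
  then show ?thesis
    by (simp add: cmean_def o_def linear_simps[OF assms(3)])
qed

lemmas cmean_Re = cmean_bounded_linear[OF _ _ bounded_linear_Re]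
lemmas cmean_cnj = cmean_bounded_linear[OF _ _ bounded_linear_cnj]

lemma norm_cmean_le:
  fixes u :: "complex \<Rightarrow> 'a::banach"
  assumes "r \<ge> 0" "continuous_on (sphere 0 r) u" "continuous_on (sphere 0 r) v"
    "\<And>z. norm z = r \<Longrightarrow> norm (u z) \<le> v z"
  shows "norm (cmean r u) \<le> cmean r v"
proof -
  have "norm (integral {0..2*pi} (\<lambda>t. u (rcis r t))) \<le> integral {0..2*pi} (\<lambda>t. v (rcis r t))"
    by (rule integral_norm_bound_integral[OF cmean_integrable[OF assms(2,1)] cmean_integrable[OF assms(3,1)]])
       (use assms in auto)
  then show ?thesis unfolding cmean_def by (simp add: divide_right_mono)
qed

text \<open>On the circle dw = i w dt, which explains the extra factor \<open>w\<close>.\<close>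

lemma cmean_contour:
  assumes "(g has_contour_integral I) (circlepath 0 r)"
  shows "cmean r (\<lambda>w. w * g w) = I / (2 * of_real pi * \<i>)"
proof -
  have "((\<lambda>t. g (0 + of_real r * cis t) * of_real r * \<i> * cis t) has_integral I) {0..2*pi}"
    using assms has_contour_integral_part_circlepath_iff[of 0 "2*pi" g I 0 r]
    by (simp add: circlepath_def)
  then have "((\<lambda>t. (1/\<i>) * (g (0 + of_real r * cis t) * of_real r * \<i> * cis t)) has_integral (1/\<i>) * I) {0..2*pi}"
    by (rule has_integral_mult_right)
  then have "((\<lambda>t. rcis r t * g (rcis r t)) has_integral I / \<i>) {0..2*pi}"
    by (simp add: rcis_def mult_ac)
  then have "integral {0..2*pi} (\<lambda>t. rcis r t * g (rcis r t)) = I / \<i>"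
    by (rule integral_unique)
  moreover have "\<i> * (\<i> * I) = - I" by (simp add: mult.assoc[symmetric])
  ultimately show ?thesis unfolding cmean_def
    by (simp add: scaleR_conv_of_real divide_simps mult_ac)
qed

lemma cmean_Cauchy:
  assumes "h holomorphic_on cball 0 r" "norm z < r"
  shows "cmean r (\<lambda>w. h w * (w / (w - z))) = h z"
proof -
  have "((\<lambda>u. h u/(u-z)) has_contour_integral (2 * of_real pi * \<i> * h z)) (circlepath 0 r)"
    using assms by (intro Cauchy_integral_circlepath_simple) auto
  from cmean_contour[OF this] show ?thesis by (simp add: mult_ac)
qed

lemma cmean_holomorphic:
  assumes "h holomorphic_on cball 0 r" "0 < r"
  shows "cmean r h = h 0"
proof -
  have "cmean r h = cmean r (\<lambda>w. h w * (w / (w - 0)))"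
    by (rule cmean_cong) (use assms in auto)
  then show ?thesis using cmean_Cauchy[of h r 0] assms by simp
qed

lemma cmean_Cauchy_deriv:
  assumes "h holomorphic_on cball 0 r" "norm z < r"
  shows "cmean r (\<lambda>w. h w * (w / (w - z)\<^sup>2)) = deriv h z"
proof -
  have "((\<lambda>u. h u/(u-z)^Suc 1) has_contour_integral ((2 * pi * \<i>) / fact 1 * (deriv ^^ 1) h z)) (circlepath 0 r)"
    using assms
    by (intro Cauchy_has_contour_integral_higher_derivative_circlepath holomorphic_on_imp_continuous_on)
       (auto intro: holomorphic_on_subset)
  from cmean_contour[OF this] show ?thesis by (simp add: mult_ac power2_eq_square)
qed

subsection \<open>The Poisson and Schwarz formulas\<close>

text \<open>The Poisson kernel. For \<open>norm w = r\<close> it equals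
  \<open>(r\<^sup>2 - (norm z)\<^sup>2) / (norm (w - z))\<^sup>2\<close>; the present form shows it
  as the real part of a function holomorphic in \<open>z\<close>.\<close>

definition poiss :: "complex \<Rightarrow> complex \<Rightarrow> real" where
  "poiss z w = Re ((w + z) / (w - z))"

text \<open>Splits the kernel into a Cauchy kernel, which reproduces holomorphic functions, and its
  conjugate, which on a circle can be rewritten as a holomorphic function of
  \<open>w\<close>.\<close>

lemma of_real_poiss: "w \<noteq> z \<Longrightarrow> complex_of_real (poiss z w) = w / (w - z) + cnj (w / (w - z)) - 1"
proof -
  assume "w \<noteq> z"
  then have "(w + z) / (w - z) = 2 * (w / (w - z)) - 1" by (simp add: field_simps)
  moreover have "Re (2 * x - 1) = 2 * Re x - 1" for x by simp
  ultimately have "poiss z w = 2 * Re (w / (w - z)) - 1" by (simp only: poiss_def)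
  then show ?thesis by (simp only: complex_add_cnj) simp
qed

lemma cnj_on_circle:
  assumes "norm w = r" "r > 0"
  shows "cnj w = of_real (r\<^sup>2) / w"
  using assms complex_norm_square[of w] by (auto simp: field_simps)

text \<open>For \<open>a\<close> other than \<open>0\<close> the only zero in \<open>z\<close> is
  the reflection of \<open>a\<close> in the circle, which lies outside the closed disc.\<close>

lemma denom_nz:
  assumes "norm a < r" "norm z \<le> r"
  shows "of_real (r\<^sup>2) - cnj a * z \<noteq> 0"
proof
  assume "of_real (r\<^sup>2) - cnj a * z = 0"
  then have "norm (complex_of_real (r\<^sup>2)) = norm (cnj a * z)" by simp
  then have e: "r\<^sup>2 = norm a * norm z" by (simp add: norm_mult norm_power)
  have "r > 0" using assms norm_ge_zero[of a] by linarith
  have "norm a * norm z \<le> norm a * r" using assms by (intro mult_left_mono) auto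
  also have "\<dots> < r * r" using assms \<open>r > 0\<close> by (intro mult_strict_right_mono) auto
  finally show False using e by (simp add: power2_eq_square)
qed

text \<open>On the circle \<open>cnj w = r\<^sup>2 / w\<close>, so the conjugate Cauchy kernel
  becomes \<open>r\<^sup>2 / (r\<^sup>2 - cnj z * w)\<close>, holomorphic on the disc with value
  \<open>1\<close> at the origin. Its contribution \<open>k 0 = h 0\<close> cancels against the mean
  of \<open>h\<close>.\<close>

lemma cmean_poiss:
  assumes "h holomorphic_on cball 0 r" "norm z < r"
  shows "cmean r (\<lambda>w. of_real (poiss z w) * h w) = h z"
proof -
  have r: "r > 0" using assms norm_ge_zero[of z] by linarith
  have nz: "of_real (r\<^sup>2) - cnj z * w \<noteq> 0" if "norm w \<le> r" for w :: complex
    using denom_nz assms(2) that by blast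
  define k where "k = (\<lambda>w. h w * (of_real (r\<^sup>2) / (of_real (r\<^sup>2) - cnj z * w)))"
  have k: "k holomorphic_on cball 0 r"
    unfolding k_def using nz by (intro holomorphic_intros assms) auto
  have c0: "continuous_on (sphere 0 r) h" "continuous_on (sphere 0 r) k"
    using assms(1) k by (auto intro!: holomorphic_on_imp_continuous_on intro: holomorphic_on_subset)
  have c1: "continuous_on (sphere 0 r) (\<lambda>w. h w * (w / (w - z)))"
    using assms(2) by (intro continuous_intros c0) auto
  have "cmean r (\<lambda>w. of_real (poiss z w) * h w) = cmean r (\<lambda>w. h w * (w / (w - z)) + k w - h w)"
  proof (rule cmean_cong)
    fix w :: complex assume w: "norm w = r"
    then have "w \<noteq> z" "w \<noteq> 0" using assms r by auto
    have "cnj (w / (w - z)) = of_real (r\<^sup>2) / (of_real (r\<^sup>2) - cnj z * w)"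
      using cnj_on_circle[OF w r] \<open>w \<noteq> 0\<close> nz[of w] w \<open>w \<noteq> z\<close>
      by (simp add: field_simps)
    moreover have "(A + B - 1) * H = H * A + H * B - H" for A B H :: complex
      by (simp add: algebra_simps)
    ultimately show "of_real (poiss z w) * h w = h w * (w / (w - z)) + k w - h w"
      using of_real_poiss[OF \<open>w \<noteq> z\<close>] by (simp only: k_def)
  qed (use r in auto)
  also have "\<dots> = cmean r (\<lambda>w. h w * (w / (w - z)) + k w) - cmean r h"
    using r c0 c1 by (intro cmean_diff continuous_on_add) auto
  also have "cmean r (\<lambda>w. h w * (w / (w - z)) + k w) = cmean r (\<lambda>w. h w * (w / (w - z))) + cmean r k"
    using r c0 c1 by (intro cmean_add) auto
  also have "\<dots> - cmean r h = h z + h 0 - h 0"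
    using r cmean_Cauchy[OF assms] cmean_holomorphic[OF assms(1) r] cmean_holomorphic[OF k r]
    by (simp only:) (simp add: k_def)
  finally show ?thesis by simp
qed

text \<open>Writes 2 Re h as h plus its conjugate. The first part is Cauchy's formula for the
  derivative; the second is the conjugate of the mean of a holomorphic \<open>k\<close> with
  \<open>k 0 = 0\<close>. Only the real part of \<open>h\<close> on the circle enters, later ln
  |f|.\<close>

lemma cmean_Schwarz_deriv:
  assumes "h holomorphic_on cball 0 r" "norm z < r"
  shows "cmean r (\<lambda>w. of_real (2 * Re (h w)) * (w / (w - z)\<^sup>2)) = deriv h z"
proof -
  have r: "r > 0" using assms norm_ge_zero[of z] by linarith
  have nz: "of_real (r\<^sup>2) - cnj z * w \<noteq> 0" if "norm w \<le> r" for w :: complex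
    using denom_nz assms(2) that by blast
  define k where "k = (\<lambda>w. h w * (of_real (r\<^sup>2) * w / (of_real (r\<^sup>2) - cnj z * w)\<^sup>2))"
  have k: "k holomorphic_on cball 0 r"
    unfolding k_def using nz by (intro holomorphic_intros assms) auto
  have c0: "continuous_on (sphere 0 r) h" "continuous_on (sphere 0 r) k"
    using assms(1) k by (auto intro!: holomorphic_on_imp_continuous_on intro: holomorphic_on_subset)
  have c1: "continuous_on (sphere 0 r) (\<lambda>w. h w * (w / (w - z)\<^sup>2))"
    using assms(2) by (intro continuous_intros c0) auto
  have c2: "continuous_on (sphere 0 r) (\<lambda>w. cnj (k w))"
    by (intro continuous_intros c0)
  have "cmean r (\<lambda>w. of_real (2 * Re (h w)) * (w / (w - z)\<^sup>2)) = cmean r (\<lambda>w. h w * (w / (w - z)\<^sup>2) + cnj (k w))"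
  proof (rule cmean_cong)
    fix w :: complex assume w: "norm w = r"
    then have "w \<noteq> z" "w \<noteq> 0" using assms r by auto
    have "cnj (w / (w - z)\<^sup>2) = of_real (r\<^sup>2) * w / (of_real (r\<^sup>2) - cnj z * w)\<^sup>2"
    proof -
      have "cnj (w / (w - z)\<^sup>2) = (of_real (r\<^sup>2) / w) / (of_real (r\<^sup>2) / w - cnj z)\<^sup>2"
        using cnj_on_circle[OF w r] by simp
      also have "of_real (r\<^sup>2) / w - cnj z = (of_real (r\<^sup>2) - cnj z * w) / w"
        using \<open>w \<noteq> 0\<close> by (simp add: field_simps)
      also have "(of_real (r\<^sup>2) / w) / ((of_real (r\<^sup>2) - cnj z * w) / w)\<^sup>2 = of_real (r\<^sup>2) * w / (of_real (r\<^sup>2) - cnj z * w)\<^sup>2"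
        using \<open>w \<noteq> 0\<close> by (simp add: power2_eq_square)
      finally show ?thesis .
    qed
    then have "cnj (of_real (r\<^sup>2) * w / (of_real (r\<^sup>2) - cnj z * w)\<^sup>2) = w / (w - z)\<^sup>2"
      by (metis complex_cnj_cnj)
    then have "cnj (k w) = cnj (h w) * (w / (w - z)\<^sup>2)"
      unfolding k_def complex_cnj_mult by simp
    moreover have "of_real (2 * Re (h w)) = h w + cnj (h w)"
      by (simp add: complex_add_cnj)
    ultimately show "of_real (2 * Re (h w)) * (w / (w - z)\<^sup>2) = h w * (w / (w - z)\<^sup>2) + cnj (k w)"
      by (simp only: distrib_right)
  qed (use r in auto)
  also have "\<dots> = deriv h z + cnj (cmean r k)"
    using r cmean_Cauchy_deriv[OF assms] cmean_cnj[OF _ c0(2)]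
    by (subst cmean_add[OF _ c1 c2]) auto
  also have "cmean r k = 0" using cmean_holomorphic[OF k r] by (simp add: k_def)
  finally show ?thesis by simp
qed

section \<open>Zero-free holomorphic functions on a disc\<close>

lemma zero_free_exp:
  assumes "g holomorphic_on ball 0 R" "\<And>z. z \<in> ball 0 R \<Longrightarrow> g z \<noteq> 0"
  obtains h where "h holomorphic_on ball 0 R" "\<And>z. z \<in> ball 0 R \<Longrightarrow> g z = exp (h z)"
proof -
  have "simply_connected (ball (0::complex) R)" by (simp add: convex_imp_simply_connected)
  then show ?thesis
    using simply_connected_eq_holomorphic_log[of "ball 0 R"] assms that by (metis open_ball)
qed

text \<open>The two kernel formulas are applied to a holomorphic logarithm \<open>h\<close> of
  \<open>g\<close>: its real part is ln |g| and its derivative is g'/g.\<close>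

lemma zero_free_poisson:
  assumes "g holomorphic_on ball 0 R" "\<And>z. z \<in> ball 0 R \<Longrightarrow> g z \<noteq> 0" "r < R" "norm z < r"
  shows "ln (norm (g z)) = cmean r (\<lambda>w. poiss z w * ln (norm (g w)))" (is ?A)
    and "deriv g z / g z = cmean r (\<lambda>w. of_real (2 * ln (norm (g w))) * (w / (w - z)\<^sup>2))" (is ?B)
proof -
  obtain h where h: "h holomorphic_on ball 0 R" "\<And>z. z \<in> ball 0 R \<Longrightarrow> g z = exp (h z)"
    using zero_free_exp assms by blast
  have r: "r > 0" using assms norm_ge_zero[of z] by linarith
  have hol: "h holomorphic_on cball 0 r" using h assms(3) by (auto intro: holomorphic_on_subset)
  have ln: "ln (norm (g w)) = Re (h w)" if "norm w \<le> r" for w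
    using h(2)[of w] that assms(3) by simp
  have c0: "continuous_on (sphere 0 r) h"
    using hol by (auto intro!: holomorphic_on_imp_continuous_on intro: holomorphic_on_subset)
  have "Re (h z) = Re (cmean r (\<lambda>w. of_real (poiss z w) * h w))"
    using cmean_poiss[OF hol assms(4)] by simp
  also have "\<dots> = cmean r (\<lambda>w. Re (of_real (poiss z w) * h w))"
    using r assms(4) unfolding poiss_def by (intro cmean_Re[symmetric] continuous_intros c0) auto
  also have "\<dots> = cmean r (\<lambda>w. poiss z w * ln (norm (g w)))"
    by (rule cmean_cong) (use r ln in auto)
  finally show ?A using ln[of z] assms by simp
  have "deriv h z = cmean r (\<lambda>w. of_real (2 * Re (h w)) * (w / (w - z)\<^sup>2))"
    using cmean_Schwarz_deriv[OF hol assms(4)] by simp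
  also have "\<dots> = cmean r (\<lambda>w. of_real (2 * ln (norm (g w))) * (w / (w - z)\<^sup>2))"
    by (rule cmean_cong) (use r ln in auto)
  finally have d: "deriv h z = \<dots>" .
  have zb: "z \<in> ball 0 R" using assms by simp
  have "(h has_field_derivative deriv h z) (at z)"
    using h(1) zb by (auto intro: holomorphic_derivI)
  then have "((\<lambda>z. exp (h z)) has_field_derivative exp (h z) * deriv h z) (at z)"
    by (auto intro!: derivative_eq_intros)
  then have "(g has_field_derivative exp (h z) * deriv h z) (at z)"
    by (rule has_field_derivative_transform_within_open[OF _ open_ball zb]) (use h in auto)
  then have "deriv g z = exp (h z) * deriv h z" by (rule DERIV_imp_deriv)
  then show ?B using d h(2)[OF zb] by simp
qed

text \<open>At the origin the Poisson kernel is constantly \<open>1\<close>.\<close>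

lemma zero_free_mean:
  assumes "g holomorphic_on ball 0 R" "\<And>z. z \<in> ball 0 R \<Longrightarrow> g z \<noteq> 0" "r < R" "0 < r"
  shows "cmean r (\<lambda>w. ln (norm (g w))) = ln (norm (g 0))"
proof -
  have "cmean r (\<lambda>w. poiss 0 w * ln (norm (g w))) = cmean r (\<lambda>w. ln (norm (g w)))"
    by (rule cmean_cong) (use assms in \<open>auto simp: poiss_def\<close>)
  then show ?thesis using zero_free_poisson(1)[OF assms(1-3), of 0] assms(4) by simp
qed

lemma poiss_nonneg_le:
  assumes "norm z < r" "norm w = r"
  shows "poiss z w \<ge> 0" "poiss z w \<le> (r + norm z) / (r - norm z)"
proof -
  have "w \<noteq> z" using assms by auto
  have "poiss z w = (r\<^sup>2 - (norm z)\<^sup>2) / (norm (w - z))\<^sup>2"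
  proof -
    have "Re (cnj (w - z) * (w + z)) = (norm w)\<^sup>2 - (norm z)\<^sup>2"
      unfolding cmod_power2 by (simp add: power2_eq_square algebra_simps)
    moreover have "(w + z) / (w - z) = (cnj (w - z) * (w + z)) / of_real ((norm (w - z))\<^sup>2)"
    proof -
      have "complex_of_real ((norm (w - z))\<^sup>2) = (w - z) * cnj (w - z)"
        using complex_norm_square[of "w - z"] by simp
      then show ?thesis using \<open>w \<noteq> z\<close> by (simp only:) simp
    qed
    ultimately show ?thesis unfolding poiss_def
      by (metis Re_divide_of_real assms(2))
  qed
  moreover have "norm z ^ 2 \<le> r\<^sup>2" using assms by (intro power_mono) auto
  ultimately show "poiss z w \<ge> 0" by simp
  have "poiss z w \<le> norm ((w + z) / (w - z))" unfolding poiss_def by (rule complex_Re_le_cmod)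
  also have "\<dots> = norm (w + z) / norm (w - z)" by (simp add: norm_divide)
  also have "\<dots> \<le> (r + norm z) / (r - norm z)"
    using assms norm_triangle_ineq[of w z] norm_triangle_ineq2[of w z] by (intro frac_le) auto
  finally show "poiss z w \<le> (r + norm z) / (r - norm z)" .
qed

text \<open>If \<open>b\<close> lies outside the circle, \<open>z - b\<close> is zero-free on the
  disc. If it lies inside, |z - b| agrees on the circle with |r^2 - cnj b * z| / r, whose zero is
  the reflected point outside.\<close>

lemma cmean_ln_dist:
  assumes "r > 0" "norm b \<noteq> r"
  shows "cmean r (\<lambda>z. ln (norm (z - b))) = ln (max r (norm b))"
proof (cases "norm b > r")
  case True
  have "cmean r (\<lambda>z. ln (norm (z - b))) = ln (norm (0 - b))"
    by (rule zero_free_mean[of _ "norm b"]) (use True assms in \<open>auto intro!: holomorphic_intros\<close>)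
  then show ?thesis using True by simp
next
  case False
  then have b: "norm b < r" using assms by simp
  define g where "g = (\<lambda>z. of_real (r\<^sup>2) - cnj b * z)"
  \<comment> \<open>\<open>R\<close> is the modulus of the zero of \<open>g\<close>; for
    \<open>b = 0\<close> the function \<open>g\<close> is constant and any radius beyond
    \<open>r\<close> serves.\<close>
  define R where "R = (if b = 0 then r + 1 else r\<^sup>2 / norm b)"
  have "cmean r (\<lambda>z. ln (norm (z - b))) = cmean r (\<lambda>z. ln (norm (g z)) + (- ln r))"
  proof (rule cmean_cong)
    fix z :: complex assume z: "norm z = r"
    then have "z \<noteq> 0" using assms by auto
    have "norm (z - b) = norm (cnj z - cnj b)" by (metis complex_cnj_diff complex_mod_cnj)
    also have "cnj z - cnj b = g z / z"
      using cnj_on_circle[OF z assms(1)] \<open>z \<noteq> 0\<close> by (simp add: g_def field_simps)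
    finally have "norm (z - b) = norm (g z) / r" using z by (simp add: norm_divide)
    moreover have "g z \<noteq> 0" unfolding g_def using denom_nz[OF b] z by auto
    ultimately show "ln (norm (z - b)) = ln (norm (g z)) + (- ln r)"
      using assms by (simp add: ln_div)
  qed (use assms in auto)
  also have "\<dots> = cmean r (\<lambda>z. ln (norm (g z))) - ln r"
    using assms denom_nz[OF b] unfolding g_def
    by (subst cmean_add) (auto intro!: continuous_intros)
  also have "cmean r (\<lambda>z. ln (norm (g z))) = ln (norm (g 0))"
  proof (rule zero_free_mean[of _ R])
    show "g holomorphic_on ball 0 R" unfolding g_def by (intro holomorphic_intros)
    show "r < R"
      using b assms by (auto simp: R_def power2_eq_square field_simps)
    fix z :: complex assume "z \<in> ball 0 R"
    then have "norm (cnj b * z) < r\<^sup>2"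
      using assms by (auto simp: R_def norm_mult field_simps split: if_splits)
    then show "g z \<noteq> 0" unfolding g_def
      by (metis abs_power2 eq_iff_diff_eq_0 less_irrefl norm_of_real)
  qed (use assms in auto)
  finally show ?thesis using b assms by (simp add: g_def ln_mult power2_eq_square norm_mult)
qed

subsection \<open>Orders of meromorphic functions\<close>

text \<open>Unlike \<open>zorder\<close>, this order is \<open>0\<close> (and not junk) for functions vanishing near the point.\<close>
definition mord :: "(complex \<Rightarrow> complex) \<Rightarrow> complex \<Rightarrow> int" where
  "mord f z = fls_subdegree (laurent_expansion f z)"

abbreviation mero :: "(complex \<Rightarrow> complex) \<Rightarrow> bool" where
  "mero f \<equiv> f meromorphic_on UNIV"

abbreviation nonz :: "(complex \<Rightarrow> complex) \<Rightarrow> bool" where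
  "nonz f \<equiv> (\<forall>\<^sub>\<approx>z. f z \<noteq> 0)"

lemma laurent_UNIV:
  assumes "mero f"
  shows "(\<lambda>w. f (z + w)) has_laurent_expansion laurent_expansion f z"
  using assms meromorphic_on_imp_has_laurent_expansion by blast

lemma mord_eqI: "(\<lambda>w. f (z + w)) has_laurent_expansion F \<Longrightarrow> mord f z = fls_subdegree F"
  by (simp add: mord_def laurent_expansion_eqI)

lemma cosparse_at: "eventually P (cosparse UNIV) \<Longrightarrow> eventually P (at (z::complex))"
  using eventually_cosparse_imp_eventually_at[of P UNIV z UNIV] by simp

lemma mord_cong: "\<forall>\<^sub>\<approx>z. f z = g z \<Longrightarrow> mord f z = mord g z"
  unfolding mord_def using laurent_expansion_cong[OF cosparse_at] by metis

lemma laurent_nonzero: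
  assumes "mero f" "nonz f"
  shows "laurent_expansion f z \<noteq> 0"
  using cosparse_at[OF assms(2)] has_laurent_expansion_eventually_nonzero_iff[OF laurent_UNIV[OF assms(1)]]
  by blast

lemma nonz_or_zero:
  assumes "mero f"
  shows "(\<forall>\<^sub>\<approx>z. f z = 0) \<or> nonz f"
  using meromorphic_imp_constant_or_avoid[OF assms] by auto

lemma nonz_mult: "nonz f \<Longrightarrow> nonz g \<Longrightarrow> nonz (\<lambda>z. f z * g z)"
  by (erule (1) eventually_elim2) simp

lemma nonz_inverse: "nonz f \<Longrightarrow> nonz (\<lambda>z. inverse (f z))"
  by (auto elim: eventually_mono)

lemma mord_mult:
  assumes "mero f" "mero g" "nonz f" "nonz g"
  shows "mord (\<lambda>z. f z * g z) z = mord f z + mord g z"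
proof -
  have "mord (\<lambda>z. f z * g z) z = fls_subdegree (laurent_expansion f z * laurent_expansion g z)"
    using assms by (intro mord_eqI laurent_expansion_intros laurent_UNIV)
  then show ?thesis using laurent_nonzero assms by (simp add: mord_def)
qed

lemma mord_powi: "mero f \<Longrightarrow> mord (\<lambda>z. f z powi n) z = n * mord f z"
  using mord_eqI[OF has_laurent_expansion_power_int[OF laurent_UNIV], of f] by (simp add: mord_def)

lemma mord_power: "mero f \<Longrightarrow> mord (\<lambda>z. f z ^ n) z = int n * mord f z"
  using mord_powi[of f "int n"] by simp

lemma mord_inverse: "mero f \<Longrightarrow> mord (\<lambda>z. inverse (f z)) z = - mord f z"
  using mord_eqI[OF has_laurent_expansion_inverse[OF laurent_UNIV], of f] by (simp add: mord_def)

lemma mord_prod: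
  assumes "finite A" "\<And>a. a \<in> A \<Longrightarrow> mero (f a)" "\<And>a. a \<in> A \<Longrightarrow> nonz (f a)"
  shows "mord (\<lambda>z. \<Prod>a\<in>A. f a z) z = (\<Sum>a\<in>A. mord (f a) z) \<and> nonz (\<lambda>z. \<Prod>a\<in>A. f a z)"
  using assms
proof (induction A rule: finite_induct)
  case empty
  have "mord (\<lambda>z. 1) z = fls_subdegree (1 :: complex fls)" by (intro mord_eqI laurent_expansion_intros)
  then show ?case by simp
next
  case (insert a A)
  have "mord (\<lambda>z. f a z * (\<Prod>a\<in>A. f a z)) z = mord (f a) z + mord (\<lambda>z. \<Prod>a\<in>A. f a z) z"
    using insert by (intro mord_mult meromorphic_intros) auto
  moreover have "nonz (\<lambda>z. f a z * (\<Prod>a\<in>A. f a z))"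
    using insert by (intro nonz_mult) auto
  ultimately show ?case using insert by simp
qed

lemma mord_analytic_nz:
  assumes "f analytic_on {z}" "f z \<noteq> 0"
  shows "mord f z = 0"
proof -
  have L: "(\<lambda>w. f (z + w)) has_laurent_expansion fps_to_fls (fps_expansion f z)"
    using assms(1) by (simp add: analytic_at_imp_has_fps_expansion has_laurent_expansion_fps)
  have "fps_nth (fps_expansion f z) 0 = f z" by (simp add: fps_expansion_def)
  then show ?thesis using mord_eqI[OF L] assms(2) by (simp add: fls_subdegree_fls_to_fps)
qed

lemma mord_analytic_nonneg:
  assumes "f analytic_on {z}"
  shows "mord f z \<ge> 0"
proof -
  have L: "(\<lambda>w. f (z + w)) has_laurent_expansion fps_to_fls (fps_expansion f z)"
    using assms(1) by (simp add: analytic_at_imp_has_fps_expansion has_laurent_expansion_fps)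
  then show ?thesis using mord_eqI[OF L] by (simp add: fls_subdegree_fls_to_fps)
qed

lemma is_pole_iff_mord: "mero f \<Longrightarrow> is_pole f z \<longleftrightarrow> mord f z < 0"
  using has_laurent_expansion_imp_is_pole_iff[OF laurent_UNIV[of f z]] by (simp add: mord_def)

lemma zorder_eq_mord: "mero f \<Longrightarrow> mord f z \<noteq> 0 \<Longrightarrow> zorder f z = mord f z"
  using has_laurent_expansion_zorder[OF laurent_UNIV[of f z]] by (cases "laurent_expansion f z = 0") (auto simp: mord_def)

lemma mord_sparse:
  assumes "mero f"
  shows "\<forall>\<^sub>\<approx>z. mord f z = 0"
  using nonz_or_zero[OF assms]
proof
  assume "nonz f"
  then show ?thesis using meromorphic_on_imp_analytic_cosparse[OF assms]
    by eventually_elim (rule mord_analytic_nz)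
next
  assume "\<forall>\<^sub>\<approx>z. f z = 0"
  then have "mord f z = mord (\<lambda>_. 0) z" for z by (rule mord_cong)
  moreover have "mord (\<lambda>_. 0) z = 0" for z
    using mord_eqI[of "\<lambda>_. 0" z 0] by simp
  ultimately show ?thesis by simp
qed

lemma finite_mord:
  assumes "mero f"
  shows "finite {a \<in> cball 0 r. mord f a \<noteq> 0}"
proof -
  have "{a. mord f a \<noteq> 0} sparse_in UNIV" using mord_sparse[OF assms] by (simp add: eventually_cosparse)
  then have "{a. mord f a \<noteq> 0} sparse_in cball 0 r"
    by (rule sparse_in_subset[OF _ subset_UNIV])
  then have "finite (cball 0 r \<inter> {a. mord f a \<noteq> 0})"
    by (rule sparse_in_compact_finite[OF _ compact_cball])
  moreover have "{a \<in> cball 0 r. mord f a \<noteq> 0} = cball 0 r \<inter> {a. mord f a \<noteq> 0}" by blast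
  ultimately show ?thesis by (simp only:)
qed

text \<open>Order \<open>0\<close> of a function that is not identically zero means that its Laurent
  series starts with a nonzero constant term.\<close>

lemma mord_0_removable:
  assumes "mero f" "nonz f" "mord f z = 0"
  shows "remove_sings f analytic_on {z}" "remove_sings f z \<noteq> 0"
proof -
  have m: "f meromorphic_on {z}" using assms meromorphic_on_subset by blast
  then have i: "isolated_singularity_at f z" "not_essential f z"
    by (auto simp: meromorphic_at_iff)
  have np: "\<not> is_pole f z" using is_pole_iff_mord[OF assms(1)] assms(3) by simp
  then obtain c where c: "f \<midarrow>z\<rightarrow> c" using i by (auto simp: not_essential_def)
  then show "remove_sings f analytic_on {z}" using i remove_sings_analytic_at by blast
  have "\<not> f \<midarrow>z\<rightarrow> 0"
    using tendsto_0_subdegree_iff[OF laurent_UNIV[OF assms(1)] laurent_nonzero[OF assms(1,2)], of z] assms(3)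
    by (simp add: mord_def)
  then show "remove_sings f z \<noteq> 0" using np i remove_sings_eq_0_iff by blast
qed

text \<open>Both values are limits along a punctured neighbourhood, on which the functions agree.
  This passes from identities off a sparse set to identities at a given regular point.\<close>

lemma analytic_cosparse_eq:
  assumes "\<forall>\<^sub>\<approx>z. f z = g z" "f analytic_on {z}" "g analytic_on {z}"
  shows "f z = g z"
proof -
  have "(f \<longlongrightarrow> f z) (at z)" "(g \<longlongrightarrow> g z) (at z)"
    using assms(2,3) by (auto intro: isContD analytic_at_imp_isCont)
  moreover have "(g \<longlongrightarrow> f z) (at z)"
    by (rule Lim_transform_eventually[OF calculation(1) cosparse_at[OF assms(1)]])
  ultimately show ?thesis using tendsto_unique[OF at_neq_bot] by blast
qed

lemma ln_power_int_pos: "x > 0 \<Longrightarrow> ln (x powi k) = of_int k * ln (x::real)"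
  by (cases "k \<ge> 0") (auto simp: power_int_def ln_realpow ln_inverse)

subsection \<open>Blaschke factorization on a disc\<close>

text \<open>The Blaschke factor of the disc of radius \<open>r\<close>: modulus one on the circle,
  and in the closed disc a single simple zero at \<open>a\<close>.\<close>

definition blaschke :: "real \<Rightarrow> complex \<Rightarrow> complex \<Rightarrow> complex" where
  "blaschke r a z = of_real r * (z - a) / (of_real (r\<^sup>2) - cnj a * z)"

lemma norm_blaschke_circle:
  assumes "norm a < r" "norm z = r"
  shows "norm (blaschke r a z) = 1"
proof -
  have r: "r > 0" using assms norm_ge_zero[of a] by linarith
  then have "z \<noteq> 0" "z \<noteq> a" using assms by auto
  have "of_real (r\<^sup>2) - cnj a * z = z * cnj (z - a)"
    using complex_norm_square[of z] assms by (simp add: algebra_simps)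
  then have "norm (of_real (r\<^sup>2) - cnj a * z) = r * norm (z - a)"
    using assms by (simp add: norm_mult flip: complex_cnj_diff)
  then show ?thesis using r \<open>z \<noteq> a\<close> by (simp add: blaschke_def norm_divide norm_mult)
qed

text \<open>The squares of the moduli of denominator and numerator differ by \<open>(r\<^sup>2 -
  (norm a)\<^sup>2) * (r\<^sup>2 - (norm z)\<^sup>2)\<close>.\<close>

lemma norm_blaschke_le:
  assumes "norm a < r" "norm z \<le> r"
  shows "norm (blaschke r a z) \<le> 1"
proof -
  have r: "r > 0" using assms norm_ge_zero[of a] by linarith
  have "(norm (of_real (r\<^sup>2) - cnj a * z))\<^sup>2 - (r * norm (z - a))\<^sup>2 = (r\<^sup>2 - (norm a)\<^sup>2) * (r\<^sup>2 - (norm z)\<^sup>2)"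
    unfolding power_mult_distrib cmod_power2 by (simp add: power2_eq_square algebra_simps)
  also have "\<dots> \<ge> 0"
    using assms by (intro mult_nonneg_nonneg) (auto intro!: power_mono)
  finally have "r * norm (z - a) \<le> norm (of_real (r\<^sup>2) - cnj a * z)"
    by (intro power2_le_imp_le[of "r * norm (z - a)"]) auto
  moreover have "norm (of_real (r\<^sup>2) - cnj a * z) > 0"
    using denom_nz[OF assms] by simp
  ultimately show ?thesis using r by (simp add: blaschke_def norm_divide norm_mult)
qed

lemma blaschke_eq_0_iff:
  assumes "norm a < r" "norm z \<le> r"
  shows "blaschke r a z = 0 \<longleftrightarrow> z = a"
  using denom_nz[OF assms] assms norm_ge_zero[of a] by (auto simp: blaschke_def)

lemma blaschke_analytic:
  assumes "norm a < r" "norm z \<le> r"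
  shows "blaschke r a analytic_on {z}"
  unfolding blaschke_def using denom_nz[OF assms] by (intro analytic_intros) auto

lemma mero_blaschke: "mero (blaschke r a)"
  unfolding blaschke_def by (intro meromorphic_intros)

lemma nonz_blaschke:
  assumes "norm a < r"
  shows "nonz (blaschke r a)"
proof -
  have r: "r > 0" using assms norm_ge_zero[of a] by linarith
  have "\<not> (\<forall>\<^sub>\<approx>z. blaschke r a z = 0)"
  proof
    assume "\<forall>\<^sub>\<approx>z. blaschke r a z = 0"
    then have "blaschke r a (of_real r) = 0"
      by (rule analytic_cosparse_eq) (use blaschke_analytic[OF assms, of "of_real r"] r in auto)
    then show False using norm_blaschke_circle[OF assms, of "of_real r"] r by simp
  qed
  then show ?thesis using nonz_or_zero[OF mero_blaschke] by blast
qed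

lemma mord_blaschke:
  assumes "norm a < r" "norm z \<le> r"
  shows "mord (blaschke r a) z = (if z = a then 1 else 0)"
proof (cases "z = a")
  case False
  then show ?thesis using blaschke_eq_0_iff[OF assms] blaschke_analytic[OF assms] mord_analytic_nz by auto
next
  case True
  have r: "r > 0" using assms norm_ge_zero[of a] by linarith
  let ?g = "\<lambda>z. of_real r / (of_real (r\<^sup>2) - cnj a * z)"
  have nz: "of_real (r\<^sup>2) - cnj a * w \<noteq> 0" if "w \<in> ball 0 r" for w
    using denom_nz[OF assms(1), of w] that by simp
  have "?g holomorphic_on ball 0 r" using nz by (intro holomorphic_intros)
  then have "zorder (\<lambda>w. ?g w * (w - a) powi 1) a = 1"
    using nz assms r
    by (intro zorder_eqI[where S = "ball 0 r" and g = ?g]) auto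
  moreover have "(\<lambda>w. ?g w * (w - a) powi 1) = blaschke r a"
    by (auto simp: blaschke_def fun_eq_iff)
  ultimately have z: "zorder (blaschke r a) a = 1" by simp
  have "laurent_expansion (blaschke r a) a \<noteq> 0"
    using laurent_nonzero[OF mero_blaschke nonz_blaschke[OF assms(1)]] .
  then have "mord (blaschke r a) a = zorder (blaschke r a) a"
    using has_laurent_expansion_zorder[OF laurent_UNIV[OF mero_blaschke]] by (auto simp: mord_def)
  then show ?thesis using z True by simp
qed

text \<open>Zeros are excluded as well as poles, so that ln |f| is continuous on the circle and no
  improper integrals occur.\<close>

definition good_radius :: "(complex \<Rightarrow> complex) \<Rightarrow> real \<Rightarrow> bool" where
  "good_radius f r \<longleftrightarrow> r > 0 \<and> (\<forall>z\<in>sphere 0 r. f analytic_on {z} \<and> f z \<noteq> 0)"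

lemma good_radius_nonz:
  assumes "mero f" "good_radius f r"
  shows "nonz f"
proof -
  have r: "r > 0" "f analytic_on {of_real r}" "f (of_real r) \<noteq> 0"
    using assms by (auto simp: good_radius_def)
  have "\<not> (\<forall>\<^sub>\<approx>z. f z = 0)"
  proof
    assume "\<forall>\<^sub>\<approx>z. f z = 0"
    then have "f (of_real r) = 0"
      by (rule analytic_cosparse_eq) (use r in auto)
    then show False using r by simp
  qed
  then show ?thesis using nonz_or_zero[OF assms(1)] by blast
qed

lemma good_radius_mord:
  assumes "good_radius f r" "norm z = r"
  shows "mord f z = 0"
  using assms by (auto simp: good_radius_def intro: mord_analytic_nz)

definition divisor_in :: "(complex \<Rightarrow> complex) \<Rightarrow> real \<Rightarrow> complex set" where
  "divisor_in f r = {a \<in> ball 0 r. mord f a \<noteq> 0}"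

lemma finite_divisor_in: "mero f \<Longrightarrow> finite (divisor_in f r)"
  unfolding divisor_in_def by (rule finite_subset[OF _ finite_mord[of f r]]) auto

text \<open>The Blaschke product over the zeros and poles in the disc has the same order as
  \<open>f\<close> at every point of the closed disc. The quotient therefore has order
  \<open>0\<close> there, and removing its singularities makes it analytic and zero-free on an open
  set containing the closed disc, hence by compactness on a larger disc. Moduli on the circle are
  unchanged.\<close>

lemma blaschke_factorization:
  assumes f: "mero f" and good: "good_radius f r"
  obtains R G where "r < R" "G holomorphic_on ball 0 R" "\<And>z. z \<in> ball 0 R \<Longrightarrow> G z \<noteq> 0"
    "\<And>z. norm z \<le> r \<Longrightarrow> f analytic_on {z} \<Longrightarrow> f z \<noteq> 0 \<Longrightarrow>
        f z = G z * (\<Prod>a\<in>divisor_in f r. blaschke r a z powi mord f a)"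
    "\<And>z. norm z = r \<Longrightarrow> norm (G z) = norm (f z)"
proof -
  define A where "A = divisor_in f r"
  have finA: "finite A" unfolding A_def by (rule finite_divisor_in[OF f])
  have nz: "nonz f" using good_radius_nonz assms by blast
  have r: "r > 0" using good by (simp add: good_radius_def)
  have Ar: "norm a < r" if "a \<in> A" for a using that by (auto simp: A_def divisor_in_def)
  define \<phi> where "\<phi> = (\<lambda>z. \<Prod>a\<in>A. blaschke r a z powi mord f a)"
  have m\<phi>: "mero \<phi>" unfolding \<phi>_def by (intro meromorphic_intros mero_blaschke)
  have nzb: "nonz (\<lambda>z. blaschke r a z powi k)" if "a \<in> A" for a k
    by (rule eventually_mono[OF nonz_blaschke[OF Ar[OF that]]]) simp
  have P: "mord \<phi> z = (\<Sum>a\<in>A. mord (\<lambda>z. blaschke r a z powi mord f a) z) \<and> nonz \<phi>" for z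
    unfolding \<phi>_def by (intro mord_prod finA meromorphic_intros mero_blaschke nzb)
  have ord\<phi>: "mord \<phi> z = mord f z" if "norm z \<le> r" for z
  proof -
    have "mord \<phi> z = (\<Sum>a\<in>A. mord f a * (if z = a then 1 else 0))"
      using P[of z] mord_powi[OF mero_blaschke] mord_blaschke[OF Ar that] by simp
    also have "\<dots> = (\<Sum>a\<in>A. if z = a then mord f z else 0)" by (intro sum.cong) auto
    also have "\<dots> = (if z \<in> A then mord f z else 0)" using finA by (simp add: sum.delta')
    also have "\<dots> = mord f z"
      using that good_radius_mord[OF good, of z] by (auto simp: A_def divisor_in_def)
    finally show ?thesis .
  qed
  define g where "g = (\<lambda>z. f z * inverse (\<phi> z))"
  have mg: "mero g" unfolding g_def by (intro meromorphic_intros f m\<phi>)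
  have nzg: "nonz g" unfolding g_def using P by (intro nonz_mult nz nonz_inverse) auto
  have ordg: "mord g z = 0" if "norm z \<le> r" for z
  proof -
    have "mord g z = mord f z + mord (\<lambda>z. inverse (\<phi> z)) z"
      unfolding g_def using P by (intro mord_mult f meromorphic_intros m\<phi> nz nonz_inverse) auto
    then show ?thesis using ord\<phi>[OF that] mord_inverse[OF m\<phi>] by simp
  qed
  define G where "G = remove_sings g"
  define S where "S = {z. G analytic_on {z} \<and> G z \<noteq> 0}"
  have "open S"
  proof (rule openI)
    fix z assume "z \<in> S"
    then have z: "G analytic_on {z}" "G z \<noteq> 0" by (auto simp: S_def)
    obtain T where T: "open T" "z \<in> T" "G holomorphic_on T" using z(1) analytic_at by blast
    obtain d where d: "d > 0" "\<And>w. dist z w < d \<Longrightarrow> G w \<noteq> 0"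
      using continuous_at_avoid[OF analytic_at_imp_isCont[OF z(1)] z(2)] by blast
    obtain e where e: "e > 0" "ball z e \<subseteq> T" using T openE by blast
    have "ball z (min d e) \<subseteq> S"
      using T d e by (auto simp: S_def analytic_at)
    then show "\<exists>e>0. ball z e \<subseteq> S" using d e by (intro exI[of _ "min d e"]) auto
  qed
  moreover have "cball 0 r \<subseteq> S"
    using mord_0_removable[OF mg nzg ordg] by (auto simp: S_def G_def)
  ultimately obtain \<epsilon> where e: "\<epsilon> > 0" "(\<Union>x\<in>cball 0 r. ball x \<epsilon>) \<subseteq> S"
    using compact_subset_open_imp_ball_epsilon_subset[OF compact_cball] by blast
  have sub: "ball 0 (r + \<epsilon>) \<subseteq> S"
  proof
    fix z :: complex assume "z \<in> ball 0 (r + \<epsilon>)"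
    then have z: "norm z < r + \<epsilon>" by simp
    show "z \<in> S"
    proof (cases "norm z \<le> r")
      case True then show ?thesis using e by force
    next
      case False
      \<comment> \<open>The radial projection of \<open>z\<close> to the circle; its distance from
        \<open>z\<close> is \<open>norm z - r\<close>, which is below \<epsilon>.\<close>
      define x where "x = of_real (r / norm z) * z"
      have "z \<noteq> 0" using False r by auto
      have nx: "norm x = r" using r \<open>z \<noteq> 0\<close> by (simp add: x_def norm_mult norm_divide)
      have "z - x = of_real (1 - r / norm z) * z" by (simp add: x_def algebra_simps)
      then have "norm (z - x) = \<bar>1 - r / norm z\<bar> * norm z" by (simp only: norm_mult norm_of_real)
      also have "\<dots> = norm z - r" using False \<open>z \<noteq> 0\<close> by (simp add: field_simps)
      finally have "z \<in> ball x \<epsilon>" using z by (simp add: dist_norm norm_minus_commute)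
      then show ?thesis using e(2) nx by (metis UN_I mem_cball_0 order_refl subsetD)
    qed
  qed
  have fac: "f z = G z * \<phi> z" if z: "norm z \<le> r" "f analytic_on {z}" "f z \<noteq> 0" for z
  proof -
    have "z \<notin> A" using mord_analytic_nz[OF z(2,3)] by (auto simp: A_def divisor_in_def)
    then have bnz: "blaschke r a z \<noteq> 0" if "a \<in> A" for a
      using blaschke_eq_0_iff[OF Ar[OF that] z(1)] that by auto
    have "\<phi> analytic_on {z}" unfolding \<phi>_def
      using bnz z(1) Ar by (intro analytic_intros blaschke_analytic) auto
    moreover have p0: "\<phi> z \<noteq> 0" unfolding \<phi>_def using bnz finA by simp
    ultimately have "g analytic_on {z}" unfolding g_def
      using z by (intro analytic_intros) auto
    then have "G z = g z" by (simp add: G_def)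
    then show ?thesis using p0 by (simp add: g_def)
  qed
  show ?thesis
  proof (rule that[of "r + \<epsilon>" G])
    show "r < r + \<epsilon>" using e by simp
    have "G analytic_on ball 0 (r + \<epsilon>)"
      using sub by (subst analytic_on_analytic_at) (auto simp: S_def)
    then show "G holomorphic_on ball 0 (r + \<epsilon>)" by (rule analytic_imp_holomorphic)
    show "G z \<noteq> 0" if "z \<in> ball 0 (r + \<epsilon>)" for z using sub that by (auto simp: S_def)
    show "f z = G z * (\<Prod>a\<in>divisor_in f r. blaschke r a z powi mord f a)"
      if "norm z \<le> r" "f analytic_on {z}" "f z \<noteq> 0" for z
      using fac[OF that] by (simp add: \<phi>_def A_def)
    show "norm (G z) = norm (f z)" if z: "norm z = r" for z
    proof -
      have "norm (\<phi> z) = 1"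
        using norm_blaschke_circle[OF Ar z] by (simp add: \<phi>_def prod_norm[symmetric] norm_power_int)
      moreover have "f z = G z * \<phi> z" using fac[of z] good z by (auto simp: good_radius_def)
      ultimately show ?thesis by (simp add: norm_mult)
    qed
  qed
qed

lemma ln_norm_prod_powi:
  assumes "finite A" "\<And>a. a \<in> A \<Longrightarrow> b a \<noteq> (0::complex)"
  shows "ln (norm (\<Prod>a\<in>A. b a powi k a)) = (\<Sum>a\<in>A. of_int (k a) * ln (norm (b a)))"
proof -
  have "ln (norm (\<Prod>a\<in>A. b a powi k a)) = ln (\<Prod>a\<in>A. norm (b a) powi k a)"
    by (simp add: prod_norm[symmetric] norm_power_int)
  also have "\<dots> = (\<Sum>a\<in>A. ln (norm (b a) powi k a))"
    using assms by (intro ln_prod) auto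
  also have "\<dots> = (\<Sum>a\<in>A. of_int (k a) * ln (norm (b a)))"
    using assms by (intro sum.cong refl) (simp add: ln_power_int_pos)
  finally show ?thesis .
qed

text \<open>Logarithm and logarithmic derivative of the Blaschke factorization. The zero-free factor
  is recovered from its boundary modulus, which is that of \<open>f\<close>; the bracket in the
  second sum is the logarithmic derivative of a Blaschke factor.\<close>

lemma poisson_jensen:
  assumes f: "mero f" and good: "good_radius f r" and z: "norm z < r" "f analytic_on {z}" "f z \<noteq> 0"
  shows "ln (norm (f z)) = cmean r (\<lambda>w. poiss z w * ln (norm (f w)))
           + (\<Sum>a\<in>divisor_in f r. of_int (mord f a) * ln (norm (blaschke r a z)))" (is ?A)
    and "deriv f z / f z = cmean r (\<lambda>w. of_real (2 * ln (norm (f w))) * (w / (w - z)\<^sup>2))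
           + (\<Sum>a\<in>divisor_in f r. of_int (mord f a) * (1 / (z - a) + cnj a / (of_real (r\<^sup>2) - cnj a * z)))" (is ?B)
proof -
  define A where "A = divisor_in f r"
  obtain R G where G: "r < R" "G holomorphic_on ball 0 R" "\<And>z. z \<in> ball 0 R \<Longrightarrow> G z \<noteq> 0"
    "\<And>z. norm z \<le> r \<Longrightarrow> f analytic_on {z} \<Longrightarrow> f z \<noteq> 0 \<Longrightarrow>
        f z = G z * (\<Prod>a\<in>A. blaschke r a z powi mord f a)"
    "\<And>z. norm z = r \<Longrightarrow> norm (G z) = norm (f z)"
    by (rule blaschke_factorization[OF f good, folded A_def]) (rule that)
  have finA: "finite A" unfolding A_def by (rule finite_divisor_in[OF f])
  have Ar: "norm a < r" if "a \<in> A" for a using that by (auto simp: A_def divisor_in_def)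
  have r: "r > 0" using good by (simp add: good_radius_def)
  have zA: "z \<notin> A" using mord_analytic_nz[OF z(2,3)] by (auto simp: A_def divisor_in_def)
  have bnz: "blaschke r a z \<noteq> 0" if "a \<in> A" for a
    using blaschke_eq_0_iff[OF Ar[OF that]] that z(1) zA by auto
  have Gz: "G z \<noteq> 0" using G(1,3) z(1) by auto
  have "f z = G z * (\<Prod>a\<in>A. blaschke r a z powi mord f a)" using G(4)[of z] z by auto
  then have "norm (f z) = norm (G z) * norm (\<Prod>a\<in>A. blaschke r a z powi mord f a)"
    by (simp add: norm_mult)
  then have "ln (norm (f z)) = ln (norm (G z)) + ln (norm (\<Prod>a\<in>A. blaschke r a z powi mord f a))"
    using Gz bnz finA by (simp add: ln_mult)
  also have "ln (norm (G z)) = cmean r (\<lambda>w. poiss z w * ln (norm (G w)))"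
    by (rule zero_free_poisson(1)[OF G(2,3,1) z(1)])
  also have "\<dots> = cmean r (\<lambda>w. poiss z w * ln (norm (f w)))"
    by (rule cmean_cong) (use r G(5) in auto)
  finally show ?A using ln_norm_prod_powi[OF finA bnz] by (simp add: A_def)

  define D where "D = (\<lambda>a. 1 / (z - a) + cnj a / (of_real (r\<^sup>2) - cnj a * z))"
  have db: "(blaschke r a has_field_derivative blaschke r a z * D a) (at z)" if "a \<in> A" for a
  proof -
    have n: "of_real (r\<^sup>2) - cnj a * z \<noteq> 0" using denom_nz[OF Ar[OF that]] z(1) by simp
    have "z \<noteq> a" using zA that by auto
    have "((\<lambda>w. of_real r * (w - a) / (of_real (r\<^sup>2) - cnj a * w)) has_field_derivative
        (of_real r * (of_real (r\<^sup>2) - cnj a * z) - of_real r * (z - a) * (- cnj a)) / (of_real (r\<^sup>2) - cnj a * z)\<^sup>2) (at z)"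
      using n by (auto intro!: derivative_eq_intros simp: power2_eq_square)
    moreover have "(of_real r * (of_real (r\<^sup>2) - cnj a * z) - of_real r * (z - a) * (- cnj a)) / (of_real (r\<^sup>2) - cnj a * z)\<^sup>2
        = blaschke r a z * D a"
    proof -
      define n where "n = of_real (r\<^sup>2) - cnj a * z"
      have "n \<noteq> 0" "z - a \<noteq> 0" using n_def n \<open>z \<noteq> a\<close> by auto
      then show ?thesis unfolding blaschke_def D_def n_def[symmetric]
        by (simp add: divide_simps power2_eq_square) (simp add: algebra_simps)
    qed
    ultimately show ?thesis unfolding blaschke_def[abs_def] by simp
  qed
  have dp: "((\<lambda>w. blaschke r a w powi mord f a) has_field_derivative
      of_int (mord f a) * blaschke r a z powi (mord f a - 1) * (blaschke r a z * D a)) (at z)" if "a \<in> A" for a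
    using bnz[OF that] db[OF that] by (intro DERIV_power_int) auto
  have "((\<lambda>w. \<Prod>a\<in>A. blaschke r a w powi mord f a) has_field_derivative
      (\<Prod>a\<in>A. blaschke r a z powi mord f a) *
      (\<Sum>a\<in>A. of_int (mord f a) * blaschke r a z powi (mord f a - 1) * (blaschke r a z * D a) / (blaschke r a z powi mord f a))) (at z)"
    using bnz by (intro has_field_derivative_prod' dp) auto
  also have "(\<Sum>a\<in>A. of_int (mord f a) * blaschke r a z powi (mord f a - 1) * (blaschke r a z * D a) / (blaschke r a z powi mord f a))
     = (\<Sum>a\<in>A. of_int (mord f a) * D a)"
    using bnz by (intro sum.cong refl) (simp add: power_int_diff)
  finally have dP: "((\<lambda>w. \<Prod>a\<in>A. blaschke r a w powi mord f a) has_field_derivative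
      (\<Prod>a\<in>A. blaschke r a z powi mord f a) * (\<Sum>a\<in>A. of_int (mord f a) * D a)) (at z)" .
  have dG: "(G has_field_derivative deriv G z) (at z)"
    using G(1,2) z(1) by (intro holomorphic_derivI[of G "ball 0 R"]) auto
  define Q where "Q = (\<Prod>a\<in>A. blaschke r a z powi mord f a)"
  have Q0: "Q \<noteq> 0" unfolding Q_def using bnz finA by simp
  have dGP: "((\<lambda>w. G w * (\<Prod>a\<in>A. blaschke r a w powi mord f a)) has_field_derivative
      deriv G z * Q + G z * (Q * (\<Sum>a\<in>A. of_int (mord f a) * D a))) (at z)"
    using DERIV_mult[OF dG dP] unfolding Q_def by (simp add: algebra_simps)
  obtain T where T: "open T" "z \<in> T" "f holomorphic_on T" using z(2) analytic_at by blast
  obtain d where d: "d > 0" "\<And>w. dist z w < d \<Longrightarrow> f w \<noteq> 0"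
    using continuous_at_avoid[OF analytic_at_imp_isCont[OF z(2)] z(3)] by blast
  define U where "U = T \<inter> ball z d \<inter> ball 0 r"
  have U: "open U" "z \<in> U" using T d z(1) by (auto simp: U_def)
  have GT: "G w * (\<Prod>a\<in>A. blaschke r a w powi mord f a) = f w" if "w \<in> U" for w
  proof -
    have "f analytic_on {w}" using T that by (auto simp: U_def analytic_at)
    then show ?thesis using G(4)[of w] d(2)[of w] that by (auto simp: U_def)
  qed
  have "(f has_field_derivative deriv G z * Q + G z * (Q * (\<Sum>a\<in>A. of_int (mord f a) * D a))) (at z)"
    by (rule has_field_derivative_transform_within_open[OF dGP U])
       (use GT in auto)
  then have "deriv f z = deriv G z * Q + G z * (Q * (\<Sum>a\<in>A. of_int (mord f a) * D a))"
    by (rule DERIV_imp_deriv)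
  moreover have "f z = G z * Q" using G(4)[of z] z by (auto simp: Q_def)
  ultimately have "deriv f z / f z = deriv G z / G z + (\<Sum>a\<in>A. of_int (mord f a) * D a)"
    using Gz Q0 by (simp add: field_simps)
  also have "deriv G z / G z = cmean r (\<lambda>w. of_real (2 * ln (norm (G w))) * (w / (w - z)\<^sup>2))"
    by (rule zero_free_poisson(2)[OF G(2,3,1) z(1)])
  also have "\<dots> = cmean r (\<lambda>w. of_real (2 * ln (norm (f w))) * (w / (w - z)\<^sup>2))"
    by (rule cmean_cong) (use r G(5) in auto)
  finally show ?B by (simp add: A_def D_def)
qed

text \<open>The weight with which a pole at \<open>a\<close> enters N(r, f): the integral of 1/t
  from |a| to r, and at the origin the separate ln r of the definition of
  \<open>nev_N\<close>.\<close>

definition logw :: "real \<Rightarrow> complex \<Rightarrow> real" where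
  "logw r a = (if a = 0 then ln r else ln (r / norm a))"

text \<open>The mean of ln |f| is ln |G 0| for the zero-free factor \<open>G\<close> of the Blaschke
  factorization. What remains is to isolate a constant that is the same for all radii: ln |c| for
  the leading Laurent coefficient \<open>c\<close> of \<open>f\<close> at the origin.\<close>

lemma jensen:
  assumes f: "mero f"
  shows "\<exists>C. \<forall>r. good_radius f r \<longrightarrow>
    cmean r (\<lambda>w. ln (norm (f w))) = C + (\<Sum>a\<in>divisor_in f r. of_int (mord f a) * logw r a)"
proof (cases "nonz f")
  case False
  then show ?thesis using good_radius_nonz[OF f] by blast
next
  case nz: True
  define k where "k = mord f 0"
  have iso: "isolated_singularity_at f 0" "not_essential f 0"
    using f by (auto simp: meromorphic_on_altdef)
  have fr: "\<exists>\<^sub>F w in at 0. f w \<noteq> 0"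
    using cosparse_at[OF nz] by (simp add: eventually_frequently)
  have k: "zorder f 0 = k"
    using has_laurent_expansion_zorder[OF laurent_UNIV[OF f] laurent_nonzero[OF f nz]] by (simp add: k_def mord_def)
  obtain s where s: "zor_poly f 0 0 \<noteq> 0" "s > 0" "zor_poly f 0 holomorphic_on cball 0 s"
     "\<And>w. w \<in> cball 0 s - {0} \<Longrightarrow> f w = zor_poly f 0 w * (w - 0) powi zorder f 0"
    using zorder_exist[OF iso fr] by metis
  define c where "c = zor_poly f 0 0"
  have "(zor_poly f 0 \<longlongrightarrow> c) (at 0)"
    using s(2,3) unfolding c_def
    by (meson ball_subset_cball centre_in_ball holomorphic_on_imp_continuous_on holomorphic_on_subset open_ball continuous_on_eq_continuous_at isContD)
  moreover have "\<forall>\<^sub>F w in at 0. zor_poly f 0 w = f w / w powi k"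
    by (rule eventually_mono[OF eventually_at_in_open[OF open_ball, of 0 0 s]]) (use s(2) k s(4) in \<open>simp_all add: less_imp_le\<close>)
  ultimately have lim: "((\<lambda>w. f w / w powi k) \<longlongrightarrow> c) (at 0)"
    by (rule Lim_transform_eventually)
  show ?thesis
  proof (intro exI[of _ "ln (norm c)"] allI impI)
    fix r assume good: "good_radius f r"
    define A where "A = divisor_in f r"
    obtain R G where G: "r < R" "G holomorphic_on ball 0 R" "\<And>z. z \<in> ball 0 R \<Longrightarrow> G z \<noteq> 0"
      "\<And>z. norm z \<le> r \<Longrightarrow> f analytic_on {z} \<Longrightarrow> f z \<noteq> 0 \<Longrightarrow>
        f z = G z * (\<Prod>a\<in>A. blaschke r a z powi mord f a)"
      "\<And>z. norm z = r \<Longrightarrow> norm (G z) = norm (f z)"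
      by (rule blaschke_factorization[OF f good, folded A_def]) (rule that)
    have finA: "finite A" unfolding A_def by (rule finite_divisor_in[OF f])
    have Ar: "norm a < r" if "a \<in> A" for a using that by (auto simp: A_def divisor_in_def)
    have r: "r > 0" using good by (simp add: good_radius_def)
    have "cmean r (\<lambda>w. ln (norm (f w))) = cmean r (\<lambda>w. ln (norm (G w)))"
      by (rule cmean_cong) (use r G(5) in auto)
    also have "\<dots> = ln (norm (G 0))"
      by (rule zero_free_mean[OF G(2,3,1) r])
    finally have mean: "cmean r (\<lambda>w. ln (norm (f w))) = ln (norm (G 0))" .
    define B where "B = A - {0}"
    have G0: "G 0 \<noteq> 0" using G r by auto
    have b0: "blaschke r a 0 = - a / of_real r" for a
      using r by (simp add: blaschke_def power2_eq_square)
    have bl0: "blaschke r 0 w = w / of_real r" for w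
      using r by (simp add: blaschke_def power2_eq_square)
    have prodA: "(\<Prod>a\<in>A. blaschke r a w powi mord f a) = (\<Prod>a\<in>B. blaschke r a w powi mord f a) * (w / of_real r) powi k" for w
    proof (cases "0 \<in> A")
      case True
      then show ?thesis using finA by (simp add: B_def prod.remove[OF finA True] bl0 k_def mult.commute)
    next
      case False
      then have "k = 0" using r by (auto simp: A_def divisor_in_def k_def)
      then show ?thesis using False by (simp add: B_def)
    qed
    \<comment> \<open>\<open>H w\<close> is \<open>f w / w powi k\<close> in factored form: the
      Blaschke factor of the origin is \<open>w / r\<close>, so dividing out \<open>w powi k\<close>
      leaves \<open>(1 / r) powi k\<close>. By continuity \<open>H 0\<close> is the leading
      coefficient \<open>c\<close>.\<close>
    define H where "H = (\<lambda>w. G w * (\<Prod>a\<in>B. blaschke r a w powi mord f a) * (1 / of_real r) powi k)"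
    have "\<forall>\<^sub>F w in at 0. w \<in> ball 0 r - {0} \<and> f analytic_on {w} \<and> f w \<noteq> 0"
      using r by (intro eventually_conj cosparse_at[OF nz] eventually_at_in_open
        cosparse_at[OF meromorphic_on_imp_analytic_cosparse[OF f]]) auto
    then have ev: "\<forall>\<^sub>F w in at 0. f w / w powi k = H w"
    proof eventually_elim
      case (elim w)
      then have "f w = G w * ((\<Prod>a\<in>B. blaschke r a w powi mord f a) * (w / of_real r) powi k)"
        using G(4)[of w] prodA[of w] by simp
      then show ?case using elim by (simp add: H_def power_int_divide_distrib)
    qed
    have "H analytic_on {0}" unfolding H_def
    proof (intro analytic_intros)
      show "G analytic_on {0}" unfolding analytic_at
        using G(1,2) r by (intro exI[of _ "ball 0 R"]) auto
    qed (use Ar r in \<open>auto simp: B_def b0 intro!: blaschke_analytic\<close>)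
    then have "isCont H 0" by (rule analytic_at_imp_isCont)
    then have "(H \<longlongrightarrow> H 0) (at 0)" by (rule isContD)
    moreover have "(H \<longlongrightarrow> c) (at 0)" using Lim_transform_eventually[OF lim ev] .
    ultimately have "H 0 = c" using tendsto_unique by (metis at_neq_bot)
    then have "ln (norm c) = ln (norm (G 0)) + (\<Sum>a\<in>B. of_int (mord f a) * ln (norm (blaschke r a 0))) - of_int k * ln r"
    proof -
      have Bn: "blaschke r a 0 \<noteq> 0" if "a \<in> B" for a using that r by (simp add: b0 B_def)
      have fB: "finite B" using finA by (simp add: B_def)
      have "norm c = norm (G 0) * norm (\<Prod>a\<in>B. blaschke r a 0 powi mord f a) * (1 / r) powi k"
        using \<open>H 0 = c\<close>[symmetric] r by (simp add: H_def norm_mult norm_power_int norm_divide)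
      then have "ln (norm c) = ln (norm (G 0)) + ln (norm (\<Prod>a\<in>B. blaschke r a 0 powi mord f a)) + ln ((1/r) powi k)"
        using G0 Bn fB r by (simp add: ln_mult)
      then show ?thesis using ln_norm_prod_powi[OF fB Bn] r by (simp add: ln_power_int_pos ln_div)
    qed
    also have "(\<Sum>a\<in>B. of_int (mord f a) * ln (norm (blaschke r a 0))) = - (\<Sum>a\<in>B. of_int (mord f a) * logw r a)"
      unfolding sum_negf[symmetric] using r
      by (intro sum.cong refl) (auto simp: B_def b0 logw_def norm_divide ln_div right_diff_distrib)
    finally have "ln (norm (G 0)) = ln (norm c) + ((\<Sum>a\<in>B. of_int (mord f a) * logw r a) + of_int k * logw r 0)"
      by (simp add: logw_def)
    also have "(\<Sum>a\<in>B. of_int (mord f a) * logw r a) + of_int k * logw r 0 = (\<Sum>a\<in>A. of_int (mord f a) * logw r a)"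
    proof (cases "0 \<in> A")
      case True
      then show ?thesis using finA by (simp add: B_def sum.remove[OF finA True] k_def)
    next
      case False
      then have "k = 0" using r by (auto simp: A_def divisor_in_def k_def)
      then show ?thesis using False by (simp add: B_def)
    qed
    finally show "cmean r (\<lambda>w. ln (norm (f w))) = ln (norm c) + (\<Sum>a\<in>divisor_in f r. of_int (mord f a) * logw r a)"
      using mean by (simp add: A_def)
  qed
qed

subsection \<open>Counting functions\<close>

definition pmul :: "(complex \<Rightarrow> complex) \<Rightarrow> complex \<Rightarrow> nat" where
  "pmul f z = nat (- mord f z)"

lemma pmul_cong: "\<forall>\<^sub>\<approx>z. f z = g z \<Longrightarrow> pmul f z = pmul g z"
  using mord_cong[of f g] by (simp add: pmul_def)

lemma pmul_analytic: "f analytic_on {z} \<Longrightarrow> pmul f z = 0"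
  using mord_analytic_nonneg by (simp add: pmul_def)

lemma pmul_mult:
  assumes "mero f" "mero g"
  shows "pmul (\<lambda>z. f z * g z) z \<le> pmul f z + pmul g z"
proof (cases "nonz f \<and> nonz g")
  case True
  then show ?thesis using mord_mult[OF assms] by (simp add: pmul_def)
next
  case False
  then have "(\<forall>\<^sub>\<approx>z. f z = 0) \<or> (\<forall>\<^sub>\<approx>z. g z = 0)" using nonz_or_zero assms by blast
  then have "\<forall>\<^sub>\<approx>z. f z * g z = 0" by (auto elim: eventually_mono)
  then have "pmul (\<lambda>z. f z * g z) z = pmul (\<lambda>_. 0) z" by (rule pmul_cong)
  then show ?thesis by (simp add: pmul_analytic)
qed

lemma pmul_add:
  assumes "mero f" "mero g"
  shows "pmul (\<lambda>z. f z + g z) z \<le> max (pmul f z) (pmul g z)"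
proof -
  let ?F = "laurent_expansion f z" and ?G = "laurent_expansion g z"
  have "mord (\<lambda>z. f z + g z) z = fls_subdegree (?F + ?G)"
    using assms by (intro mord_eqI laurent_expansion_intros laurent_UNIV)
  moreover have "?F + ?G \<noteq> 0 \<Longrightarrow> fls_subdegree (?F + ?G) \<ge> min (fls_subdegree ?F) (fls_subdegree ?G)"
    by (rule fls_plus_subdegree)
  ultimately show ?thesis by (cases "?F + ?G = 0") (auto simp: pmul_def mord_def)
qed

text \<open>A pole of order k becomes one of order k + 1, and k + 1 is at most 2 k; regular points
  stay regular. The factor form is what comparisons of counting functions require.\<close>

lemma pmul_deriv:
  assumes "mero f"
  shows "pmul (deriv f) z \<le> 2 * pmul f z"
proof -
  let ?F = "laurent_expansion f z"
  have "deriv (\<lambda>w. f (z + w)) has_laurent_expansion fls_deriv ?F"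
    by (intro has_laurent_expansion_deriv laurent_UNIV assms)
  moreover have "deriv (\<lambda>w. f (z + w)) = (\<lambda>w. deriv f (z + w))"
    by (rule ext) (subst (1 2) deriv_shift_0, simp add: o_def add.assoc)
  ultimately have *: "mord (deriv f) z = fls_subdegree (fls_deriv ?F)" by (simp add: mord_eqI)
  show ?thesis
  proof (cases "fls_subdegree ?F = 0")
    case True
    then show ?thesis using * fls_deriv_subdegree0[of ?F] by (simp add: pmul_def)
  next
    case False
    then have "fls_subdegree (fls_deriv ?F) = fls_subdegree ?F - 1"
      by (intro fls_subdegree_deriv)
    then show ?thesis using * False by (auto simp: pmul_def mord_def)
  qed
qed

lemma pmul_power: "mero f \<Longrightarrow> pmul (\<lambda>z. f z ^ n) z = n * pmul f z"
  using nat_mult_distrib[of "int n" "- mord f z"] by (simp add: pmul_def mord_power)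

lemma pmul_inverse: "mero f \<Longrightarrow> pmul (\<lambda>z. inverse (f z)) z = nat (mord f z)"
  by (simp add: pmul_def mord_inverse)

section \<open>The integrated counting function as a weighted sum over poles\<close>

lemma nev_n_eq:
  assumes "mero f" "finite A" "A \<subseteq> cball 0 r" "{b \<in> cball 0 r. pmul f b \<noteq> 0} \<subseteq> A" "t \<le> r"
  shows "real (nev_n t f) = (\<Sum>b\<in>A. real (pmul f b) * (if norm b \<le> t then 1 else 0))"
proof -
  have "nev_n t f = (\<Sum>z\<in>{z \<in> cball 0 t. is_pole f z}. pmul f z)"
    unfolding nev_n_def using is_pole_iff_mord[OF assms(1)] zorder_eq_mord[OF assms(1)]
    by (intro sum.cong refl) (auto simp: pmul_def)
  also have "\<dots> = (\<Sum>z\<in>{z\<in>A. norm z \<le> t}. pmul f z)"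
    using assms is_pole_iff_mord[OF assms(1)]
    by (intro sum.mono_neutral_left) (auto simp: pmul_def)
  also have "\<dots> = (\<Sum>z\<in>A. if norm z \<le> t then pmul f z else 0)"
    using assms(2) by (rule sum.inter_filter)
  finally show ?thesis by (simp add: if_distrib cong: if_cong)
qed

lemma has_integral_inverse_tail:
  assumes "0 < c" "c \<le> (r::real)"
  shows "((\<lambda>t. if c \<le> t then 1 / t else 0) has_integral ln (r / c)) {0..r}"
proof -
  have "((\<lambda>t. 1 / t) has_integral (ln r - ln c)) {c..r}"
    using assms by (intro fundamental_theorem_of_calculus)
      (auto intro!: derivative_eq_intros simp flip: has_real_derivative_iff_has_vector_derivative)
  then have "((\<lambda>t. if t \<in> {c..r} then 1 / t else 0) has_integral (ln r - ln c)) {0..r}"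
    using assms by (subst has_integral_restrict) auto
  then show ?thesis using assms
    by (subst has_integral_cong[where g = "\<lambda>t. if t \<in> {c..r} then 1 / t else 0"]) (auto simp: ln_div)
qed

text \<open>Termwise integration: a pole at \<open>b\<close> contributes the integral of 1/t from
  |b| to r. The index set may be any finite superset of the poles, so that several functions can
  share one.\<close>

lemma nev_N_sum:
  assumes "mero f" "r > 0" "finite A" "A \<subseteq> cball 0 r" "{b \<in> cball 0 r. pmul f b \<noteq> 0} \<subseteq> A"
  shows "nev_N r f = (\<Sum>b\<in>A. real (pmul f b) * logw r b)"
proof -
  let ?g = "\<lambda>b t. real (pmul f b) * (if norm b \<le> t then 1 / t else 0)"
  have p0: "pmul f 0 = 0" if "0 \<notin> A"
  proof (rule ccontr)
    assume "pmul f 0 \<noteq> 0"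
    then have "0 \<in> {b \<in> cball 0 r. pmul f b \<noteq> 0}" using assms(2) by simp
    then show False using assms(5) that by blast
  qed
  have n0: "real (nev_n 0 f) = real (pmul f 0)"
  proof (cases "0 \<in> A")
    case True
    have "real (nev_n 0 f) = (\<Sum>b\<in>A. if b = 0 then real (pmul f 0) else 0)"
      using nev_n_eq[OF assms(1,3,4,5), of 0] assms(2) by (auto intro!: sum.cong)
    then show ?thesis using True assms(3) by simp
  next
    case False
    have "pmul f 0 = 0" using False by (rule p0)
    have "real (nev_n 0 f) = (\<Sum>b\<in>A. 0)"
      using nev_n_eq[OF assms(1,3,4,5), of 0] assms(2) False
      by (auto intro!: sum.neutral)
    then show ?thesis using \<open>pmul f 0 = 0\<close> by simp
  qed
  have "((\<lambda>t. \<Sum>b\<in>A-{0}. ?g b t) has_integral (\<Sum>b\<in>A-{0}. real (pmul f b) * ln (r / norm b))) {0..r}"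
    using assms by (intro has_integral_sum has_integral_mult_right has_integral_inverse_tail) auto
  moreover have "(\<Sum>b\<in>A-{0}. ?g b t) = (real (nev_n t f) - real (nev_n 0 f)) / t" if t: "t \<in> {0..r}" for t
  \<comment> \<open>At \<open>t = 0\<close> both sides are \<open>0\<close>, since division by zero
    yields \<open>0\<close>.\<close>
  proof (cases "t = 0")
    case False
    have "real (nev_n t f) - real (nev_n 0 f) = (\<Sum>b\<in>A-{0}. real (pmul f b) * (if norm b \<le> t then 1 else 0))"
    proof (cases "0 \<in> A")
      case True
      then show ?thesis using nev_n_eq[OF assms(1,3,4,5), of t] t n0
        sum.remove[OF assms(3) True, of "\<lambda>b. real (pmul f b) * (if norm b \<le> t then 1 else 0)"] by simp
    next
      case F: False
      then have "pmul f 0 = 0" by (rule p0)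
      then show ?thesis using nev_n_eq[OF assms(1,3,4,5), of t] t n0 F by simp
    qed
    also have "\<dots> / t = (\<Sum>b\<in>A-{0}. ?g b t)"
      unfolding sum_divide_distrib by (intro sum.cong) auto
    finally show ?thesis by simp
  qed (auto intro!: sum.neutral)
  ultimately have "((\<lambda>t. (real (nev_n t f) - real (nev_n 0 f)) / t) has_integral (\<Sum>b\<in>A-{0}. real (pmul f b) * ln (r / norm b))) {0..r}"
    using has_integral_cong by (metis (no_types, lifting))
  then have "nev_N r f = (\<Sum>b\<in>A-{0}. real (pmul f b) * ln (r / norm b)) + real (pmul f 0) * ln r"
    unfolding nev_N_def n0 by (simp add: integral_unique)
  also have "(\<Sum>b\<in>A-{0}. real (pmul f b) * ln (r / norm b)) = (\<Sum>b\<in>A-{0}. real (pmul f b) * logw r b)"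
    by (intro sum.cong) (auto simp: logw_def)
  also have "\<dots> + real (pmul f 0) * ln r = (\<Sum>b\<in>A. real (pmul f b) * logw r b)"
  proof (cases "0 \<in> A")
    case True
    then show ?thesis by (simp add: sum.remove[OF assms(3) True] logw_def)
  next
    case False
    then have "pmul f 0 = 0" by (rule p0)
    then show ?thesis using False by simp
  qed
  finally show ?thesis .
qed

lemma logw_nonneg: "r \<ge> 1 \<Longrightarrow> norm b \<le> r \<Longrightarrow> logw r b \<ge> 0"
  by (auto simp: logw_def)

lemma finite_pmul: "mero f \<Longrightarrow> finite {b \<in> cball 0 r. pmul f b \<noteq> 0}"
  by (rule finite_subset[OF _ finite_mord[of f r]]) (auto simp: pmul_def)

text \<open>All three counting functions are sums over the same points with the same weights, and
  the weights are nonnegative for \<open>r\<close> at least \<open>1\<close>; so it suffices to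
  compare multiplicities.\<close>

lemma nev_N_mono:
  assumes "mero f" "mero g" "mero h" "\<And>z. real (pmul f z) \<le> c * real (pmul g z) + d * real (pmul h z)" "r \<ge> 1"
  shows "nev_N r f \<le> c * nev_N r g + d * nev_N r h"
proof -
  define A where "A = {b \<in> cball 0 r. pmul f b \<noteq> 0} \<union> {b \<in> cball 0 r. pmul g b \<noteq> 0} \<union> {b \<in> cball 0 r. pmul h b \<noteq> 0}"
  have A: "finite A" "A \<subseteq> cball 0 r" using finite_pmul assms(1-3) by (auto simp: A_def)
  have "nev_N r f = (\<Sum>b\<in>A. real (pmul f b) * logw r b)"
    using assms A by (intro nev_N_sum) (auto simp: A_def)
  also have "\<dots> \<le> (\<Sum>b\<in>A. (c * real (pmul g b) + d * real (pmul h b)) * logw r b)"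
    using A assms(4,5) logw_nonneg by (intro sum_mono mult_right_mono) auto
  also have "\<dots> = c * (\<Sum>b\<in>A. real (pmul g b) * logw r b) + d * (\<Sum>b\<in>A. real (pmul h b) * logw r b)"
    by (simp add: sum.distrib distrib_right sum_distrib_left mult.assoc)
  also have "(\<Sum>b\<in>A. real (pmul g b) * logw r b) = nev_N r g"
    using assms A by (intro nev_N_sum[symmetric]) (auto simp: A_def)
  also have "(\<Sum>b\<in>A. real (pmul h b) * logw r b) = nev_N r h"
    using assms A by (intro nev_N_sum[symmetric]) (auto simp: A_def)
  finally show ?thesis .
qed

lemma nev_N_nonneg:
  assumes "mero f" "r \<ge> 1"
  shows "nev_N r f \<ge> 0"
  using nev_N_mono[of "\<lambda>_. 0" f f 1 0 r] nev_N_sum[of "\<lambda>_. 0" r "{}"] assms pmul_analytic[of "\<lambda>_. 0"]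
  by (simp add: meromorphic_intros)

lemma nev_N_entire: "f holomorphic_on UNIV \<Longrightarrow> r \<ge> 1 \<Longrightarrow> nev_N r f = 0"
  using nev_N_sum[of f r "{}"] pmul_analytic[of f]
  by (auto simp: analytic_on_imp_meromorphic_on analytic_on_open holomorphic_on_imp_analytic_at)

text \<open>The order is the zero multiplicity minus the pole multiplicity, and the zeros of
  \<open>f\<close> are the poles of its inverse.\<close>

lemma jensen_nev_N:
  assumes f: "mero f"
  shows "\<exists>C. \<forall>r. good_radius f r \<longrightarrow>
    cmean r (\<lambda>w. ln (norm (f w))) = C + nev_N r (\<lambda>z. inverse (f z)) - nev_N r f"
proof -
  obtain C where C: "\<And>r. good_radius f r \<Longrightarrow>
    cmean r (\<lambda>w. ln (norm (f w))) = C + (\<Sum>a\<in>divisor_in f r. of_int (mord f a) * logw r a)"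
    using jensen[OF f] by blast
  show ?thesis
  proof (intro exI[of _ C] allI impI)
    fix r assume good: "good_radius f r"
    then have r: "r > 0" by (simp add: good_radius_def)
    have m0: "norm z < r" if "norm z \<le> r" "mord f z \<noteq> 0" for z
      using good_radius_mord[OF good, of z] that by fastforce
    have "nev_N r f = (\<Sum>a\<in>divisor_in f r. real (pmul f a) * logw r a)"
      by (intro nev_N_sum f r finite_divisor_in) (auto simp: divisor_in_def pmul_def intro!: m0)
    moreover have "nev_N r (\<lambda>z. inverse (f z)) = (\<Sum>a\<in>divisor_in f r. real (pmul (\<lambda>z. inverse (f z)) a) * logw r a)"
      by (intro nev_N_sum f r finite_divisor_in meromorphic_intros) (auto simp: divisor_in_def pmul_inverse[OF f] intro!: m0)
    moreover have "(\<Sum>a\<in>divisor_in f r. real (pmul (\<lambda>z. inverse (f z)) a) * logw r a) - (\<Sum>a\<in>divisor_in f r. real (pmul f a) * logw r a)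
       = (\<Sum>a\<in>divisor_in f r. of_int (mord f a) * logw r a)"
      unfolding sum_subtractf[symmetric] pmul_inverse[OF f] pmul_def left_diff_distrib[symmetric]
      by (intro sum.cong refl arg_cong[of _ _ "\<lambda>x. x * _"]) auto
    ultimately show "cmean r (\<lambda>w. ln (norm (f w))) = C + nev_N r (\<lambda>z. inverse (f z)) - nev_N r f"
      using C[OF good] by simp
  qed
qed

subsection \<open>Proximity functions\<close>

lemma log_plus_altdef: "log_plus x = ln (max 1 x)"
  by (simp add: log_plus_def max_def)

lemma log_plus_nonneg [simp]: "log_plus x \<ge> 0"
  by (simp add: log_plus_altdef)

lemma log_plus_mono: "x \<le> y \<Longrightarrow> log_plus x \<le> log_plus y"
  by (simp add: log_plus_altdef)

lemma log_plus_mult: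
  assumes "x \<ge> 0" "y \<ge> 0"
  shows "log_plus (x * y) \<le> log_plus x + log_plus y"
proof -
  have "max 1 (x * y) \<le> max 1 x * max 1 y"
    using assms mult_mono[of x "max 1 x" y "max 1 y"] mult_mono[of 1 "max 1 x" 1 "max 1 y"] by auto
  then have "ln (max 1 (x * y)) \<le> ln (max 1 x * max 1 y)" by (subst ln_le_cancel_iff) auto
  also have "\<dots> = ln (max 1 x) + ln (max 1 y)" by (rule ln_mult_pos) auto
  finally show ?thesis by (simp add: log_plus_altdef)
qed

lemma log_plus_add:
  assumes "x \<ge> 0" "y \<ge> 0"
  shows "log_plus (x + y) \<le> log_plus x + log_plus y + ln 2"
proof -
  have "x + y \<le> 2 * max x y" by simp
  then have "log_plus (x + y) \<le> log_plus (2 * max x y)" by (rule log_plus_mono)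
  also have "\<dots> \<le> log_plus 2 + log_plus (max x y)" using assms by (intro log_plus_mult) auto
  also have "log_plus (max x y) \<le> log_plus x + log_plus y" by (auto simp: max_def)
  also have "log_plus 2 = ln (2::real)" by (simp add: log_plus_def)
  finally show ?thesis by simp
qed

lemma ln_eq_log_plus: "x > 0 \<Longrightarrow> ln x = log_plus x - log_plus (inverse x)"
  by (auto simp: log_plus_def ln_inverse inverse_le_1_iff)

lemma ln_le_log_plus: "x \<ge> 0 \<Longrightarrow> ln x \<le> log_plus x"
  by (cases "x = 0") (auto simp: log_plus_def)

lemma log_plus_power: "x \<ge> 0 \<Longrightarrow> log_plus (x ^ n) = n * log_plus x"
  by (cases "n = 0") (auto simp: log_plus_def ln_realpow power_le_one_iff)

lemma continuous_on_log_plus [continuous_intros]: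
  "continuous_on A u \<Longrightarrow> continuous_on A (\<lambda>x. log_plus (u x))"
  unfolding log_plus_altdef by (intro continuous_intros) auto

text \<open>Weaker than \<open>good_radius\<close>: zeros may lie on the circle, because
  \<open>log_plus\<close> is continuous there.\<close>

definition cir :: "(complex \<Rightarrow> complex) \<Rightarrow> real \<Rightarrow> bool" where
  "cir f r \<longleftrightarrow> r > 0 \<and> (\<forall>z\<in>sphere 0 r. f analytic_on {z})"

lemma eventually_cir: "mero f \<Longrightarrow> eventually (cir f) exc_filter"
  by (rule eventually_mono[OF eventually_conj[OF eventually_sphere_exc[OF meromorphic_on_imp_analytic_cosparse] eventually_exc_ge[of 1]]])
     (auto simp: cir_def)

lemma eventually_good: "mero f \<Longrightarrow> nonz f \<Longrightarrow> eventually (good_radius f) exc_filter"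
  using eventually_conj[OF eventually_sphere_exc[OF meromorphic_on_imp_analytic_cosparse[of f]]
     eventually_conj[OF eventually_sphere_exc[of "\<lambda>z. f z \<noteq> 0"] eventually_exc_ge[of 1]]]
  by (auto elim!: eventually_mono simp: good_radius_def)

lemma good_cir: "good_radius f r \<Longrightarrow> cir f r"
  by (simp add: good_radius_def cir_def)

lemma cir_cont: "cir f r \<Longrightarrow> continuous_on (sphere 0 r) f"
  by (simp add: cir_def analytic_imp_holomorphic holomorphic_on_imp_continuous_on analytic_on_analytic_at[of f "sphere 0 r"])

lemma nev_m_eq: "nev_m r f = cmean r (\<lambda>z. log_plus (norm (f z)))"
  by (simp only: nev_m_def cmean_def real_scaleR_def inverse_eq_divide)

lemma nev_m_le:
  assumes "cir f r" "continuous_on (sphere 0 r) v" "\<And>z. norm z = r \<Longrightarrow> log_plus (norm (f z)) \<le> v z"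
  shows "nev_m r f \<le> cmean r v"
  unfolding nev_m_eq using assms cir_cont[OF assms(1)]
  by (intro cmean_mono continuous_intros) (auto simp: cir_def)

lemma nev_m_nonneg:
  assumes "cir f r"
  shows "nev_m r f \<ge> 0"
  unfolding nev_m_eq using assms cir_cont[OF assms(1)]
  by (intro cmean_nonneg continuous_intros) (auto simp: cir_def)

lemma cir_r: "cir f r \<Longrightarrow> 0 \<le> r"
  by (simp add: cir_def)

lemma nev_m_mult:
  assumes "cir f r" "cir g r"
  shows "nev_m r (\<lambda>z. f z * g z) \<le> nev_m r f + nev_m r g"
proof -
  note c = cir_cont[OF assms(1)] cir_cont[OF assms(2)]
  have "nev_m r (\<lambda>z. f z * g z) \<le> cmean r (\<lambda>z. log_plus (norm (f z)) + log_plus (norm (g z)))"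
    using assms c unfolding nev_m_eq
    by (intro cmean_mono continuous_intros) (auto simp: cir_def norm_mult log_plus_mult)
  also have "\<dots> = nev_m r f + nev_m r g"
    unfolding nev_m_eq using assms c by (intro cmean_add continuous_intros) (auto simp: cir_def)
  finally show ?thesis .
qed

lemma nev_m_cong_ev:
  assumes "\<forall>\<^sub>\<approx>z. f z = g z"
  shows "eventually (\<lambda>r. nev_m r f = nev_m r g) exc_filter"
  using eventually_conj[OF eventually_sphere_exc[OF assms] eventually_exc_ge[of 0]]
  by eventually_elim (auto simp: nev_m_eq intro!: cmean_cong)

lemma nev_m_inverse:
  assumes "good_radius f r"
  shows "nev_m r f - nev_m r (\<lambda>z. inverse (f z)) = cmean r (\<lambda>z. ln (norm (f z)))"
    and "nev_m r f + nev_m r (\<lambda>z. inverse (f z)) = cmean r (\<lambda>z. \<bar>ln (norm (f z))\<bar>)"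
proof -
  have nz: "f z \<noteq> 0" if "norm z = r" for z using assms that by (auto simp: good_radius_def)
  have r: "r \<ge> 0" using assms by (simp add: good_radius_def)
  note c = cir_cont[OF good_cir[OF assms]]
  have "cmean r (\<lambda>z. ln (norm (f z))) = cmean r (\<lambda>z. log_plus (norm (f z)) - log_plus (norm (inverse (f z))))"
    using nz ln_eq_log_plus by (intro cmean_cong r) (simp add: norm_inverse)
  also have "\<dots> = nev_m r f - nev_m r (\<lambda>z. inverse (f z))"
    unfolding nev_m_eq using nz by (intro cmean_diff continuous_intros c r) auto
  finally show "nev_m r f - nev_m r (\<lambda>z. inverse (f z)) = cmean r (\<lambda>z. ln (norm (f z)))" ..
  have "cmean r (\<lambda>z. \<bar>ln (norm (f z))\<bar>) = cmean r (\<lambda>z. log_plus (norm (f z)) + log_plus (norm (inverse (f z))))"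
    using nz by (intro cmean_cong r) (auto simp: log_plus_def norm_inverse ln_inverse inverse_le_1_iff)
  also have "\<dots> = nev_m r f + nev_m r (\<lambda>z. inverse (f z))"
    unfolding nev_m_eq using nz by (intro cmean_add continuous_intros c r) auto
  finally show "nev_m r f + nev_m r (\<lambda>z. inverse (f z)) = cmean r (\<lambda>z. \<bar>ln (norm (f z))\<bar>)" ..
qed

text \<open>Jensen's formula with ln x written as \<open>log_plus x - log_plus (inverse x)\<close>.
  On good circles the difference is exactly constant.\<close>

theorem first_main_theorem:
  assumes "mero f"
  shows "\<exists>C. \<forall>r. good_radius f r \<longrightarrow> nev_T r f = nev_T r (\<lambda>z. inverse (f z)) + C"
proof -
  obtain C where "\<And>r. good_radius f r \<Longrightarrow> cmean r (\<lambda>w. ln (norm (f w))) = C + nev_N r (\<lambda>z. inverse (f z)) - nev_N r f"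
    using jensen_nev_N[OF assms] by blast
  then show ?thesis
    by (intro exI[of _ C] allI impI) (use nev_m_inverse(1) in \<open>fastforce simp: nev_T_def\<close>)
qed

subsection \<open>Monotonicity of the characteristic\<close>

text \<open>Blaschke factors have modulus at most one, so the terms of zeros are nonpositive and may
  be dropped, while ln on the circle may be raised to \<open>log_plus\<close>. The right side is
  then nonnegative, which allows \<open>log_plus\<close> on the left too.\<close>

lemma poisson_jensen_log_plus:
  assumes f: "mero f" and good: "good_radius f r" and z: "norm z < r" "f analytic_on {z}" "f z \<noteq> 0"
  shows "log_plus (norm (f z)) \<le> cmean r (\<lambda>w. poiss z w * log_plus (norm (f w)))
           + (\<Sum>a\<in>divisor_in f r. real (pmul f a) * (- ln (norm (blaschke r a z))))"
proof -
  have r: "r > 0" using good by (simp add: good_radius_def)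
  have nz: "f w \<noteq> 0" if "norm w = r" for w using good that by (auto simp: good_radius_def)
  note c = cir_cont[OF good_cir[OF good]]
  have bl: "ln (norm (blaschke r a z)) \<le> 0" if "a \<in> divisor_in f r" for a
  proof -
    have a: "norm a < r" "a \<noteq> z"
      using that mord_analytic_nz[OF z(2,3)] by (auto simp: divisor_in_def)
    then have "0 < norm (blaschke r a z)" using blaschke_eq_0_iff[of a r z] z(1) by auto
    then show ?thesis using norm_blaschke_le[of a r z] a z(1) by simp
  qed
  have c2: "continuous_on (sphere 0 r) (poiss z)"
    unfolding poiss_def using z(1) by (intro continuous_intros) auto
  have le1: "cmean r (\<lambda>w. poiss z w * ln (norm (f w))) \<le> cmean r (\<lambda>w. poiss z w * log_plus (norm (f w)))"
    using r nz z(1) poiss_nonneg_le(1)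
    by (intro cmean_mono continuous_intros c c2 mult_left_mono ln_le_log_plus) auto
  have le2: "(\<Sum>a\<in>divisor_in f r. of_int (mord f a) * ln (norm (blaschke r a z)))
     \<le> (\<Sum>a\<in>divisor_in f r. real (pmul f a) * (- ln (norm (blaschke r a z))))"
  proof (rule sum_mono)
    fix a assume a: "a \<in> divisor_in f r"
    have "of_int (mord f a) * ln (norm (blaschke r a z)) \<le> (- real (pmul f a)) * ln (norm (blaschke r a z))"
      using bl[OF a] by (intro mult_right_mono_neg) (auto simp: pmul_def)
    then show "of_int (mord f a) * ln (norm (blaschke r a z)) \<le> real (pmul f a) * (- ln (norm (blaschke r a z)))"
      by simp
  qed
  have "ln (norm (f z)) \<le> cmean r (\<lambda>w. poiss z w * log_plus (norm (f w)))
           + (\<Sum>a\<in>divisor_in f r. real (pmul f a) * (- ln (norm (blaschke r a z))))"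
    using poisson_jensen(1)[OF f good z] le1 le2 by linarith
  moreover have "0 \<le> cmean r (\<lambda>w. poiss z w * log_plus (norm (f w)))
           + (\<Sum>a\<in>divisor_in f r. real (pmul f a) * (- ln (norm (blaschke r a z))))"
    using r nz z(1) poiss_nonneg_le(1) bl
    by (intro add_nonneg_nonneg cmean_nonneg sum_nonneg continuous_intros c c2 mult_nonneg_nonneg) auto
  ultimately show ?thesis by (simp add: log_plus_def)
qed

text \<open>For fixed \<open>w\<close> the kernel is the real part of a function of \<open>z\<close>
  holomorphic on the smaller disc with value \<open>1\<close> at the origin, so its mean over radius
  \<open>s\<close> is \<open>1\<close>. Exchanging the two integrals gives the claim.\<close>

lemma cmean_poisson_swap:
  fixes u :: "complex \<Rightarrow> real"
  assumes "0 < s" "s < r" "continuous_on (sphere 0 r) u"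
  shows "continuous_on (sphere 0 s) (\<lambda>z. cmean r (\<lambda>w. poiss z w * u w))"
    and "cmean s (\<lambda>z. cmean r (\<lambda>w. poiss z w * u w)) = cmean r u"
proof -
  have ne: "w \<noteq> z" if "norm z = s" "norm w = r" for z w :: complex using that assms by auto
  have r: "r > 0" using assms by simp
  have cu: "continuous_on A (\<lambda>x. u (rcis r (g x)))" if "continuous_on A g" for A :: "'b::topological_space set" and g
    by (rule continuous_on_compose2[OF assms(3)]) (use that r in \<open>auto intro!: continuous_intros\<close>)
  have "continuous_on (sphere 0 s \<times> cbox 0 (2*pi)) (\<lambda>(z,t). poiss z (rcis r t) * u (rcis r t))"
    unfolding poiss_def case_prod_beta
    using ne r by (intro continuous_intros cu) (auto simp: case_prod_beta)
  then have "continuous_on (sphere 0 s) (\<lambda>z. integral (cbox 0 (2*pi)) (\<lambda>t. poiss z (rcis r t) * u (rcis r t)))"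
    by (rule integral_continuous_on_param)
  then show "continuous_on (sphere 0 s) (\<lambda>z. cmean r (\<lambda>w. poiss z w * u w))"
    unfolding cmean_def by (intro continuous_intros) simp
  have sw: "continuous_on (cbox (0, 0) (2*pi, 2*pi)) (\<lambda>(x,t). poiss (rcis s x) (rcis r t) * u (rcis r t))"
    unfolding poiss_def case_prod_beta
    using ne[of "rcis s _" "rcis r _"] r assms(1) by (intro continuous_intros cu) (auto simp: case_prod_beta)
  have P1: "cmean s (\<lambda>z. poiss z w) = 1" if w: "norm w = r" for w
  proof -
    have hol: "(\<lambda>z. (w + z) / (w - z)) holomorphic_on cball 0 s"
      using w assms by (intro holomorphic_intros) auto
    have "cmean s (\<lambda>z. poiss z w) = Re (cmean s (\<lambda>z. (w + z) / (w - z)))"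
      unfolding poiss_def using assms(1) hol
      by (intro cmean_Re holomorphic_on_imp_continuous_on) (auto elim: holomorphic_on_subset)
    also have "\<dots> = 1" using cmean_holomorphic[OF hol assms(1)] w r by auto
    finally show ?thesis .
  qed
  have "cmean s (\<lambda>z. cmean r (\<lambda>w. poiss z w * u w)) =
     integral {0..2*pi} (\<lambda>x. integral {0..2*pi} (\<lambda>t. poiss (rcis s x) (rcis r t) * u (rcis r t))) / (2*pi) / (2*pi)"
    by (simp only: cmean_def real_scaleR_def integral_mult_right divide_inverse mult_ac)
  also have "integral {0..2*pi} (\<lambda>x. integral {0..2*pi} (\<lambda>t. poiss (rcis s x) (rcis r t) * u (rcis r t)))
     = integral {0..2*pi} (\<lambda>t. integral {0..2*pi} (\<lambda>x. poiss (rcis s x) (rcis r t) * u (rcis r t)))"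
    using integral_swap_continuous[OF sw] by simp
  also have "\<dots> = integral {0..2*pi} (\<lambda>t. integral {0..2*pi} (\<lambda>x. poiss (rcis s x) (rcis r t)) * u (rcis r t))"
    by (simp only: integral_mult_left)
  also have "\<dots> / (2*pi) / (2*pi) = inverse (2*pi) * integral {0..2*pi} (\<lambda>t. inverse (2*pi) *
      (integral {0..2*pi} (\<lambda>x. poiss (rcis s x) (rcis r t)) * u (rcis r t)))"
    by (subst integral_mult_right) (simp only: divide_inverse mult_ac)
  also have "\<dots> = cmean r (\<lambda>w. cmean s (\<lambda>z. poiss z w) * u w)"
    by (simp only: cmean_def real_scaleR_def mult.assoc)
  also have "\<dots> = cmean r u"
    using r by (intro cmean_cong) (auto simp: P1)
  finally show "cmean s (\<lambda>z. cmean r (\<lambda>w. poiss z w * u w)) = cmean r u" .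
qed

text \<open>The denominator is zero-free, with mean logarithm \<open>2 * ln r\<close>; the numerator
  is covered by \<open>cmean_ln_dist\<close>.\<close>

lemma cmean_blaschke:
  assumes "0 < s" "s < r" "norm a < r" "norm a \<noteq> s"
  shows "cmean s (\<lambda>z. - ln (norm (blaschke r a z))) = ln r - ln (max s (norm a))"
    and "continuous_on (sphere 0 s) (\<lambda>z. - ln (norm (blaschke r a z)))"
proof -
  have d: "of_real (r\<^sup>2) - cnj a * z \<noteq> 0" if "norm z \<le> r" for z using denom_nz[OF assms(3) that] .
  have za: "z \<noteq> a" if "norm z = s" for z using assms(4) that by auto
  have b0: "blaschke r a z \<noteq> 0" if "norm z = s" for z
    using blaschke_eq_0_iff[of a r z] assms that by auto
  have cb: "continuous_on (sphere 0 s) (blaschke r a)"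
    unfolding blaschke_def using d assms by (intro continuous_intros) auto
  show "continuous_on (sphere 0 s) (\<lambda>z. - ln (norm (blaschke r a z)))"
    using b0 by (intro continuous_intros cb) auto
  have "cmean s (\<lambda>z. - ln (norm (blaschke r a z)))
     = cmean s (\<lambda>z. (ln (norm (of_real (r\<^sup>2) - cnj a * z)) - ln (norm (z - a))) - ln r)"
  proof (rule cmean_cong)
    fix z :: complex assume z: "norm z = s"
    then show "- ln (norm (blaschke r a z)) = (ln (norm (of_real (r\<^sup>2) - cnj a * z)) - ln (norm (z - a))) - ln r"
      unfolding blaschke_def norm_divide norm_mult using d[of z] za[OF z] assms
      by (simp add: ln_div ln_mult)
  qed (use assms in auto)
  also have "\<dots> = cmean s (\<lambda>z. ln (norm (of_real (r\<^sup>2) - cnj a * z)) - ln (norm (z - a))) - cmean s (\<lambda>_. ln r)"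
    using assms d za by (intro cmean_diff continuous_intros) auto
  also have "cmean s (\<lambda>z. ln (norm (of_real (r\<^sup>2) - cnj a * z)) - ln (norm (z - a)))
     = cmean s (\<lambda>z. ln (norm (of_real (r\<^sup>2) - cnj a * z))) - cmean s (\<lambda>z. ln (norm (z - a)))"
    using assms d za by (intro cmean_diff continuous_intros) auto
  also have "cmean s (\<lambda>z. ln (norm (of_real (r\<^sup>2) - cnj a * z))) = ln (norm (of_real (r\<^sup>2) - cnj a * 0))"
    using assms d by (intro zero_free_mean[of _ r]) (auto intro!: holomorphic_intros)
  also have "\<dots> = 2 * ln r" using assms by (simp add: norm_power ln_realpow)
  finally show "cmean s (\<lambda>z. - ln (norm (blaschke r a z))) = ln r - ln (max s (norm a))"
    using cmean_ln_dist[OF assms(1,4)] by simp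
qed

text \<open>Averaging \<open>poisson_jensen_log_plus\<close> over the circle of radius
  \<open>s\<close> turns the Poisson mean into \<open>nev_m r f\<close> and the pole terms into
  exactly \<open>nev_N r f - nev_N s f\<close>.\<close>

theorem nev_T_mono:
  assumes f: "mero f" and good: "good_radius f s" "good_radius f r" and s: "s < r"
  shows "nev_T s f \<le> nev_T r f"
proof -
  define A where "A = divisor_in f r"
  have s0: "s > 0" using good by (simp add: good_radius_def)
  have finA: "finite A" unfolding A_def by (rule finite_divisor_in[OF f])
  have Ar: "norm a < r" "norm a \<noteq> s" if "a \<in> A" for a
    using that good_radius_mord[OF good(1)] by (auto simp: A_def divisor_in_def)
  note c = cir_cont[OF good_cir[OF good(1)]] cir_cont[OF good_cir[OF good(2)]]
  have cl: "continuous_on (sphere 0 r) (\<lambda>w. log_plus (norm (f w)))"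
    by (intro continuous_intros c)
  note sw = cmean_poisson_swap[OF s0 s cl]
  have cs: "continuous_on (sphere 0 s) (\<lambda>z. \<Sum>a\<in>A. real (pmul f a) * (- ln (norm (blaschke r a z))))"
    using Ar by (intro continuous_on_sum continuous_on_mult continuous_on_const cmean_blaschke(2) s0 s) auto
  have "nev_m s f \<le> cmean s (\<lambda>z. cmean r (\<lambda>w. poiss z w * log_plus (norm (f w)))
           + (\<Sum>a\<in>A. real (pmul f a) * (- ln (norm (blaschke r a z)))))"
    using poisson_jensen_log_plus[OF f good(2)] good(1) s
    by (intro nev_m_le good_cir continuous_on_add sw(1) cs) (auto simp: A_def good_radius_def)
  also have "\<dots> = cmean s (\<lambda>z. cmean r (\<lambda>w. poiss z w * log_plus (norm (f w))))
      + cmean s (\<lambda>z. \<Sum>a\<in>A. real (pmul f a) * (- ln (norm (blaschke r a z))))"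
    using s0 by (intro cmean_add sw(1) cs) auto
  also have "cmean s (\<lambda>z. cmean r (\<lambda>w. poiss z w * log_plus (norm (f w)))) = nev_m r f"
    unfolding nev_m_eq by (rule sw(2))
  also have "cmean s (\<lambda>z. \<Sum>a\<in>A. real (pmul f a) * (- ln (norm (blaschke r a z))))
      = (\<Sum>a\<in>A. cmean s (\<lambda>z. real (pmul f a) * (- ln (norm (blaschke r a z)))))"
    using s0 s Ar by (intro cmean_sum continuous_on_mult continuous_on_const cmean_blaschke(2)) auto
  also have "\<dots> = (\<Sum>a\<in>A. real (pmul f a) * (ln r - ln (max s (norm a))))"
    using Ar s0 s by (intro sum.cong refl) (subst cmean_cmult, subst cmean_blaschke(1)[OF s0 s Ar], auto)
  finally have m: "nev_m s f \<le> nev_m r f + (\<Sum>a\<in>A. real (pmul f a) * (ln r - ln (max s (norm a))))" .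
  have m0: "norm z < r" if "norm z \<le> r" "mord f z \<noteq> 0" for z
    using good_radius_mord[OF good(2), of z] that by fastforce
  have Nr: "nev_N r f = (\<Sum>a\<in>A. real (pmul f a) * logw r a)"
    unfolding A_def using s0 s by (intro nev_N_sum f finite_divisor_in) (auto simp: divisor_in_def pmul_def intro!: m0)
  have finB: "finite {a\<in>A. norm a \<le> s}" using finA by simp
  have "nev_N s f = (\<Sum>a\<in>{a\<in>A. norm a \<le> s}. real (pmul f a) * logw s a)"
    using s0 s by (intro nev_N_sum f finB) (auto simp: A_def divisor_in_def pmul_def)
  also have "\<dots> = (\<Sum>a\<in>A. if norm a \<le> s then real (pmul f a) * logw s a else 0)"
    by (rule sum.inter_filter[OF finA])
  finally have Ns: "nev_N s f = (\<Sum>a\<in>A. if norm a \<le> s then real (pmul f a) * logw s a else 0)" .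
  have "nev_N r f = (\<Sum>a\<in>A. (if norm a \<le> s then real (pmul f a) * logw s a else 0) + real (pmul f a) * (ln r - ln (max s (norm a))))"
    unfolding Nr
  proof (intro sum.cong refl)
    fix a assume a: "a \<in> A"
    show "real (pmul f a) * logw r a = (if norm a \<le> s then real (pmul f a) * logw s a else 0) + real (pmul f a) * (ln r - ln (max s (norm a)))"
      using Ar[OF a] s0 s by (auto simp: logw_def ln_div max_def algebra_simps)
  qed
  then have "nev_N r f = nev_N s f + (\<Sum>a\<in>A. real (pmul f a) * (ln r - ln (max s (norm a))))"
    unfolding Ns sum.distrib .
  then show ?thesis using m by (simp add: nev_T_def)
qed

subsection \<open>The logarithmic derivative\<close>

lemma abs_sin_ge_third:
  assumes "\<bar>u\<bar> \<le> pi / 2"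
  shows "\<bar>u\<bar> / 3 \<le> \<bar>sin (u::real)\<bar>"
proof -
  have "\<bar>sin u - (\<Sum>m<3. sin_coeff m * u ^ m)\<bar> \<le> inverse (fact 3) * \<bar>u\<bar> ^ 3"
    by (rule Maclaurin_sin_bound)
  moreover have "(\<Sum>m<3. sin_coeff m * u ^ m) = u"
    by (simp add: sin_coeff_def numeral_eq_Suc)
  moreover have "inverse (fact 3) * \<bar>u\<bar> ^ 3 \<le> \<bar>u\<bar> * 2 / 3"
  proof -
    \<comment> \<open>With |u| at most 2 the cubic Taylor remainder |u|^3 / 6 is at most 2 |u| / 3,
      which leaves a third of |u|.\<close>
    have "\<bar>u\<bar> \<le> 2" using assms pi_less_4 by linarith
    then have "\<bar>u\<bar> ^ 2 \<le> 2 ^ 2" by (intro power_mono) auto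
    then have "\<bar>u\<bar> * \<bar>u\<bar> ^ 2 \<le> \<bar>u\<bar> * 4" by (intro mult_left_mono) auto
    then show ?thesis by (simp add: fact_numeral power3_eq_cube power2_eq_square)
  qed
  ultimately show ?thesis by linarith
qed

text \<open>The antiderivative 2 sgn(t - c) sqrt |t - c| is continuous across the singularity and
  has modulus at most 20 within distance 100 of \<open>c\<close>. The generous numbers make the
  bound uniform in \<open>c\<close>.\<close>

lemma has_integral_inverse_sqrt:
  assumes "a \<le> b" "\<bar>a - c\<bar> \<le> 100" "\<bar>b - c\<bar> \<le> 100"
  shows "\<exists>I. ((\<lambda>t. 1 / sqrt \<bar>t - c\<bar>) has_integral I) {a..b} \<and> I \<le> 40"
proof -
  define F where "F = (\<lambda>t. 2 * (sgn (t - c) * sqrt \<bar>t - c\<bar>))"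
  have F: "F = (\<lambda>t. if t \<le> c then - 2 * sqrt (c - t) else 2 * sqrt (t - c))"
  proof
    show "F t = (if t \<le> c then - 2 * sqrt (c - t) else 2 * sqrt (t - c))" for t
      by (cases t c rule: linorder_cases) (simp_all add: F_def)
  qed
  have "((\<lambda>t. 1 / sqrt \<bar>t - c\<bar>) has_integral (F b - F a)) {a..b}"
  proof (rule fundamental_theorem_of_calculus_strong[of "{c}"])
    show "continuous_on {a..b} F"
      unfolding F
      by (rule continuous_on_subset[of UNIV]) (intro continuous_on_cases_le[where h = "\<lambda>x. x", simplified] continuous_intros, auto)
    fix t assume t: "t \<in> {a..b} - {c}"
    show "(F has_vector_derivative 1 / sqrt \<bar>t - c\<bar>) (at t)"
    proof (cases "t < c")
      case True
      have "((\<lambda>t. - 2 * sqrt (c - t)) has_real_derivative 1 / sqrt \<bar>t - c\<bar>) (at t)"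
        using True by (auto intro!: derivative_eq_intros simp: field_simps)
      then have "(F has_real_derivative 1 / sqrt \<bar>t - c\<bar>) (at t)"
        by (rule has_field_derivative_transform_within_open[where S = "{..<c}"]) (use True in \<open>auto simp: F\<close>)
      then show ?thesis by (simp add: has_real_derivative_iff_has_vector_derivative)
    next
      case False
      then have ct: "t > c" using t by auto
      have "((\<lambda>t. 2 * sqrt (t - c)) has_real_derivative 1 / sqrt \<bar>t - c\<bar>) (at t)"
        using ct by (auto intro!: derivative_eq_intros simp: field_simps)
      then have "(F has_real_derivative 1 / sqrt \<bar>t - c\<bar>) (at t)"
        by (rule has_field_derivative_transform_within_open[where S = "{c<..}"]) (use ct in \<open>auto simp: F\<close>)
      then show ?thesis by (simp add: has_real_derivative_iff_has_vector_derivative)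
    qed
  qed (use assms in auto)
  moreover have "\<bar>F t\<bar> \<le> 20" if "\<bar>t - c\<bar> \<le> 100" for t
  proof -
    have "sqrt \<bar>t - c\<bar> \<le> 10" using that by (intro real_le_lsqrt) auto
    then show ?thesis by (auto simp: F_def abs_mult sgn_if)
  qed
  then have "F b - F a \<le> 40" using assms(2,3) by (smt (verit))
  ultimately show ?thesis by blast
qed

text \<open>Rotating \<open>a\<close> onto the nonnegative real axis leaves only
  \<open>r * sin (t - Arg a)\<close> in the imaginary part of the difference.\<close>

lemma dist_circle_ge:
  assumes "r \<ge> 1"
  shows "\<bar>sin (t - Arg a)\<bar> \<le> norm (rcis r t - a)"
proof -
  have "(rcis r t - a) * cis (- Arg a) = rcis r (t - Arg a) - of_real (norm a)"
  proof -
    have "a * cis (- Arg a) = of_real (norm a)"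
      by (subst (1) rcis_cmod_Arg[symmetric]) (simp only: rcis_def mult.assoc cis_mult, simp)
    moreover have "rcis r t * cis (- Arg a) = rcis r (t - Arg a)"
      by (simp only: rcis_def mult.assoc cis_mult) simp
    ultimately show ?thesis by (simp only: left_diff_distrib)
  qed
  then have "Im ((rcis r t - a) * cis (- Arg a)) = r * sin (t - Arg a)" by simp
  moreover have "\<bar>Im ((rcis r t - a) * cis (- Arg a))\<bar> \<le> norm (rcis r t - a)"
    using abs_Im_le_cmod[of "(rcis r t - a) * cis (- Arg a)"] by (simp add: norm_mult)
  moreover have "\<bar>sin (t - Arg a)\<bar> \<le> \<bar>r * sin (t - Arg a)\<bar>"
    using assms by (simp add: abs_mult mult_left_le_one_le mult_le_cancel_right1)
  ultimately show ?thesis by simp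
qed

text \<open>The constant is uniform although the integrand is unbounded for \<open>a\<close> near the circle.\<close>
lemma cmean_inverse_sqrt_dist:
  assumes "r \<ge> 1" "norm a \<noteq> r"
  shows "cmean r (\<lambda>z. 1 / sqrt (norm (z - a))) \<le> 400"
proof -
  \<comment> \<open>The \<open>c k\<close> are zeros of \<open>sin (t - Arg a)\<close>. As
    \<open>t - Arg a\<close> lies between -pi and 3 pi, rounding it to a multiple of pi gives an
    index in \<open>{-1..3}\<close>. Five integrals of at most 40, each times sqrt 3 < 2, give
    400.\<close>
  define c where "c = (\<lambda>k::int. Arg a + of_int k * pi)"
  define g where "g = (\<lambda>t. \<Sum>k\<in>{-1..3}. sqrt 3 * (1 / sqrt \<bar>t - c k\<bar>))"
  define v where "v = (\<lambda>t. 1 / sqrt (norm (rcis r t - a)))"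
  have Arg: "- pi < Arg a" "Arg a \<le> pi" using Arg_bounded by auto
  have "\<exists>I. ((\<lambda>t. 1 / sqrt \<bar>t - c k\<bar>) has_integral I) {0..2*pi} \<and> I \<le> 40" if k: "k \<in> {-1..3}" for k
  proof -
    have "of_int k * pi \<le> 3 * pi" "(-1) * pi \<le> of_int k * pi"
      using k by (intro mult_right_mono; simp)+
    then have "\<bar>c k\<bar> \<le> 20" using Arg pi_less_4 unfolding c_def by linarith
    then have "\<bar>0 - c k\<bar> \<le> 100" "\<bar>2*pi - c k\<bar> \<le> 100" using pi_less_4 pi_gt_zero by linarith+
    then show ?thesis
      by (intro has_integral_inverse_sqrt) simp_all
  qed
  then obtain I where I: "\<And>k. k \<in> {-1..3} \<Longrightarrow> ((\<lambda>t. 1 / sqrt \<bar>t - c k\<bar>) has_integral I k) {0..2*pi}"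
     "\<And>k. k \<in> {-1..3} \<Longrightarrow> I k \<le> 40" by metis
  have gI: "(g has_integral (\<Sum>k\<in>{-1..3}. sqrt 3 * I k)) {0..2*pi}"
    unfolding g_def by (intro has_integral_sum has_integral_mult_right I) auto
  have sum: "(\<Sum>k\<in>{-1..3::int}. sqrt 3 * I k) \<le> 400"
  proof -
    have "sqrt 3 \<le> 2" by (intro real_le_lsqrt) auto
    then have "sqrt 3 * I k \<le> 80" if "k \<in> {-1..3}" for k
    proof (cases "I k \<ge> 0")
      case True
      then show ?thesis using \<open>sqrt 3 \<le> 2\<close> mult_mono[of "sqrt 3" 2 "I k" 40] I(2)[OF that] by simp
    next
      case False
      then have "sqrt 3 * I k \<le> 0" by (intro mult_nonneg_nonpos) auto
      then show ?thesis by linarith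
    qed
    then have "(\<Sum>k\<in>{-1..3::int}. sqrt 3 * I k) \<le> (\<Sum>k\<in>{-1..3::int}. 80)" by (intro sum_mono) auto
    then show ?thesis by simp
  qed
  have cont: "continuous_on (sphere 0 r) (\<lambda>z. 1 / sqrt (norm (z - a)))"
    using assms by (intro continuous_intros) auto
  have vint: "v integrable_on {0..2*pi}"
    unfolding v_def using cmean_integrable[OF cont] assms by simp
  \<comment> \<open>At a point \<open>c k\<close> the corresponding term of \<open>g\<close> is
    \<open>0\<close> by division by zero, so \<open>v\<close> need not lie below \<open>g\<close>
    there; changing \<open>v\<close> on this finite set leaves its integral alone.\<close>
  define w where "w = (\<lambda>t. if t \<in> c ` {-1..3} then 0 else v t)"
  have neg: "negligible (c ` {-1..3})" by (intro negligible_finite) auto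
  have wint: "(w has_integral integral {0..2*pi} v) {0..2*pi}"
    by (rule has_integral_spike[OF neg _ integrable_integral[OF vint]]) (auto simp: w_def)
  have le: "w t \<le> g t" if t: "t \<in> {0..2*pi}" for t
  proof (cases "t \<in> c ` {-1..3}")
    case True
    then show ?thesis by (auto simp: w_def g_def intro!: sum_nonneg)
  next
    case False
    define u where "u = t - Arg a"
    define k where "k = round (u / pi)"
    have u: "-1 \<le> u / pi" "u / pi \<le> 3" using t Arg by (auto simp: u_def field_simps)
    have k: "k \<in> {-1..3}"
      using round_mono[OF u(1)] round_mono[OF u(2)] by (simp add: k_def round_numeral)
         (metis of_int_minus of_int_1 round_of_int)
    have "\<bar>of_int k - u / pi\<bar> \<le> 1 / 2" unfolding k_def by (rule of_int_round_abs_le)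
    then have "\<bar>of_int k - u / pi\<bar> * pi \<le> 1 / 2 * pi" by (intro mult_right_mono) auto
    moreover have "u - of_int k * pi = - ((of_int k - u / pi) * pi)" by (simp add: field_simps)
    then have "\<bar>u - of_int k * pi\<bar> = \<bar>of_int k - u / pi\<bar> * pi" by (simp only: abs_minus_cancel abs_mult) simp
    ultimately have "\<bar>u - of_int k * pi\<bar> \<le> pi / 2" by linarith
    then have "\<bar>u - of_int k * pi\<bar> / 3 \<le> \<bar>sin (u - of_int k * pi)\<bar>" by (rule abs_sin_ge_third)
    also have "\<bar>sin (u - of_int k * pi)\<bar> = \<bar>sin u\<bar>"
      using sin_npi_int[of k] cos_npi_int[of k] by (simp add: sin_diff mult.commute split: if_splits)
    also have "\<dots> \<le> norm (rcis r t - a)" unfolding u_def by (rule dist_circle_ge[OF assms(1)])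
    finally have d: "\<bar>t - c k\<bar> / 3 \<le> norm (rcis r t - a)" by (simp add: u_def c_def algebra_simps)
    have pos: "\<bar>t - c k\<bar> > 0" using False k by auto
    have "v t \<le> 1 / sqrt (\<bar>t - c k\<bar> / 3)"
      unfolding v_def using d pos by (intro divide_left_mono real_sqrt_le_mono mult_pos_pos) auto
    also have "\<dots> = sqrt 3 * (1 / sqrt \<bar>t - c k\<bar>)" by (simp add: real_sqrt_divide)
    also have "\<dots> \<le> g t" unfolding g_def
      using k by (intro member_le_sum[of k]) auto
    finally show ?thesis using False by (simp add: w_def)
  qed
  have "integral {0..2*pi} v \<le> (\<Sum>k\<in>{-1..3}. sqrt 3 * I k)"
    by (rule has_integral_le[OF wint gI le])
  then have "integral {0..2*pi} v \<le> 400" using sum by linarith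
  moreover have "0 \<le> integral {0..2*pi} v" by (intro integral_nonneg vint) (auto simp: v_def)
  ultimately have "integral {0..2*pi} v / (2*pi) \<le> 400 / 1"
    using pi_ge_two by (intro frac_le) auto
  moreover have "cmean r (\<lambda>z. 1 / sqrt (norm (z - a))) = integral {0..2*pi} v / (2*pi)"
    unfolding cmean_def v_def real_scaleR_def by (subst mult.commute) (simp only: divide_inverse)
  ultimately show ?thesis by simp
qed

lemma sum_power2_le_power2_sum:
  fixes x :: "'a \<Rightarrow> real"
  assumes "\<And>a. a \<in> A \<Longrightarrow> x a \<ge> 0"
  shows "(\<Sum>a\<in>A. (x a)\<^sup>2) \<le> (\<Sum>a\<in>A. x a)\<^sup>2"
  using assms
proof (induction A rule: infinite_finite_induct)
  case (insert a A)
  have "0 \<le> 2 * x a * (\<Sum>a\<in>A. x a)" using insert by (intro mult_nonneg_nonneg sum_nonneg) auto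
  then show ?case using insert by (simp add: power2_sum)
qed auto

text \<open>The differentiated Poisson-Jensen formula on the outer circle bounds |f'/f| by
  \<open>B\<close> plus the sum of |mord f a| / |z - a|. The mean of 1 / |z - a| is not uniformly
  bounded as \<open>a\<close> approaches the circle, so the sum is dominated by the square of a sum
  of inverse square roots, whose means are uniformly bounded.\<close>

lemma log_deriv_estimate:
  assumes f: "mero f" and good: "good_radius f r" "good_radius f \<rho>" and r: "1 \<le> r" "r < \<rho>"
  defines "M \<equiv> nev_m \<rho> f + nev_m \<rho> (\<lambda>z. inverse (f z))"
  defines "n \<equiv> (\<Sum>a\<in>divisor_in f \<rho>. real_of_int \<bar>mord f a\<bar>)"
  defines "B \<equiv> 2 * \<rho> / (\<rho> - r)\<^sup>2 * M + n / (\<rho> - r)"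
  shows "nev_m r (\<lambda>z. deriv f z / f z) \<le> ln (1 + B) + 2 * ln (1 + 400 * n)"
proof -
  define A where "A = divisor_in f \<rho>"
  have finA: "finite A" unfolding A_def by (rule finite_divisor_in[OF f])
  have Ar: "norm a < \<rho>" "norm a \<noteq> r" "\<bar>mord f a\<bar> \<ge> 1" if "a \<in> A" for a
    using that good_radius_mord[OF good(1)] by (auto simp: A_def divisor_in_def)
  note c\<rho> = cir_cont[OF good_cir[OF good(2)]]
  have nz\<rho>: "f w \<noteq> 0" if "norm w = \<rho>" for w using good(2) that by (auto simp: good_radius_def)
  have n0: "n \<ge> 0" unfolding n_def by (intro sum_nonneg) auto
  have M_eq: "M = cmean \<rho> (\<lambda>w. \<bar>ln (norm (f w))\<bar>)" unfolding M_def by (rule nev_m_inverse(2)[OF good(2)])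
  have M0: "M \<ge> 0" unfolding M_eq using r nz\<rho> by (intro cmean_nonneg continuous_intros c\<rho>) auto
  have B0: "B \<ge> 0" unfolding B_def using r M0 n0 by (intro add_nonneg_nonneg mult_nonneg_nonneg divide_nonneg_nonneg) auto
  define Y where "Y = (\<lambda>z. \<Sum>a\<in>A. real_of_int \<bar>mord f a\<bar> / norm (z - a))"
  define X where "X = (\<lambda>z. \<Sum>a\<in>A. real_of_int \<bar>mord f a\<bar> * (1 / sqrt (norm (z - a))))"
  have bound: "norm (deriv f z / f z) \<le> B + Y z" if z: "norm z = r" for z
  proof -
    have fz: "f analytic_on {z}" "f z \<noteq> 0" using good(1) z by (auto simp: good_radius_def)
    have zr: "norm z < \<rho>" using z r by simp
    have zw: "\<rho> - r \<le> norm (w - z)" if "norm w = \<rho>" for w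
      using norm_triangle_ineq2[of w z] that z by simp
    have "norm (cmean \<rho> (\<lambda>w. complex_of_real (2 * ln (norm (f w))) * (w / (w - z)\<^sup>2)))
       \<le> cmean \<rho> (\<lambda>w. (2 * \<rho> / (\<rho> - r)\<^sup>2) * \<bar>ln (norm (f w))\<bar>)"
    proof (rule norm_cmean_le)
      show "continuous_on (sphere 0 \<rho>) (\<lambda>w. complex_of_real (2 * ln (norm (f w))) * (w / (w - z)\<^sup>2))"
        using nz\<rho> zr by (intro continuous_intros c\<rho>) auto
      show "continuous_on (sphere 0 \<rho>) (\<lambda>w. (2 * \<rho> / (\<rho> - r)\<^sup>2) * \<bar>ln (norm (f w))\<bar>)"
        using nz\<rho> r by (intro continuous_intros c\<rho>) auto
      fix w :: complex assume w: "norm w = \<rho>"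
      have "norm (complex_of_real (2 * ln (norm (f w))) * (w / (w - z)\<^sup>2)) = (2 * \<bar>ln (norm (f w))\<bar>) * (\<rho> / (norm (w - z))\<^sup>2)"
        using w by (simp add: norm_mult norm_divide norm_power)
      also have "\<dots> \<le> (2 * \<bar>ln (norm (f w))\<bar>) * (\<rho> / (\<rho> - r)\<^sup>2)"
        using zw[OF w] r by (intro mult_left_mono divide_left_mono power_mono mult_pos_pos) auto
      finally show "norm (complex_of_real (2 * ln (norm (f w))) * (w / (w - z)\<^sup>2)) \<le> (2 * \<rho> / (\<rho> - r)\<^sup>2) * \<bar>ln (norm (f w))\<bar>"
        by (simp add: mult_ac)
    qed (use r in auto)
    also have "\<dots> = 2 * \<rho> / (\<rho> - r)\<^sup>2 * M" unfolding M_eq by (rule cmean_cmult)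
    finally have 1: "norm (cmean \<rho> (\<lambda>w. complex_of_real (2 * ln (norm (f w))) * (w / (w - z)\<^sup>2))) \<le> 2 * \<rho> / (\<rho> - r)\<^sup>2 * M" .
    have "norm (\<Sum>a\<in>A. of_int (mord f a) * (1 / (z - a) + cnj a / (of_real (\<rho>\<^sup>2) - cnj a * z)))
       \<le> (\<Sum>a\<in>A. real_of_int \<bar>mord f a\<bar> / norm (z - a) + real_of_int \<bar>mord f a\<bar> / (\<rho> - r))"
    proof (rule sum_norm_le)
      fix a assume a: "a \<in> A"
      have "\<rho> * (\<rho> - r) \<le> norm (of_real (\<rho>\<^sup>2) - cnj a * z)"
      proof -
        have "norm (of_real (\<rho>\<^sup>2) - cnj a * z) \<ge> norm (complex_of_real (\<rho>\<^sup>2)) - norm (cnj a * z)" by (rule norm_triangle_ineq2)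
        moreover have "norm (cnj a * z) \<le> \<rho> * r"
          using Ar[OF a] z r by (simp add: norm_mult mult_right_mono)
        moreover have "norm (complex_of_real (\<rho>\<^sup>2)) = \<rho> * \<rho>" by (simp only: norm_of_real) (simp add: power2_eq_square)
        ultimately show ?thesis by (simp add: algebra_simps)
      qed
      then have "norm (cnj a / (of_real (\<rho>\<^sup>2) - cnj a * z)) \<le> \<rho> / (\<rho> * (\<rho> - r))"
        unfolding norm_divide using Ar[OF a] r by (intro frac_le) auto
      then have "norm (cnj a / (of_real (\<rho>\<^sup>2) - cnj a * z)) \<le> 1 / (\<rho> - r)" using r by simp
      then have "norm (1 / (z - a) + cnj a / (of_real (\<rho>\<^sup>2) - cnj a * z)) \<le> 1 / norm (z - a) + 1 / (\<rho> - r)"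
        by (intro order_trans[OF norm_triangle_ineq] add_mono) (auto simp: norm_divide)
      then have "real_of_int \<bar>mord f a\<bar> * norm (1 / (z - a) + cnj a / (of_real (\<rho>\<^sup>2) - cnj a * z))
          \<le> real_of_int \<bar>mord f a\<bar> * (1 / norm (z - a) + 1 / (\<rho> - r))"
        by (intro mult_left_mono) auto
      then show "norm (of_int (mord f a) * (1 / (z - a) + cnj a / (of_real (\<rho>\<^sup>2) - cnj a * z)))
        \<le> real_of_int \<bar>mord f a\<bar> / norm (z - a) + real_of_int \<bar>mord f a\<bar> / (\<rho> - r)"
        unfolding norm_mult norm_of_int of_int_abs by (simp add: distrib_left)
    qed
    also have "\<dots> = Y z + n / (\<rho> - r)"
      by (simp add: Y_def n_def A_def sum.distrib sum_divide_distrib)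
    finally have 2: "norm (\<Sum>a\<in>A. of_int (mord f a) * (1 / (z - a) + cnj a / (of_real (\<rho>\<^sup>2) - cnj a * z))) \<le> Y z + n / (\<rho> - r)" .
    show ?thesis
      using poisson_jensen(2)[OF f good(2) zr fz, folded A_def] 1 2
      by (simp only: B_def) (smt (verit) norm_triangle_ineq)
  qed
  have X0: "X z \<ge> 0" for z unfolding X_def by (intro sum_nonneg) auto
  have YX: "Y z \<le> (X z)\<^sup>2" for z
  proof -
    have "Y z \<le> (\<Sum>a\<in>A. (real_of_int \<bar>mord f a\<bar> * (1 / sqrt (norm (z - a))))\<^sup>2)"
      unfolding Y_def
    proof (rule sum_mono)
      fix a assume "a \<in> A"
      \<comment> \<open>Orders in the divisor are nonzero integers, so they are at most their own
        squares in modulus; this lets the multiplicity be squared along with the root.\<close>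
      then have "(1::real) \<le> real_of_int \<bar>mord f a\<bar>" using Ar(3) by (metis of_int_1_le_iff)
      then have "real_of_int \<bar>mord f a\<bar> * 1 \<le> real_of_int \<bar>mord f a\<bar> * real_of_int \<bar>mord f a\<bar>"
        by (intro mult_left_mono) auto
      then have "real_of_int \<bar>mord f a\<bar> / norm (z - a) \<le> (real_of_int \<bar>mord f a\<bar>)\<^sup>2 / norm (z - a)"
        by (intro divide_right_mono) (auto simp: power2_eq_square)
      then show "real_of_int \<bar>mord f a\<bar> / norm (z - a) \<le> (real_of_int \<bar>mord f a\<bar> * (1 / sqrt (norm (z - a))))\<^sup>2"
        by (simp add: power_divide)
    qed
    also have "\<dots> \<le> (X z)\<^sup>2" unfolding X_def by (rule sum_power2_le_power2_sum) auto
    finally show ?thesis .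
  qed
  \<comment> \<open>\<open>m\<close> is an upper bound for the mean of \<open>1 + X\<close>. The
    tangent of ln at \<open>m\<close> therefore gives \<open>ln m\<close> after averaging, as in
    Jensen's inequality for the concave logarithm: the linear terms are bounded by exactly
    \<open>2 * (1 - 1 / m)\<close>.\<close>
  define m where "m = 1 + 400 * n"
  have m1: "m \<ge> 1" using n0 by (simp add: m_def)
  have pt: "log_plus (norm (deriv f z / f z)) \<le> (ln (1 + B) + 2 * ln m - 2 * (1 - 1 / m)) + (2 / m) * X z" if z: "norm z = r" for z
  proof -
    have Y0: "Y z \<ge> 0" unfolding Y_def by (intro sum_nonneg) auto
    have "log_plus (norm (deriv f z / f z)) \<le> log_plus (B + Y z)" by (rule log_plus_mono[OF bound[OF z]])
    also have "\<dots> \<le> ln (1 + (B + Y z))" unfolding log_plus_altdef using B0 Y0 by (subst ln_le_cancel_iff) auto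
    also have "\<dots> \<le> ln ((1 + B) * (1 + X z)\<^sup>2)"
    proof -
      have "1 + (B + Y z) \<le> (1 + B) * (1 + Y z)" using B0 Y0 by (simp add: algebra_simps)
      also have "\<dots> \<le> (1 + B) * (1 + X z)\<^sup>2"
        using B0 YX[of z] X0[of z] by (intro mult_left_mono) (auto simp: power2_sum)
      finally have "1 + (B + Y z) \<le> (1 + B) * (1 + X z)\<^sup>2" .
      then show ?thesis using B0 Y0 by (subst ln_le_cancel_iff) auto
    qed
    also have "\<dots> = ln (1 + B) + ln ((1 + X z)\<^sup>2)" using B0 X0[of z] by (intro ln_mult_pos) (auto intro!: zero_less_power)
    also have "ln ((1 + X z)\<^sup>2) = 2 * ln (1 + X z)" by (simp add: ln_realpow)
    also have "ln (1 + X z) \<le> ln m + ((1 + X z) / m - 1)"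
    proof -
      have "ln ((1 + X z) / m) \<le> (1 + X z) / m - 1" using m1 X0[of z] by (intro ln_le_minus_one) (auto intro!: divide_pos_pos)
      moreover have "ln ((1 + X z) / m) = ln (1 + X z) - ln m" using m1 X0[of z] by (intro ln_divide_pos) auto
      ultimately show ?thesis by simp
    qed
    finally show ?thesis by (simp add: add_divide_distrib)
  qed
  have cX: "continuous_on (sphere 0 r) X"
    unfolding X_def using Ar(2) by (intro continuous_intros) auto
  have dan: "(\<lambda>z. deriv f z / f z) analytic_on {z}" if "norm z = r" for z
    using good(1) that by (auto simp: good_radius_def intro!: analytic_intros analytic_deriv)
  have cd: "cir (\<lambda>z. deriv f z / f z) r" using dan r by (auto simp: cir_def)
  have "nev_m r (\<lambda>z. deriv f z / f z) \<le> cmean r (\<lambda>z. (ln (1 + B) + 2 * ln m - 2 * (1 - 1 / m)) + (2 / m) * X z)"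
    by (intro nev_m_le cd continuous_intros cX pt)
  also have "\<dots> = (ln (1 + B) + 2 * ln m - 2 * (1 - 1 / m)) + (2 / m) * cmean r X"
  proof -
    have "cmean r (\<lambda>z. (ln (1 + B) + 2 * ln m - 2 * (1 - 1 / m)) + (2 / m) * X z)
       = cmean r (\<lambda>z. ln (1 + B) + 2 * ln m - 2 * (1 - 1 / m)) + cmean r (\<lambda>z. (2 / m) * X z)"
      using r by (intro cmean_add continuous_on_mult continuous_on_const cX) auto
    then show ?thesis by (simp only: cmean_cmult cmean_const)
  qed
  also have "cmean r X \<le> 400 * n"
  proof -
    have "cmean r X = (\<Sum>a\<in>A. cmean r (\<lambda>z. real_of_int \<bar>mord f a\<bar> * (1 / sqrt (norm (z - a)))))"
      unfolding X_def using r Ar(2) by (intro cmean_sum continuous_intros) auto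
    also have "\<dots> = (\<Sum>a\<in>A. real_of_int \<bar>mord f a\<bar> * cmean r (\<lambda>z. 1 / sqrt (norm (z - a))))"
      by (simp only: cmean_cmult)
    also have "\<dots> \<le> (\<Sum>a\<in>A. real_of_int \<bar>mord f a\<bar> * 400)"
      using r Ar(2) by (intro sum_mono mult_left_mono cmean_inverse_sqrt_dist) auto
    also have "\<dots> = 400 * n" unfolding n_def A_def sum_distrib_left by (simp only: mult.commute)
    finally show ?thesis .
  qed
  then have "(2 / m) * cmean r X \<le> (2 / m) * (400 * n)" using m1 by (intro mult_left_mono) auto
  moreover have "(2 / m) * (400 * n) = 2 * (1 - 1 / m)" using m1 by (simp add: m_def field_simps)
  ultimately show ?thesis by (simp add: m_def)
qed

text \<open>Borel's growth lemma. On the set of exceptional points at which \<open>\<Phi>\<close> lies in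
  \<open>[2\<^sup>k, 2\<^sup>k\<^sup>+\<^sup>1)\<close>, any two points are at distance at most \<open>2\<^sup>-\<^sup>k\<close>.\<close>
lemma borel_growth:
  fixes \<Phi> :: "real \<Rightarrow> real" and G :: "real set"
  assumes mono: "\<And>r s. r \<in> G \<Longrightarrow> s \<in> G \<Longrightarrow> r \<le> s \<Longrightarrow> \<Phi> r \<le> \<Phi> s"
    and ge1: "\<And>r. r \<in> G \<Longrightarrow> \<Phi> r \<ge> 1"
  obtains E where "E \<in> lmeasurable"
    "\<And>r s. r \<in> G \<Longrightarrow> r \<notin> E \<Longrightarrow> s \<in> G \<Longrightarrow> r < s \<Longrightarrow> s \<le> r + 1 / \<Phi> r \<Longrightarrow> \<Phi> s \<le> 2 * \<Phi> r"
proof -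
  define Bad where "Bad = (\<lambda>k::nat. {r \<in> G. 2 ^ k \<le> \<Phi> r \<and> \<Phi> r < 2 ^ Suc k \<and>
     (\<exists>s\<in>G. r < s \<and> s \<le> r + 1 / \<Phi> r \<and> 2 * \<Phi> r < \<Phi> s)})"
  \<comment> \<open>If \<open>s\<close> were farther away, the witness \<open>t\<close> for
    \<open>r\<close> would satisfy \<open>t \<le> s\<close>, although \<Phi> at \<open>t\<close>
    exceeds \<open>2 ^ Suc k\<close> and at \<open>s\<close> stays below it.\<close>
  have close: "s \<le> r + (1/2) ^ k" if rB: "r \<in> Bad k" and sB: "s \<in> Bad k" for r s k
  proof (rule ccontr)
    assume n: "\<not> s \<le> r + (1/2) ^ k"
    obtain t where t: "t \<in> G" "r < t" "t \<le> r + 1 / \<Phi> r" "2 * \<Phi> r < \<Phi> t"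
      using rB by (auto simp: Bad_def)
    have "1 / \<Phi> r \<le> 1 / 2 ^ k" using rB by (intro divide_left_mono) (auto simp: Bad_def intro!: mult_pos_pos dest: ge1)
    then have "t \<le> s" using n t(3) by (simp add: power_divide)
    then have "\<Phi> t \<le> \<Phi> s" using mono t(1) sB by (auto simp: Bad_def)
    then show False using t(4) rB sB by (auto simp: Bad_def)
  qed
  \<comment> \<open>Any point of \<open>Bad k\<close> serves as the centre of an interval covering
    it. For empty \<open>Bad k\<close> the choice is arbitrary and harmless.\<close>
  define c where "c = (\<lambda>k. SOME r. r \<in> Bad k)"
  define I where "I = (\<lambda>k. {c k - (1/2) ^ k .. c k + (1/2) ^ k})"
  have sub: "Bad k \<subseteq> I k" for k
  proof
    fix r assume r: "r \<in> Bad k"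
    then have "c k \<in> Bad k" unfolding c_def by (rule someI)
    then show "r \<in> I k" using close[OF r, of "c k"] close[OF _ r, of "c k"] by (auto simp: I_def)
  qed
  have "(\<Union>k. I k) \<in> lmeasurable"
  proof (rule fmeasurable_UN_bound)
    show "I k \<in> lmeasurable" for k by (simp add: I_def)
    fix J :: "nat set" assume J: "finite J"
    have "measure lebesgue (\<Union>k\<in>J. I k) \<le> (\<Sum>k\<in>J. measure lebesgue (I k))"
      using J by (intro measure_UNION_le) (auto simp: I_def)
    also have "\<dots> = (\<Sum>k\<in>J. 2 * (1/2) ^ k)" by (simp add: I_def)
    also have "\<dots> \<le> (\<Sum>k. 2 * (1/2) ^ k)"
      using J by (intro sum_le_suminf summable_mult summable_geometric) auto
    finally show "measure lebesgue (\<Union>k\<in>J. I k) \<le> (\<Sum>k. 2 * (1/2) ^ k)" .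
  qed auto
  moreover have "\<Phi> s \<le> 2 * \<Phi> r" if "r \<in> G" "r \<notin> (\<Union>k. I k)" "s \<in> G" "r < s" "s \<le> r + 1 / \<Phi> r" for r s
  proof (rule ccontr)
    assume n: "\<not> \<Phi> s \<le> 2 * \<Phi> r"
    define k where "k = nat \<lfloor>log 2 (\<Phi> r)\<rfloor>"
    have p: "\<Phi> r \<ge> 1" using ge1 that(1) .
    then have l0: "log 2 (\<Phi> r) \<ge> 0" by simp
    have "real k \<le> log 2 (\<Phi> r)" "log 2 (\<Phi> r) < real k + 1"
      using l0 unfolding k_def by (auto simp: of_nat_nat)
    then have "2 powr real k \<le> \<Phi> r" "\<Phi> r < 2 powr (real k + 1)"
      using p by (simp_all add: le_log_iff log_less_iff)
    then have "2 ^ k \<le> \<Phi> r" "\<Phi> r < 2 ^ Suc k"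
      by (simp_all add: powr_realpow powr_add)
    then have "r \<in> Bad k" using that n by (auto simp: Bad_def not_le)
    then show False using sub that(2) by auto
  qed
  ultimately show ?thesis using that by blast
qed

section \<open>The logarithmic derivative outside an exceptional set\<close>

lemma good_radius_between:
  assumes "mero f" "nonz f" "0 \<le> a" "a < b"
  obtains r where "a < r" "r < b" "good_radius f r"
proof -
  define Z where "Z = {z. \<not> (f analytic_on {z} \<and> f z \<noteq> 0)}"
  have "\<forall>\<^sub>\<approx>z. f analytic_on {z} \<and> f z \<noteq> 0"
    by (intro eventually_conj assms meromorphic_on_imp_analytic_cosparse)
  then have "countable Z"
    using sparse_imp_countable[of UNIV Z] by (auto simp: eventually_cosparse Z_def)
  then have "countable (norm ` Z)" by simp
  then have "\<not> {a<..<b} \<subseteq> norm ` Z"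
    using assms(4) countable_subset uncountable_open_interval by blast
  then obtain r where "r \<in> {a<..<b}" "r \<notin> norm ` Z" by blast
  then show ?thesis using assms(3) by (intro that[of r]) (auto simp: good_radius_def Z_def)
qed

text \<open>Each point of the smaller disc has weight at least ln (s / \<rho>) in the counting
  functions at \<open>s\<close>, and this is at least (s - \<rho>) / s because ln x is at most x -
  1.\<close>

lemma divisor_count_le:
  assumes f: "mero f" and r: "1 \<le> \<rho>" "\<rho> < s"
  shows "(\<Sum>a\<in>divisor_in f \<rho>. real_of_int \<bar>mord f a\<bar>) * ((s - \<rho>) / s) \<le> nev_N s f + nev_N s (\<lambda>z. inverse (f z))"
proof -
  define A where "A = {a \<in> cball 0 s. mord f a \<noteq> 0}"
  have finA: "finite A" unfolding A_def by (rule finite_mord[OF f])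
  have sub: "divisor_in f \<rho> \<subseteq> A" using r by (auto simp: A_def divisor_in_def)
  have lw: "(s - \<rho>) / s \<le> logw s a" if "a \<in> divisor_in f \<rho>" for a
  proof -
    have na: "norm a < \<rho>" using that by (simp add: divisor_in_def)
    have "ln (\<rho> / s) \<le> \<rho> / s - 1" using r by (intro ln_le_minus_one) auto
    then have 1: "(s - \<rho>) / s \<le> ln s - ln \<rho>" using r by (simp add: ln_div field_simps)
    show ?thesis
    proof (cases "a = 0")
      case True then show ?thesis using 1 r by (simp add: logw_def) (smt (verit) ln_ge_zero)
    next
      case False
      then have "ln (norm a) \<le> ln \<rho>" using na r by (subst ln_le_cancel_iff) auto
      moreover have "logw s a = ln s - ln (norm a)" using False r by (simp add: logw_def ln_div)
      ultimately show ?thesis using 1 by linarith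
    qed
  qed
  have "(\<Sum>a\<in>divisor_in f \<rho>. real_of_int \<bar>mord f a\<bar>) * ((s - \<rho>) / s) \<le> (\<Sum>a\<in>divisor_in f \<rho>. real_of_int \<bar>mord f a\<bar> * logw s a)"
    unfolding sum_distrib_right using lw by (intro sum_mono mult_left_mono) auto
  also have "\<dots> \<le> (\<Sum>a\<in>A. real_of_int \<bar>mord f a\<bar> * logw s a)"
    using finA sub r by (intro sum_mono2 mult_nonneg_nonneg logw_nonneg) (auto simp: A_def)
  also have "\<dots> = (\<Sum>a\<in>A. real (pmul f a) * logw s a) + (\<Sum>a\<in>A. real (pmul (\<lambda>z. inverse (f z)) a) * logw s a)"
    unfolding sum.distrib[symmetric] distrib_right[symmetric] pmul_inverse[OF f] pmul_def
    by (intro sum.cong refl arg_cong[of _ _ "\<lambda>x. x * _"]) auto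
  also have "(\<Sum>a\<in>A. real (pmul f a) * logw s a) = nev_N s f"
    using r finA by (intro nev_N_sum[symmetric] f) (auto simp: A_def pmul_def)
  also have "(\<Sum>a\<in>A. real (pmul (\<lambda>z. inverse (f z)) a) * logw s a) = nev_N s (\<lambda>z. inverse (f z))"
    using r finA by (intro nev_N_sum[symmetric] f meromorphic_intros) (auto simp: A_def pmul_inverse[OF f])
  finally show ?thesis .
qed

text \<open>Borel's lemma provides outer circles on which \<Phi> has at most doubled, at a distance
  of order 1 / \<Phi> from the inner one. Every quantity in \<open>log_deriv_estimate\<close> is
  then bounded by a power of \<Phi> at the inner radius.\<close>

theorem log_deriv_lemma:
  assumes f: "mero f" "nonz f"
  obtains C D where "D \<ge> 0"
    "eventually (\<lambda>r. nev_m r (\<lambda>z. deriv f z / f z) \<le> C + 10 * ln (2 * nev_T r f + D + r)) exc_filter"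
proof -
  have f': "mero (\<lambda>z. inverse (f z))" by (intro meromorphic_intros f)
  obtain D0 where D0: "\<And>r. good_radius f r \<Longrightarrow> nev_T r f = nev_T r (\<lambda>z. inverse (f z)) + D0"
    using first_main_theorem[OF f(1)] by blast
  define D where "D = \<bar>D0\<bar>"
  define G where "G = {r. good_radius f r \<and> r \<ge> 1}"
  \<comment> \<open>\<open>2 * nev_T r f + D\<close> dominates the sum of the characteristics of
    \<open>f\<close> and its inverse. The summand \<open>r\<close> makes \<Phi> at least
    \<open>1\<close> and bounds the outer radii as well.\<close>
  define \<Phi> where "\<Phi> = (\<lambda>r. 2 * nev_T r f + D + r)"
  have good_inv: "cir (\<lambda>z. inverse (f z)) r" if "good_radius f r" for r
    using that by (auto simp: good_radius_def cir_def intro!: analytic_intros)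
  have T0: "nev_T r f \<ge> 0" if "r \<in> G" for r
    using that nev_m_nonneg[OF good_cir] nev_N_nonneg[OF f(1)] by (auto simp: G_def nev_T_def)
  have ge1: "\<Phi> r \<ge> 1" if "r \<in> G" for r using T0[OF that] that by (auto simp: \<Phi>_def G_def D_def)
  have mono: "\<Phi> r \<le> \<Phi> s" if "r \<in> G" "s \<in> G" "r \<le> s" for r s
    using nev_T_mono[OF f(1), of r s] that by (cases "r = s") (auto simp: \<Phi>_def G_def)
  obtain E where E: "E \<in> lmeasurable"
    "\<And>r s. r \<in> G \<Longrightarrow> r \<notin> E \<Longrightarrow> s \<in> G \<Longrightarrow> r < s \<Longrightarrow> s \<le> r + 1 / \<Phi> r \<Longrightarrow> \<Phi> s \<le> 2 * \<Phi> r"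
    using borel_growth[of G \<Phi>] mono ge1 by metis
  have est: "nev_m r (\<lambda>z. deriv f z / f z) \<le> (ln 200 + 2 * ln 7000) + 10 * ln (\<Phi> r)" if r: "r \<in> G" "r \<notin> E" for r
  proof -
    define P where "P = \<Phi> r"
    have P1: "P \<ge> 1" using ge1[OF r(1)] by (simp add: P_def)
    \<comment> \<open>A quarter of Borel's window: it leaves room for good radii \<rho> between
      \<open>r + \<delta>\<close> and \<open>r + 2 * \<delta>\<close>, and \<open>s\<close> between
      \<open>r + 3 * \<delta>\<close> and \<open>r + 4 * \<delta>\<close>, with gaps of at least
      \<delta>.\<close>
    define \<delta> where "\<delta> = 1 / (4 * P)"
    have d0: "\<delta> > 0" using P1 by (simp add: \<delta>_def)
    have r1: "r \<ge> 1" "good_radius f r" using r by (auto simp: G_def)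
    obtain \<rho> where \<rho>: "r + \<delta> < \<rho>" "\<rho> < r + 2 * \<delta>" "good_radius f \<rho>"
      using good_radius_between[OF f, of "r + \<delta>" "r + 2 * \<delta>"] d0 r1 by auto
    obtain s where s: "r + 3 * \<delta> < s" "s < r + 4 * \<delta>" "good_radius f s"
      using good_radius_between[OF f, of "r + 3 * \<delta>" "r + 4 * \<delta>"] d0 r1 by auto
    have sG: "s \<in> G" "\<rho> \<in> G" "r < \<rho>" "\<rho> < s" using s \<rho> d0 r1 by (auto simp: G_def)
    have "4 * \<delta> = 1 / P" by (simp add: \<delta>_def)
    then have \<Phi>s: "\<Phi> s \<le> 2 * P" using E(2)[OF r sG(1)] s sG by (simp add: P_def)
    have \<Phi>\<rho>: "\<Phi> \<rho> \<le> 2 * P" using mono[OF sG(2,1)] sG \<Phi>s by simp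
    have sP: "s \<le> 2 * P" using \<Phi>s T0[OF sG(1)] by (simp add: \<Phi>_def D_def)
    have \<rho>P: "\<rho> \<le> 2 * P" using sP sG by simp
    define M where "M = nev_m \<rho> f + nev_m \<rho> (\<lambda>z. inverse (f z))"
    define n where "n = (\<Sum>a\<in>divisor_in f \<rho>. real_of_int \<bar>mord f a\<bar>)"
    define B where "B = 2 * \<rho> / (\<rho> - r)\<^sup>2 * M + n / (\<rho> - r)"
    have n0: "n \<ge> 0" unfolding n_def by (intro sum_nonneg) auto
    have M0: "M \<ge> 0" unfolding M_def using \<rho>(3) by (intro add_nonneg_nonneg nev_m_nonneg good_cir good_inv)
    have \<rho>1: "\<rho> \<ge> 1" "s \<ge> 1" using r1 sG by auto
    have M2P: "M \<le> 2 * P"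
      using D0[OF \<rho>(3)] nev_N_nonneg[OF f(1) \<rho>1(1)] nev_N_nonneg[OF f' \<rho>1(1)] \<Phi>\<rho> \<rho>1
      by (auto simp: M_def nev_T_def \<Phi>_def D_def)
    have "n * ((s - \<rho>) / s) \<le> nev_N s f + nev_N s (\<lambda>z. inverse (f z))"
      unfolding n_def using \<rho>1 sG by (intro divisor_count_le f) auto
    also have "\<dots> \<le> 2 * P"
      using D0[OF s(3)] nev_m_nonneg[OF good_cir[OF s(3)]] nev_m_nonneg[OF good_inv[OF s(3)]] \<Phi>s \<rho>1
      by (auto simp: nev_T_def \<Phi>_def D_def)
    finally have n1: "n * ((s - \<rho>) / s) \<le> 2 * P" .
    have "\<delta> / (2 * P) \<le> (s - \<rho>) / s" using s \<rho> sP \<rho>1 d0 P1 by (intro frac_le) auto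
    then have "n * (\<delta> / (2 * P)) \<le> 2 * P" using n1 n0 mult_left_mono by (meson order_trans)
    then have "n \<le> 2 * P * (2 * P / \<delta>)" using d0 P1 by (simp add: field_simps)
    also have "\<dots> = 16 * P ^ 3" using P1 by (simp add: \<delta>_def power3_eq_cube)
    finally have n2: "n \<le> 16 * P ^ 3" .
    have "2 * \<rho> / (\<rho> - r)\<^sup>2 * M \<le> 2 * (2 * P) / \<delta>\<^sup>2 * (2 * P)"
      using \<rho>P M2P M0 \<rho> d0 \<rho>1 P1 by (intro mult_mono frac_le power_mono) auto
    also have "\<dots> = 128 * P ^ 4" using P1 by (simp add: \<delta>_def power2_eq_square power4_eq_xxxx)
    finally have b1: "2 * \<rho> / (\<rho> - r)\<^sup>2 * M \<le> 128 * P ^ 4" .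
    have "n / (\<rho> - r) \<le> 16 * P ^ 3 / \<delta>" using n2 \<rho> d0 P1 by (intro frac_le) auto
    also have "\<dots> = 64 * P ^ 4" by (simp add: \<delta>_def power3_eq_cube power4_eq_xxxx)
    finally have b2: "n / (\<rho> - r) \<le> 64 * P ^ 4" .
    have P4: "1 \<le> P ^ 4" "1 \<le> P ^ 3" using P1 by (auto intro: one_le_power)
    \<comment> \<open>128 + 64 + 1 and 400 * 16 + 1 are rounded up. The exponents 4 and 3 combine to
      4 + 2 * 3 = 10, the factor of the logarithm in the result.\<close>
    have B: "1 + B \<le> 200 * P ^ 4" using b1 b2 P4 by (simp add: B_def)
    have N: "1 + 400 * n \<le> 7000 * P ^ 3" using n2 P4 by simp
    have B0: "B \<ge> 0" unfolding B_def using \<rho>1 M0 n0 sG by (intro add_nonneg_nonneg mult_nonneg_nonneg divide_nonneg_nonneg) auto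
    have "nev_m r (\<lambda>z. deriv f z / f z) \<le> ln (1 + B) + 2 * ln (1 + 400 * n)"
      unfolding B_def M_def n_def by (rule log_deriv_estimate[OF f(1) r1(2) \<rho>(3) r1(1) sG(3)])
    also have "\<dots> \<le> ln (200 * P ^ 4) + 2 * ln (7000 * P ^ 3)"
      using B N B0 n0 P1 by (intro add_mono mult_left_mono iffD2[OF ln_le_cancel_iff]) auto
    also have "\<dots> = (ln 200 + 2 * ln 7000) + 10 * ln P"
      using P1 by (simp add: ln_mult ln_realpow)
    finally show ?thesis by (simp add: P_def)
  qed
  have "eventually (\<lambda>r. r \<in> G \<and> r \<notin> E) exc_filter"
  proof -
    have "eventually (\<lambda>r. r \<notin> E) exc_filter" by (rule exc_filterI[OF E(1)]) auto
    then show ?thesis using eventually_good[OF f] eventually_exc_ge[of 1]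
      by eventually_elim (auto simp: G_def)
  qed
  then have "eventually (\<lambda>r. nev_m r (\<lambda>z. deriv f z / f z) \<le> (ln 200 + 2 * ln 7000) + 10 * ln (2 * nev_T r f + D + r)) exc_filter"
    by eventually_elim (use est in \<open>auto simp: \<Phi>_def\<close>)
  then show ?thesis using that[of D] by (simp add: D_def)
qed

subsection \<open>Growth of transcendental functions\<close>

text \<open>Up to half the radius the Poisson kernel is at most 3, so |g| is at most r^(3k) there
  and Cauchy's inequality kills all Taylor coefficients of index above 3k. Arbitrarily large radii
  of this kind suffice, hence \<open>frequently\<close>.\<close>

lemma entire_log_growth_polynomial:
  assumes g: "g holomorphic_on UNIV" "nonz g"
    and fr: "frequently (\<lambda>r. nev_m r g \<le> real k * ln r) exc_filter"
  obtains p where "\<And>z. g z = poly p z"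
proof -
  have mg: "mero g" using g(1) by (simp add: analytic_on_imp_meromorphic_on analytic_on_open)
  have an: "g analytic_on {z}" for z using g(1) by (meson UNIV_I holomorphic_on_imp_analytic_at open_UNIV)
  have empty: "real (pmul g a) = 0" for a using pmul_analytic[OF an] by simp
  have bnd: "norm (g z) \<le> r ^ (3 * k)" if r: "good_radius g r" "r \<ge> 1" "nev_m r g \<le> real k * ln r" and z: "norm z \<le> r / 2" for r z
  proof (cases "g z = 0")
    case True then show ?thesis using r by simp
  next
    case False
    have zr: "norm z < r" using z r by simp
    note c = cir_cont[OF good_cir[OF r(1)]]
    have "log_plus (norm (g z)) \<le> cmean r (\<lambda>w. poiss z w * log_plus (norm (g w)))"
      using poisson_jensen_log_plus[OF mg r(1) zr an False] empty by simp
    also have "\<dots> \<le> cmean r (\<lambda>w. 3 * log_plus (norm (g w)))"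
    proof (rule cmean_mono)
      show "continuous_on (sphere 0 r) (\<lambda>w. poiss z w * log_plus (norm (g w)))"
        unfolding poiss_def using zr by (intro continuous_intros c) auto
      show "continuous_on (sphere 0 r) (\<lambda>w. 3 * log_plus (norm (g w)))" by (intro continuous_intros c)
      fix w :: complex assume w: "norm w = r"
      have "poiss z w \<le> (r + norm z) / (r - norm z)" by (rule poiss_nonneg_le(2)[OF zr w])
      also have "\<dots> \<le> 3" using z zr r(2) by (simp add: field_simps)
      finally show "poiss z w * log_plus (norm (g w)) \<le> 3 * log_plus (norm (g w))"
        by (intro mult_right_mono) auto
    qed (use r in auto)
    also have "\<dots> = 3 * nev_m r g" unfolding nev_m_eq by (rule cmean_cmult)
    also have "\<dots> \<le> 3 * (real k * ln r)" using r by simp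
    also have "\<dots> = ln (r ^ (3 * k))" by (simp add: ln_realpow)
    finally have "ln (norm (g z)) \<le> ln (r ^ (3 * k))" using ln_le_log_plus[of "norm (g z)"] by simp
    then show ?thesis using False r by (subst (asm) ln_le_cancel_iff) auto
  qed
  have zero: "(deriv ^^ j) g 0 = 0" if j: "j > 3 * k" for j
  proof (rule ccontr)
    assume n: "(deriv ^^ j) g 0 \<noteq> 0"
    define c where "c = norm ((deriv ^^ j) g 0)"
    have c0: "c > 0" using n by (simp add: c_def)
    have "frequently (\<lambda>r. nev_m r g \<le> real k * ln r \<and> good_radius g r \<and> r \<ge> 1 \<and> r > fact j * 2 ^ j / c) exc_filter"
      using frequently_eventually_frequently[OF fr eventually_conj[OF eventually_good[OF mg g(2)]
        eventually_conj[OF eventually_exc_ge[of 1] eventually_exc_ge[of "fact j * 2 ^ j / c + 1"]]]]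
      by (rule frequently_elim1) auto
    then obtain r where r: "nev_m r g \<le> real k * ln r" "good_radius g r" "r \<ge> 1" "r > fact j * 2 ^ j / c"
      using frequently_ex by blast
    have "c \<le> fact j * r ^ (3 * k) / (r / 2) ^ j" unfolding c_def
      using g(1) bnd[OF r(2,3,1)] r(3)
      by (intro Cauchy_inequality) (auto intro: holomorphic_on_subset holomorphic_on_imp_continuous_on)
    also have "\<dots> = fact j * 2 ^ j * (r ^ (3 * k) / r ^ j)" by (simp add: power_divide)
    also have "r ^ (3 * k) / r ^ j \<le> 1 / r"
    proof -
      have "r ^ Suc (3 * k) \<le> r ^ j" using j r(3) by (intro power_increasing) auto
      then show ?thesis using r(3) by (simp add: field_simps)
    qed
    finally have "c \<le> fact j * 2 ^ j * (1 / r)" by simp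
    then have "c * r \<le> fact j * 2 ^ j" using r(3) by (simp add: field_simps)
    moreover have "fact j * 2 ^ j < r * c" using r(4) c0 by (simp add: field_simps)
    ultimately show False by (simp add: mult.commute)
  qed
  define p where "p = (\<Sum>j\<le>3 * k. monom ((deriv ^^ j) g 0 / fact j) j)"
  have "g z = poly p z" for z
  proof -
    have "(\<lambda>j. (deriv ^^ j) g 0 / fact j * (z - 0) ^ j) sums g z"
      using g(1) by (intro holomorphic_power_series[of _ _ "norm z + 1"]) (auto intro: holomorphic_on_subset)
    moreover have "(\<lambda>j. (deriv ^^ j) g 0 / fact j * (z - 0) ^ j) sums (\<Sum>j\<le>3 * k. (deriv ^^ j) g 0 / fact j * (z - 0) ^ j)"
      using zero by (intro sums_finite) auto
    ultimately have "g z = (\<Sum>j\<le>3 * k. (deriv ^^ j) g 0 / fact j * (z - 0) ^ j)" by (rule sums_unique2)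
    then show ?thesis by (simp add: p_def poly_sum poly_monom)
  qed
  then show ?thesis using that by blast
qed

lemma transcendental_nonz: "transcendental_meromorphic f \<Longrightarrow> nonz f"
proof -
  assume t: "transcendental_meromorphic f"
  have "\<not> (\<forall>\<^sub>\<approx>z. f z = 0)"
  proof
    assume "\<forall>\<^sub>\<approx>z. f z = 0"
    then have "\<forall>\<^sub>\<approx>z. f z = poly 0 z / poly 1 z" by simp
    then show False using t unfolding transcendental_meromorphic_def by (metis zero_neq_one)
  qed
  then show ?thesis using nonz_or_zero t by (auto simp: transcendental_meromorphic_def)
qed

text \<open>Each pole in the disc of radius \<open>R0\<close> has weight at least ln (r /
  R0).\<close>

lemma nev_N_ge_card:
  assumes f: "mero f" and F: "finite F" "\<And>a. a \<in> F \<Longrightarrow> pmul f a \<noteq> 0 \<and> norm a \<le> R0" and R: "1 \<le> R0" "R0 \<le> r"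
  shows "real (card F) * (ln r - ln R0) \<le> nev_N r f"
proof -
  define A where "A = {b \<in> cball 0 r. pmul f b \<noteq> 0}"
  have finA: "finite A" unfolding A_def by (rule finite_pmul[OF f])
  have sub: "F \<subseteq> A" unfolding A_def using F(2) R by (auto intro: order_trans)
  have "real (card F) * (ln r - ln R0) = (\<Sum>a\<in>F. ln r - ln R0)" by simp
  also have "\<dots> \<le> (\<Sum>a\<in>F. real (pmul f a) * logw r a)"
  proof (rule sum_mono)
    fix a assume a: "a \<in> F"
    have "ln r - ln R0 \<le> logw r a"
    proof (cases "a = 0")
      case True then show ?thesis using R by (simp add: logw_def)
    next
      case False
      then have "ln (norm a) \<le> ln R0" using F(2)[OF a] R by (subst ln_le_cancel_iff) auto
      moreover have "logw r a = ln r - ln (norm a)" using False R by (simp add: logw_def ln_div)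
      ultimately show ?thesis by linarith
    qed
    also have "\<dots> = 1 * logw r a" by simp
    also have "\<dots> \<le> real (pmul f a) * logw r a"
      using F(2)[OF a] R by (intro mult_right_mono logw_nonneg) auto
    finally show "ln r - ln R0 \<le> real (pmul f a) * logw r a" .
  qed
  also have "\<dots> \<le> (\<Sum>a\<in>A. real (pmul f a) * logw r a)"
    using finA sub R by (intro sum_mono2 mult_nonneg_nonneg logw_nonneg) (auto simp: A_def)
  also have "\<dots> = nev_N r f"
    using R finA by (intro nev_N_sum[symmetric] f) (auto simp: A_def)
  finally show ?thesis .
qed

text \<open>Otherwise T(r, f) is at most C ln r for radii that no exceptional set removes. This
  leaves only finitely many poles; clearing them by a polynomial gives an entire function of
  logarithmic growth, hence a polynomial, so \<open>f\<close> is rational.\<close>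

theorem transcendental_growth:
  assumes t: "transcendental_meromorphic f"
  shows "eventually (\<lambda>r. C * ln r \<le> nev_T r f) exc_filter"
proof (rule ccontr)
  have f: "mero f" using t by (simp add: transcendental_meromorphic_def)
  have nz: "nonz f" by (rule transcendental_nonz[OF t])
  assume "\<not> eventually (\<lambda>r. C * ln r \<le> nev_T r f) exc_filter"
  then have fr: "frequently (\<lambda>r. nev_T r f \<le> C * ln r) exc_filter"
    unfolding not_eventually by (rule frequently_elim1) simp
  define A where "A = {a. pmul f a \<noteq> 0}"
  have "finite A"
  proof (rule ccontr)
    assume "infinite A"
    \<comment> \<open>At least C + 1 poles give N(r, f) a growth of (C + 1) ln r up to a constant,
      more than C ln r allows.\<close>
    then obtain F where F: "F \<subseteq> A" "finite F" "card F = nat \<lceil>C\<rceil> + 1" by (metis infinite_arbitrarily_large)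
    define m where "m = real (card F)"
    define R0 where "R0 = Max (insert 1 (norm ` F))"
    have R0: "1 \<le> R0" "\<And>a. a \<in> F \<Longrightarrow> norm a \<le> R0" using F(2) by (auto simp: R0_def)
    have mC: "m \<ge> C + 1" unfolding m_def F(3) by (simp add: of_nat_nat) linarith
    have "eventually (\<lambda>r. cir f r \<and> r \<ge> R0 \<and> ln r > m * ln R0) exc_filter"
      using eventually_cir[OF f] eventually_exc_ge[of R0] eventually_exc_ge[of "exp (m * ln R0) + 1"]
    proof eventually_elim
      case (elim r)
      then have "exp (m * ln R0) < r" by simp
      then have "ln (exp (m * ln R0)) < ln r" using elim R0 by (subst ln_less_cancel_iff) auto
      then show ?case using elim by simp
    qed
    then obtain r where r: "nev_T r f \<le> C * ln r" "cir f r" "r \<ge> R0" "ln r > m * ln R0"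
      using frequently_ex[OF frequently_eventually_frequently[OF fr]] by blast
    have "m * (ln r - ln R0) \<le> nev_N r f"
      unfolding m_def using F R0 r(3) by (intro nev_N_ge_card f) (auto simp: A_def)
    also have "\<dots> \<le> C * ln r" using r(1) nev_m_nonneg[OF r(2)] by (simp add: nev_T_def)
    finally have 1: "m * ln r - m * ln R0 \<le> C * ln r" by (simp add: right_diff_distrib)
    have "(C + 1) * ln r \<le> m * ln r" using mC r(3) R0 by (intro mult_right_mono) auto
    then show False using 1 r(4) by (simp add: algebra_simps)
  qed
  \<comment> \<open>Its zeros cancel the poles of \<open>f\<close> with multiplicity, so
    \<open>f * q\<close> has removable singularities only.\<close>
  define q where "q = (\<Prod>a\<in>A. [:- a, 1:] ^ pmul f a)"
  have q0: "q \<noteq> 0" using \<open>finite A\<close> by (simp add: q_def)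
  have pq: "poly q z = (\<Prod>a\<in>A. (z - a) ^ pmul f a)" for z by (simp add: q_def poly_prod)
  have anq: "poly q analytic_on X" for X unfolding pq[abs_def] by (intro analytic_intros)
  have mq: "mero (poly q)" by (intro analytic_on_imp_meromorphic_on anq)
  have lin: "mero (\<lambda>z. z - a)" "nonz (\<lambda>z. z - a)" for a :: complex
  proof -
    show "mero (\<lambda>z. z - a)" by (intro meromorphic_intros)
    have "\<forall>\<^sub>\<approx>z. z \<notin> {a}" by (intro eventually_not_in_cosparse) simp
    then show "nonz (\<lambda>z. z - a)" by (rule eventually_mono) simp
  qed
  have mlin: "mord (\<lambda>w. w - a) z = (if z = a then 1 else 0)" for a z :: complex
  proof (cases "z = a")
    case True
    have "(\<lambda>w. (z + w) - a) has_laurent_expansion fls_X" using True by (simp add: laurent_expansion_intros)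
    then show ?thesis using True mord_eqI[of "\<lambda>w. w - a" z fls_X] by simp
  qed (auto intro!: mord_analytic_nz analytic_intros)
  have P: "mord (poly q) z = (\<Sum>a\<in>A. mord (\<lambda>z. (z - a) ^ pmul f a) z) \<and> nonz (poly q)" for z
  proof -
    have "nonz (\<lambda>z. (z - a) ^ pmul f a)" for a by (rule eventually_mono[OF lin(2)[of a]]) simp
    then have "mord (\<lambda>z. \<Prod>a\<in>A. (z - a) ^ pmul f a) z = (\<Sum>a\<in>A. mord (\<lambda>z. (z - a) ^ pmul f a) z) \<and> nonz (\<lambda>z. \<Prod>a\<in>A. (z - a) ^ pmul f a)"
      by (intro mord_prod \<open>finite A\<close> meromorphic_intros) auto
    then show ?thesis by (simp only: pq[symmetric])
  qed
  have ordq: "mord (poly q) z = int (pmul f z)" for z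
  proof -
    have "mord (poly q) z = (\<Sum>a\<in>A. int (pmul f a) * (if z = a then 1 else 0))"
      using P[of z] mord_power[OF lin(1)] mlin by simp
    also have "\<dots> = (\<Sum>a\<in>A. if z = a then int (pmul f z) else 0)" by (intro sum.cong) auto
    also have "\<dots> = int (pmul f z)" using \<open>finite A\<close> by (auto simp: sum.delta' A_def)
    finally show ?thesis .
  qed
  define h where "h = (\<lambda>z. f z * poly q z)"
  have mh: "mero h" unfolding h_def by (intro meromorphic_intros f mq)
  have nzh: "nonz h" unfolding h_def using P by (intro nonz_mult nz) auto
  have ordh: "mord h z \<ge> 0" for z
    using mord_mult[OF f mq nz, of z] P ordq[of z] by (auto simp: h_def pmul_def)
  define g where "g = remove_sings h"
  have ang: "g analytic_on {z}" for z
  proof -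
    have "isolated_singularity_at h z" "not_essential h z" using mh by (auto simp: meromorphic_on_altdef)
    moreover have "\<not> is_pole h z" using is_pole_iff_mord[OF mh] ordh[of z] by (simp add: not_less)
    ultimately show ?thesis unfolding g_def by (auto simp: not_essential_def intro: remove_sings_analytic_at)
  qed
  have g: "g holomorphic_on UNIV" using ang by (meson analytic_imp_holomorphic analytic_on_analytic_at)
  have gh: "\<forall>\<^sub>\<approx>z. g z = h z" unfolding g_def by (rule eventually_remove_sings_eq[OF mh])
  have nzg: "nonz g" using gh nzh by eventually_elim auto
  define d where "d = (\<Sum>a\<in>A. pmul f a)"
  \<comment> \<open>For r at least 2 each factor |z - a| of \<open>q\<close> is at most 2 r, hence
    at most r^2, which adds 2 d to the exponent.\<close>
  define k where "k = nat \<lceil>C\<rceil> + 2 * d"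
  define R0 where "R0 = Max (insert 2 (norm ` A))"
  have R0: "2 \<le> R0" "\<And>a. a \<in> A \<Longrightarrow> norm a \<le> R0" using \<open>finite A\<close> by (auto simp: R0_def)
  have "eventually (\<lambda>r. cir f r \<and> nev_m r g = nev_m r h \<and> r \<ge> R0) exc_filter"
    by (intro eventually_conj eventually_cir f nev_m_cong_ev gh eventually_exc_ge)
  then have "frequently (\<lambda>r. nev_T r f \<le> C * ln r \<and> cir f r \<and> nev_m r g = nev_m r h \<and> r \<ge> R0) exc_filter"
    by (rule frequently_eventually_frequently[OF fr])
  then have "frequently (\<lambda>r. nev_m r g \<le> real k * ln r) exc_filter"
  proof (rule frequently_elim1)
    fix r assume r: "nev_T r f \<le> C * ln r \<and> cir f r \<and> nev_m r g = nev_m r h \<and> r \<ge> R0"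
    then have r2: "r \<ge> 2" using R0 by simp
    have cq: "cir (poly q) r" using r anq by (auto simp: cir_def)
    have "nev_m r (poly q) \<le> cmean r (\<lambda>_. real d * (2 * ln r))"
    proof (rule nev_m_le[OF cq])
      fix z :: complex assume z: "norm z = r"
      have "norm (poly q z) = (\<Prod>a\<in>A. norm (z - a) ^ pmul f a)" by (simp add: pq prod_norm[symmetric] norm_power)
      also have "\<dots> \<le> (\<Prod>a\<in>A. (2 * r) ^ pmul f a)"
        using R0 r z norm_triangle_ineq4[of z] by (intro prod_mono conjI power_mono) (auto intro!: order_trans[OF norm_triangle_ineq4] dest!: R0(2))
      also have "\<dots> = (2 * r) ^ d" by (simp add: d_def power_sum)
      finally have "log_plus (norm (poly q z)) \<le> log_plus ((2 * r) ^ d)" by (rule log_plus_mono)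
      also have "\<dots> = real d * log_plus (2 * r)" by (rule log_plus_power) (use r2 in auto)
      also have "log_plus (2 * r) = ln (2 * r)" using r2 by (simp add: log_plus_def)
      also have "real d * ln (2 * r) \<le> real d * (2 * ln r)" using r2 by (intro mult_left_mono) (auto simp: ln_mult)
      finally show "log_plus (norm (poly q z)) \<le> real d * (2 * ln r)" .
    qed auto
    then have mq': "nev_m r (poly q) \<le> real d * (2 * ln r)" by simp
    have "nev_m r g \<le> nev_m r f + nev_m r (poly q)"
      using r nev_m_mult[OF _ cq, of f] by (simp add: h_def)
    also have "nev_m r f \<le> C * ln r" using r nev_N_nonneg[OF f, of r] r2 by (simp add: nev_T_def)
    also have "C * ln r \<le> real (nat \<lceil>C\<rceil>) * ln r" using r2 by (intro mult_right_mono real_nat_ceiling_ge) auto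
    finally show "nev_m r g \<le> real k * ln r" using mq' by (simp add: k_def algebra_simps)
  qed
  then obtain p where p: "\<And>z. g z = poly p z" using entire_log_growth_polynomial[OF g nzg] by blast
  have "\<forall>\<^sub>\<approx>z. f z = poly p z / poly q z"
    using gh conjunct2[OF P] by eventually_elim (auto simp: p h_def field_simps)
  then show False using t q0 by (auto simp: transcendental_meromorphic_def)
qed

subsection \<open>Functions of bounded weight\<close>

lemma nev_S_small_add:
  assumes "nev_S g1 f" "nev_S g2 f" "nev_S g3 f"
    and "eventually (\<lambda>r. 0 \<le> h r \<and> h r \<le> g1 r + g2 r + g3 r) exc_filter"
  shows "nev_S h f"
proof (rule nev_S_mono[where C = 1])
  show "nev_S (\<lambda>r. g1 r + g2 r + g3 r) f" by (intro nev_S_add assms)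
  show "eventually (\<lambda>r. \<bar>h r\<bar> \<le> 1 * \<bar>g1 r + g2 r + g3 r\<bar>) exc_filter"
    using assms(4) by eventually_elim auto
qed

text \<open>Dividing by \<open>max 1 (norm (f z)) ^ d\<close> rather than by |f|^d treats both
  regimes of Clunie's argument at once: the divisor is 1 where |f| is at most 1, and |f|^d
  elsewhere.\<close>

definition wnorm :: "(complex \<Rightarrow> complex) \<Rightarrow> nat \<Rightarrow> (complex \<Rightarrow> complex) \<Rightarrow> complex \<Rightarrow> real" where
  "wnorm f d g z = norm (g z) / max 1 (norm (f z)) ^ d"

definition nev_w :: "(complex \<Rightarrow> complex) \<Rightarrow> nat \<Rightarrow> (complex \<Rightarrow> complex) \<Rightarrow> real \<Rightarrow> real" where
  "nev_w f d g r = cmean r (\<lambda>z. log_plus (wnorm f d g z))"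

lemma nev_w_0: "nev_w f 0 g r = nev_m r g"
  by (simp add: nev_w_def wnorm_def nev_m_eq)

lemma wnorm_nonneg: "wnorm f d g z \<ge> 0"
  by (simp add: wnorm_def)

lemma wnorm_cont:
  assumes "cir f r" "cir g r"
  shows "continuous_on (sphere 0 r) (\<lambda>z. log_plus (wnorm f d g z))"
  unfolding wnorm_def using assms[THEN cir_cont] by (intro continuous_intros) auto

lemma nev_w_nonneg: "cir f r \<Longrightarrow> cir g r \<Longrightarrow> nev_w f d g r \<ge> 0"
  unfolding nev_w_def by (intro cmean_nonneg wnorm_cont) (auto simp: cir_def)

locale nev_setting =
  fixes f :: "complex \<Rightarrow> complex"
  assumes tr: "transcendental_meromorphic f" and NS_f: "nev_S (\<lambda>r. nev_N r f) f"
begin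

lemma mf: "mero f"
  using tr by (simp add: transcendental_meromorphic_def)

section \<open>Quantities of size S(r, f)\<close>

lemma T_ge: "eventually (\<lambda>r. c \<le> nev_T r f) exc_filter"
  using transcendental_growth[OF tr, of "\<bar>c\<bar>"] eventually_exc_ge[of "exp 1"]
proof eventually_elim
  case (elim r)
  then have "ln (exp 1) \<le> ln r" by (subst ln_le_cancel_iff) (auto intro: less_le_trans[OF exp_gt_zero])
  then have "\<bar>c\<bar> * 1 \<le> \<bar>c\<bar> * ln r" by (intro mult_left_mono) auto
  then show ?case using elim by linarith
qed

lemma T_at_top: "filterlim (\<lambda>r. nev_T r f) at_top exc_filter"
  using T_ge by (auto simp: filterlim_at_top)

lemma S_const: "nev_S (\<lambda>_. c) f"
  unfolding nev_S_iff
proof (rule landau_o.smallI)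
  fix e :: real assume e: "e > 0"
  show "\<forall>\<^sub>F x in exc_filter. norm c \<le> e * norm (nev_T x f)"
    using T_ge[of "\<bar>c\<bar> / e"]
  proof eventually_elim
    case (elim r)
    then have "\<bar>c\<bar> \<le> e * nev_T r f" using e by (simp add: field_simps)
    also have "\<dots> \<le> e * \<bar>nev_T r f\<bar>" using e by (intro mult_left_mono) auto
    finally show ?case by simp
  qed
qed

lemma S_ln: "nev_S (\<lambda>r. ln r) f"
  unfolding nev_S_iff
proof (rule landau_o.smallI)
  fix e :: real assume e: "e > 0"
  show "\<forall>\<^sub>F x in exc_filter. norm (ln x) \<le> e * norm (nev_T x f)"
    using transcendental_growth[OF tr, of "1 / e"] eventually_exc_ge[of 1]
  proof eventually_elim
    case (elim r)
    then have "ln r \<le> e * nev_T r f" using e by (simp add: field_simps)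
    also have "\<dots> \<le> e * \<bar>nev_T r f\<bar>" using e by (intro mult_left_mono) auto
    finally show ?case using elim by simp
  qed
qed

lemma S_ln_T: "nev_S (\<lambda>r. ln (nev_T r f)) f"
proof -
  have "ln \<in> o[at_top](\<lambda>x::real. x)" 
    by (rule smalloI_tendsto[OF ln_x_over_x_tendsto_0 eventually_at_top_not_equal])
  then show ?thesis unfolding nev_S_iff using landau_o.small.compose[OF _ T_at_top] by blast
qed

text \<open>Made for the error term of \<open>log_deriv_lemma\<close>. With t = T(r, f) and r both
  at least 1, a sum of multiples of t, 1 and r is at most a constant times t r, and ln t and ln r
  are both S(r, f).\<close>

lemma S_ln_bound:
  assumes "eventually (\<lambda>r. 0 \<le> T r \<and> T r \<le> K * nev_T r f) exc_filter" "D \<ge> 0"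
  shows "nev_S (\<lambda>r. C + 10 * ln (2 * T r + D + r)) f"
proof -
  have "nev_S (\<lambda>r. ln (2 * \<bar>K\<bar> + D + 1) + (ln (nev_T r f) + ln r)) f"
    by (intro nev_S_add S_const S_ln S_ln_T)
  then have "nev_S (\<lambda>r. ln (2 * T r + D + r)) f"
  proof (rule nev_S_mono[where C = 1])
    show "\<forall>\<^sub>F r in exc_filter. \<bar>ln (2 * T r + D + r)\<bar> \<le> 1 * \<bar>ln (2 * \<bar>K\<bar> + D + 1) + (ln (nev_T r f) + ln r)\<bar>"
      using assms(1) T_ge[of 1] eventually_exc_ge[of 1]
    proof eventually_elim
      case (elim r)
      define t where "t = nev_T r f"
      have t: "t \<ge> 1" "r \<ge> 1" "0 \<le> T r" "T r \<le> \<bar>K\<bar> * t"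
        using elim mult_right_mono[of K "\<bar>K\<bar>" t] unfolding t_def by linarith+
      have "1 \<le> 2 * T r + D + r" using t assms(2) by simp
      have tr1: "1 \<le> t * r" using t mult_mono[of 1 t 1 r] by simp
      have "t * 1 \<le> t * r" "1 * r \<le> t * r" using t by (intro mult_mono; simp)+
      have "D * 1 \<le> D * (t * r)" "\<bar>K\<bar> * t \<le> \<bar>K\<bar> * (t * r)"
        using tr1 assms(2) \<open>t * 1 \<le> t * r\<close> by (intro mult_left_mono; simp)+
      have "2 * T r + D + r \<le> (2 * \<bar>K\<bar> + D + 1) * (t * r)"
      proof -
        have "(2 * \<bar>K\<bar> + D + 1) * (t * r) = 2 * (\<bar>K\<bar> * (t * r)) + D * (t * r) + t * r"
          by (simp add: algebra_simps)
        then show ?thesis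
          using t(4) \<open>1 * r \<le> t * r\<close> \<open>D * 1 \<le> D * (t * r)\<close> \<open>\<bar>K\<bar> * t \<le> \<bar>K\<bar> * (t * r)\<close> by linarith
      qed
      then have "ln (2 * T r + D + r) \<le> ln ((2 * \<bar>K\<bar> + D + 1) * (t * r))"
        using \<open>1 \<le> 2 * T r + D + r\<close> by (subst ln_le_cancel_iff) auto
      also have "\<dots> = ln (2 * \<bar>K\<bar> + D + 1) + (ln t + ln r)"
        using t assms(2) by (simp add: ln_mult_pos)
      finally show ?case using \<open>1 \<le> 2 * T r + D + r\<close> by (simp add: t_def)
    qed
  qed
  then show ?thesis by (intro nev_S_add nev_S_cmult S_const)
qed

section \<open>Weighted smallness and its closure properties\<close>

definition wsmall :: "nat \<Rightarrow> (complex \<Rightarrow> complex) \<Rightarrow> bool" where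
  "wsmall d g \<longleftrightarrow> nev_S (nev_w f d g) f"

definition nsmall :: "(complex \<Rightarrow> complex) \<Rightarrow> bool" where
  "nsmall g \<longleftrightarrow> nev_S (\<lambda>r. nev_N r g) f"

text \<open>The pattern behind the closure rules: a pointwise inequality off a sparse set is
  averaged over circles that avoid this set.\<close>

lemma wsmall_le:
  assumes "wsmall d1 g1" "wsmall d2 g2" "mero g1" "mero g2" "mero g"
    "\<forall>\<^sub>\<approx>z. log_plus (wnorm f d g z) \<le> log_plus (wnorm f d1 g1 z) + log_plus (wnorm f d2 g2 z) + c"
  shows "wsmall d g"
  unfolding wsmall_def
proof (rule nev_S_small_add)
  show "nev_S (nev_w f d1 g1) f" "nev_S (nev_w f d2 g2) f" "nev_S (\<lambda>_. c) f"
    using assms(1,2) S_const by (auto simp: wsmall_def)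
  show "\<forall>\<^sub>F r in exc_filter. 0 \<le> nev_w f d g r \<and> nev_w f d g r \<le> nev_w f d1 g1 r + nev_w f d2 g2 r + c"
    using eventually_cir[OF mf] eventually_cir[OF assms(3)] eventually_cir[OF assms(4)] eventually_cir[OF assms(5)]
      eventually_sphere_exc[OF assms(6)]
  proof eventually_elim
    case (elim r)
    have r: "r \<ge> 0" using elim(1) by (rule cir_r)
    have "nev_w f d g r \<le> cmean r (\<lambda>z. log_plus (wnorm f d1 g1 z) + log_plus (wnorm f d2 g2 z) + c)"
      unfolding nev_w_def using elim
      by (intro cmean_mono wnorm_cont continuous_on_add continuous_on_const r) auto
    also have "\<dots> = cmean r (\<lambda>z. log_plus (wnorm f d1 g1 z) + log_plus (wnorm f d2 g2 z)) + cmean r (\<lambda>_. c)"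
      using elim by (intro cmean_add wnorm_cont continuous_on_add continuous_on_const r) auto
    also have "cmean r (\<lambda>z. log_plus (wnorm f d1 g1 z) + log_plus (wnorm f d2 g2 z)) = nev_w f d1 g1 r + nev_w f d2 g2 r"
      unfolding nev_w_def using elim by (intro cmean_add wnorm_cont r) auto
    finally show ?case using nev_w_nonneg elim by simp
  qed
qed

lemma wsmall_const_0: "wsmall 0 (\<lambda>_. 0)"
  unfolding wsmall_def nev_w_def wnorm_def using S_const[of 0] by (simp add: log_plus_def)

lemma wsmall_le1:
  assumes "wsmall d1 g1" "mero g1" "mero g" "\<forall>\<^sub>\<approx>z. wnorm f d g z \<le> wnorm f d1 g1 z"
  shows "wsmall d g"
  using assms(4) by (intro wsmall_le[OF assms(1) wsmall_const_0 assms(2) _ assms(3), where c = 0])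
    (auto elim!: eventually_mono intro: log_plus_mono simp: wnorm_def[of _ 0] log_plus_def[of 0])

lemma wsmall_cong: "wsmall d g \<Longrightarrow> mero g \<Longrightarrow> mero h \<Longrightarrow> \<forall>\<^sub>\<approx>z. g z = h z \<Longrightarrow> wsmall d h"
  by (rule wsmall_le1[of d g]) (auto elim!: eventually_mono simp: wnorm_def)

lemma wsmall_mono:
  assumes "wsmall d g" "mero g" "d \<le> e"
  shows "wsmall e g"
proof (rule wsmall_le1[OF assms(1,2,2)])
  have "max 1 (norm (f z)) ^ d \<le> max 1 (norm (f z)) ^ e" for z
    using assms(3) by (intro power_increasing) auto
  then show "\<forall>\<^sub>\<approx>z. wnorm f e g z \<le> wnorm f d g z"
    unfolding wnorm_def by (intro always_eventually allI divide_left_mono mult_pos_pos zero_less_power) auto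
qed

lemma wsmall_mult:
  assumes "wsmall d g" "wsmall e h" "mero g" "mero h"
  shows "wsmall (d + e) (\<lambda>z. g z * h z)"
proof (rule wsmall_le[OF assms])
  have "wnorm f (d + e) (\<lambda>z. g z * h z) z = wnorm f d g z * wnorm f e h z" for z
    by (simp add: wnorm_def norm_mult power_add)
  then show "\<forall>\<^sub>\<approx>z. log_plus (wnorm f (d + e) (\<lambda>z. g z * h z) z) \<le> log_plus (wnorm f d g z) + log_plus (wnorm f e h z) + 0"
    by (intro always_eventually allI) (simp add: log_plus_mult wnorm_nonneg)
qed (intro meromorphic_intros assms)

lemma wsmall_add:
  assumes "wsmall d g" "wsmall d h" "mero g" "mero h"
  shows "wsmall d (\<lambda>z. g z + h z)"
proof (rule wsmall_le[OF assms])
  have "wnorm f d (\<lambda>z. g z + h z) z \<le> wnorm f d g z + wnorm f d h z" for z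
    unfolding wnorm_def add_divide_distrib[symmetric]
    by (intro divide_right_mono norm_triangle_ineq) auto
  then have "log_plus (wnorm f d (\<lambda>z. g z + h z) z) \<le> log_plus (wnorm f d g z) + log_plus (wnorm f d h z) + ln 2" for z
    by (intro order_trans[OF log_plus_mono log_plus_add] wnorm_nonneg)
  then show "\<forall>\<^sub>\<approx>z. log_plus (wnorm f d (\<lambda>z. g z + h z) z) \<le> log_plus (wnorm f d g z) + log_plus (wnorm f d h z) + ln 2"
    by (intro always_eventually allI)
qed (intro meromorphic_intros assms)


text \<open>|f| / max 1 |f| never exceeds 1, so its \<open>log_plus\<close> vanishes.\<close>

lemma wsmall_f: "wsmall 1 f"
proof -
  have "log_plus (wnorm f 1 f z) \<le> 0" for z
    by (simp add: wnorm_def log_plus_def max_def)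
  then show ?thesis
    by (intro wsmall_le[OF wsmall_const_0 wsmall_const_0 _ _ mf, where c = 0])
       (auto simp: wnorm_def[of _ 0] log_plus_def[of 0])
qed

lemma nsmall_le:
  assumes "nsmall g1" "nsmall g2" "mero g1" "mero g2" "mero g"
    "\<And>z. pmul g z \<le> C * pmul g1 z + C * pmul g2 z"
  shows "nsmall g"
  unfolding nsmall_def
proof (rule nev_S_small_add)
  show "nev_S (\<lambda>r. real C * nev_N r g1) f" "nev_S (\<lambda>r. real C * nev_N r g2) f" "nev_S (\<lambda>_. 0) f"
    using assms(1,2) S_const nev_S_cmult by (auto simp: nsmall_def)
  have le: "real (pmul g z) \<le> real C * real (pmul g1 z) + real C * real (pmul g2 z)" for z
    using assms(6)[of z] by (simp flip: of_nat_mult of_nat_add)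
  show "\<forall>\<^sub>F r in exc_filter. 0 \<le> nev_N r g \<and> nev_N r g \<le> real C * nev_N r g1 + real C * nev_N r g2 + 0"
    using eventually_exc_ge[of 1]
    by eventually_elim (use nev_N_nonneg[OF assms(5)] nev_N_mono[OF assms(5,3,4) le] in auto)
qed

lemma nsmall_entire:
  assumes "g holomorphic_on UNIV"
  shows "nsmall g"
  unfolding nsmall_def
proof (rule nev_S_mono[OF S_const[of 0], where C = 0])
  show "\<forall>\<^sub>F r in exc_filter. \<bar>nev_N r g\<bar> \<le> 0 * \<bar>0\<bar>"
    using eventually_exc_ge[of 1] by eventually_elim (simp add: nev_N_entire[OF assms])
qed

lemma nsmall_mult: "nsmall g \<Longrightarrow> nsmall h \<Longrightarrow> mero g \<Longrightarrow> mero h \<Longrightarrow> nsmall (\<lambda>z. g z * h z)"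
  by (rule nsmall_le[of g h _ 1]) (auto intro: meromorphic_intros simp: pmul_mult)

lemma nsmall_add: "nsmall g \<Longrightarrow> nsmall h \<Longrightarrow> mero g \<Longrightarrow> mero h \<Longrightarrow> nsmall (\<lambda>z. g z + h z)"
  by (rule nsmall_le[of g h _ 1])
     (auto intro: meromorphic_intros order_trans[OF pmul_add])

lemma nsmall_deriv: "nsmall g \<Longrightarrow> mero g \<Longrightarrow> nsmall (deriv g)"
  by (rule nsmall_le[of g g _ 1]) (auto intro: meromorphic_intros order_trans[OF pmul_deriv])

lemma nsmall_cong: "nsmall g \<Longrightarrow> mero g \<Longrightarrow> mero h \<Longrightarrow> \<forall>\<^sub>\<approx>z. g z = h z \<Longrightarrow> nsmall h"
  by (rule nsmall_le[of g g _ 1]) (auto simp: pmul_cong)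

text \<open>\<open>bw d g\<close> plays the role of ``\<open>g\<close> is a differential polynomial in \<open>f\<close> of degree at most
  \<open>d\<close>''; it retains just what Clunie's argument uses.\<close>
definition bw :: "nat \<Rightarrow> (complex \<Rightarrow> complex) \<Rightarrow> bool" where
  "bw d g \<longleftrightarrow> mero g \<and> wsmall d g \<and> nsmall g"

lemma bw_mero: "bw d g \<Longrightarrow> mero g"
  by (simp add: bw_def)

lemma bw_f: "bw 1 f"
  using mf wsmall_f NS_f by (simp add: bw_def nsmall_def)

lemma bw_mult: "bw d g \<Longrightarrow> bw e h \<Longrightarrow> bw (d + e) (\<lambda>z. g z * h z)"
  by (auto simp: bw_def intro!: wsmall_mult nsmall_mult meromorphic_intros)

lemma bw_add: "bw d g \<Longrightarrow> bw d h \<Longrightarrow> bw d (\<lambda>z. g z + h z)"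
  by (auto simp: bw_def intro!: wsmall_add nsmall_add meromorphic_intros)

lemma bw_mono: "bw d g \<Longrightarrow> d \<le> e \<Longrightarrow> bw e g"
  by (auto simp: bw_def intro: wsmall_mono)

lemma bw_cong: "bw d g \<Longrightarrow> \<forall>\<^sub>\<approx>z. g z = h z \<Longrightarrow> bw d h"
  using meromorphic_on_cong'[of g h UNIV UNIV] by (auto simp: bw_def intro: wsmall_cong nsmall_cong)

text \<open>For weight \<open>0\<close> the condition concerns m(r, g) and N(r, g). Both are
  nonnegative off an exceptional set, so they are small separately exactly if their sum is.\<close>

lemma bw_0_iff: "bw 0 g \<longleftrightarrow> small_function g f"
proof -
  have "nev_S (\<lambda>r. nev_m r g) f \<and> nev_S (\<lambda>r. nev_N r g) f \<longleftrightarrow> nev_S (\<lambda>r. nev_T r g) f" if g: "mero g"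
  proof safe
    assume "nev_S (\<lambda>r. nev_m r g) f" "nev_S (\<lambda>r. nev_N r g) f"
    then show "nev_S (\<lambda>r. nev_T r g) f" unfolding nev_T_def by (rule nev_S_add)
  next
    assume T: "nev_S (\<lambda>r. nev_T r g) f"
    have ev: "\<forall>\<^sub>F r in exc_filter. 0 \<le> nev_m r g \<and> 0 \<le> nev_N r g"
      using eventually_cir[OF g] eventually_exc_ge[of 1]
      by eventually_elim (use nev_m_nonneg nev_N_nonneg[OF g] in auto)
    show "nev_S (\<lambda>r. nev_m r g) f"
      by (rule nev_S_mono[OF T, where C = 1], use ev in eventually_elim) (auto simp: nev_T_def)
    show "nev_S (\<lambda>r. nev_N r g) f"
      by (rule nev_S_mono[OF T, where C = 1], use ev in eventually_elim) (auto simp: nev_T_def)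
  qed
  then show ?thesis by (auto simp: bw_def small_function_def wsmall_def nsmall_def nev_w_0[abs_def])
qed

lemma bw_const: "bw 0 (\<lambda>_. c)"
proof -
  have "wsmall 0 (\<lambda>_. c)" unfolding wsmall_def nev_w_def wnorm_def by (simp add: S_const)
  then show ?thesis by (auto simp: bw_def intro!: nsmall_entire meromorphic_intros)
qed

lemma bw_uminus: "bw d g \<Longrightarrow> bw d (\<lambda>z. - g z)"
  using bw_mult[OF bw_const[of "-1"], of d g] by simp

lemma bw_diff: "bw d g \<Longrightarrow> bw d h \<Longrightarrow> bw d (\<lambda>z. g z - h z)"
  using bw_add[OF _ bw_uminus, of d g h] by simp

lemma bw_small_mult: "bw 0 a \<Longrightarrow> bw d g \<Longrightarrow> bw d (\<lambda>z. a z * g z)"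
  using bw_mult[of 0 a d g] by simp

lemma bw_power: "bw d g \<Longrightarrow> bw (n * d) (\<lambda>z. g z ^ n)"
  by (induction n) (use bw_const[of 1] bw_mult[of d g] in auto)

text \<open>Since |g| is \<open>wnorm f d g\<close> times \<open>max 1 (norm (f z)) ^ d\<close>,
  m(r, g) is at most d m(r, f) plus an S(r, f) term. The \<open>2\<close> absorbs this term and N(r,
  g), each eventually at most T(r, f).\<close>

lemma bw_T:
  assumes "bw d g"
  shows "\<forall>\<^sub>F r in exc_filter. 0 \<le> nev_T r g \<and> nev_T r g \<le> (real d + 2) * nev_T r f"
proof -
  have g: "mero g" "nev_S (nev_w f d g) f" "nev_S (\<lambda>r. nev_N r g) f"
    using assms by (auto simp: bw_def wsmall_def nsmall_def)
  show ?thesis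
    using eventually_cir[OF g(1)] eventually_cir[OF mf] eventually_exc_ge[of 1] T_ge[of 0]
      nev_S_eventually_le[OF g(2) zero_less_one] nev_S_eventually_le[OF g(3) zero_less_one]
  proof eventually_elim
    case (elim r)
    have "nev_m r g \<le> cmean r (\<lambda>z. log_plus (wnorm f d g z) + real d * log_plus (norm (f z)))"
    proof (rule nev_m_le[OF elim(1)])
      show "continuous_on (sphere 0 r) (\<lambda>z. log_plus (wnorm f d g z) + real d * log_plus (norm (f z)))"
        by (intro continuous_intros wnorm_cont elim cir_cont)
      fix z
      have "norm (g z) = wnorm f d g z * max 1 (norm (f z)) ^ d" by (simp add: wnorm_def)
      then have "log_plus (norm (g z)) \<le> log_plus (wnorm f d g z) + log_plus (max 1 (norm (f z)) ^ d)"
        using log_plus_mult[OF wnorm_nonneg, of "max 1 (norm (f z)) ^ d" f d g z] by simp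
      also have "log_plus (max 1 (norm (f z)) ^ d) = real d * log_plus (norm (f z))"
        by (subst log_plus_power) (auto simp: log_plus_altdef)
      finally show "log_plus (norm (g z)) \<le> log_plus (wnorm f d g z) + real d * log_plus (norm (f z))" .
    qed
    also have "\<dots> = nev_w f d g r + cmean r (\<lambda>z. real d * log_plus (norm (f z)))"
      unfolding nev_w_def using cir_r[OF elim(1)] elim
      by (intro cmean_add wnorm_cont continuous_intros cir_cont) auto
    also have "cmean r (\<lambda>z. real d * log_plus (norm (f z))) = real d * nev_m r f"
      unfolding nev_m_eq by (rule cmean_cmult)
    also have "real d * nev_m r f \<le> real d * nev_T r f"
      using nev_N_nonneg[OF mf elim(3)] by (intro mult_left_mono) (auto simp: nev_T_def)
    finally have "nev_m r g \<le> nev_w f d g r + real d * nev_T r f" by simp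
    then have "nev_T r g \<le> (real d + 2) * nev_T r f"
      using elim(4,5,6) unfolding nev_T_def[of r g] by (simp add: distrib_right)
    moreover have "0 \<le> nev_T r g"
      using nev_m_nonneg[OF elim(1)] nev_N_nonneg[OF g(1) elim(3)] by (simp add: nev_T_def)
    ultimately show ?case by simp
  qed
qed

text \<open>The error term of \<open>log_deriv_lemma\<close> is measured by T(r, g);
  \<open>bw_T\<close> makes it S(r, f). For \<open>g\<close> vanishing off a sparse set the quotient
  is \<open>0\<close> there by division by zero.\<close>

lemma bw_log_deriv:
  assumes "bw d g"
  shows "wsmall 0 (\<lambda>z. deriv g z / g z)"
proof (cases "nonz g")
  case False
  have g: "mero g" using assms by (rule bw_mero)
  then have z: "\<forall>\<^sub>\<approx>z. g z = 0" using False nonz_or_zero by blast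
  show ?thesis
    by (rule wsmall_cong[OF wsmall_const_0]) (use z g in \<open>auto elim: eventually_mono intro!: meromorphic_intros\<close>)
next
  case True
  have g: "mero g" using assms by (rule bw_mero)
  obtain C D where D: "D \<ge> 0" and
    ev: "\<forall>\<^sub>F r in exc_filter. nev_m r (\<lambda>z. deriv g z / g z) \<le> C + 10 * ln (2 * nev_T r g + D + r)"
    by (rule log_deriv_lemma[OF g True]) (rule that)
  have S: "nev_S (\<lambda>r. C + 10 * ln (2 * nev_T r g + D + r)) f"
    by (rule S_ln_bound[OF bw_T[OF assms] D])
  have m: "mero (\<lambda>z. deriv g z / g z)" by (intro meromorphic_intros g)
  have "\<forall>\<^sub>F r in exc_filter. \<bar>nev_m r (\<lambda>z. deriv g z / g z)\<bar> \<le> 1 * \<bar>C + 10 * ln (2 * nev_T r g + D + r)\<bar>"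
    using ev eventually_cir[OF m] by eventually_elim (use nev_m_nonneg[of "\<lambda>z. deriv g z / g z"] in auto)
  then show ?thesis unfolding wsmall_def nev_w_0[abs_def] by (rule nev_S_mono[OF S])
qed

text \<open>The set where \<open>g\<close> and \<open>h\<close> differ is closed, so they agree near
  every point off it.\<close>

lemma deriv_cosparse_cong:
  assumes "\<forall>\<^sub>\<approx>z. g z = h z"
  shows "\<forall>\<^sub>\<approx>z. deriv g z = deriv h (z::complex)"
proof -
  define S where "S = {z. g z \<noteq> h z}"
  have "S sparse_in UNIV" using assms by (simp add: eventually_cosparse S_def)
  then have op: "open (- S)" using sparse_in_UNIV_imp_closed by blast
  have "deriv g z = deriv h z" if "g z = h z" for z
  proof (rule deriv_cong_ev[OF _ refl])
    have "z \<in> - S" using that by (simp add: S_def)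
    then have "eventually (\<lambda>w. w \<in> - S) (nhds z)" using op eventually_nhds_in_open by blast
    then show "eventually (\<lambda>w. g w = h w) (nhds z)" by eventually_elim (simp add: S_def)
  qed
  then show ?thesis using assms by (auto elim: eventually_mono)
qed

text \<open>Writing g' as (g'/g) g, the first factor has weight \<open>0\<close>, so differentiation
  does not raise the weight.\<close>

lemma bw_deriv:
  assumes "bw d g"
  shows "bw d (deriv g)"
proof -
  have g: "mero g" "wsmall d g" "nsmall g" using assms by (auto simp: bw_def)
  have m: "mero (\<lambda>z. deriv g z / g z)" "mero (deriv g)" by (intro meromorphic_intros g)+
  have w: "wsmall d (\<lambda>z. deriv g z / g z * g z)"
    using wsmall_mult[OF bw_log_deriv[OF assms] g(2) m(1) g(1)] by simp
  have "\<forall>\<^sub>\<approx>z. deriv g z / g z * g z = deriv g z"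
    using nonz_or_zero[OF g(1)]
  proof
    assume "nonz g" then show ?thesis by (auto elim: eventually_mono)
  next
    assume z: "\<forall>\<^sub>\<approx>z. g z = 0"
    then have "\<forall>\<^sub>\<approx>z. deriv g z = deriv (\<lambda>_. 0) z" by (rule deriv_cosparse_cong)
    then show ?thesis using z by eventually_elim simp
  qed
  then have "wsmall d (deriv g)"
    by (intro wsmall_cong[OF w]) (intro meromorphic_intros m g)+
  then show ?thesis using nsmall_deriv[OF g(3,1)] m(2) by (simp add: bw_def)
qed

lemma bw_higher_deriv: "bw 1 ((deriv ^^ k) f)"
  using bw_f by (induction k) (auto intro: bw_deriv)

text \<open>By the first main theorem T(r, 1/a) and T(r, a) differ by a constant on good circles,
  and constants are S(r, f).\<close>

lemma bw_inverse:
  assumes "bw 0 a"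
  shows "bw 0 (\<lambda>z. inverse (a z))"
proof (cases "nonz a")
  case False
  then have "\<forall>\<^sub>\<approx>z. a z = 0" using nonz_or_zero[OF bw_mero[OF assms]] by blast
  then have "\<forall>\<^sub>\<approx>z. 0 = inverse (a z)" by (rule eventually_mono) simp
  then show ?thesis by (rule bw_cong[OF bw_const])
next
  case True
  have a: "mero a" "nev_S (\<lambda>r. nev_T r a) f" using assms by (auto simp: bw_0_iff small_function_def)
  obtain C where C: "\<And>r. good_radius a r \<Longrightarrow> nev_T r a = nev_T r (\<lambda>z. inverse (a z)) + C"
    using first_main_theorem[OF a(1)] by blast
  have "nev_S (\<lambda>r. nev_T r a + (- C)) f" by (intro nev_S_add a S_const)
  then have "nev_S (\<lambda>r. nev_T r (\<lambda>z. inverse (a z))) f"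
  proof (rule nev_S_mono[where C = 1])
    show "\<forall>\<^sub>F r in exc_filter. \<bar>nev_T r (\<lambda>z. inverse (a z))\<bar> \<le> 1 * \<bar>nev_T r a + - C\<bar>"
      using eventually_good[OF a(1) True] by eventually_elim (use C in simp)
  qed
  then show ?thesis using a(1) by (simp add: bw_0_iff small_function_def meromorphic_intros)
qed

text \<open>Where |f| is at most 1, the weight \<open>e\<close> has no effect on \<open>Q\<close>.
  Where |f| exceeds 1, Q = P / f^m and |P| / |f|^m is the weighted norm of \<open>P\<close>. Either
  way |Q| is bounded by a weighted norm with small mean; the poles of \<open>Q\<close> are
  controlled through \<open>bw e Q\<close>.\<close>

lemma clunie:
  assumes P: "bw m P" and Q: "bw e Q" and eq: "\<forall>\<^sub>\<approx>z. f z ^ m * Q z = P z"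
  shows "bw 0 Q"
proof -
  have "wsmall 0 Q"
  proof (rule wsmall_le[where c = 0])
    show "wsmall m P" "wsmall e Q" "mero P" "mero Q" "mero Q" using P Q by (auto simp: bw_def)
    show "\<forall>\<^sub>\<approx>z. log_plus (wnorm f 0 Q z) \<le> log_plus (wnorm f m P z) + log_plus (wnorm f e Q z) + 0"
      using eq
    proof eventually_elim
      case (elim z)
      show ?case
      proof (cases "norm (f z) \<le> 1")
        case True
        then have "wnorm f e Q z = wnorm f 0 Q z" by (simp add: wnorm_def max_def)
        then show ?thesis by simp
      next
        case False
        then have "f z \<noteq> 0" by auto
        then have "wnorm f m P z = wnorm f 0 Q z"
          using False elim[symmetric] by (simp add: wnorm_def max_def norm_mult norm_power)
        then show ?thesis by simp
      qed
    qed
  qed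
  then show ?thesis using Q by (simp add: bw_def)
qed

text \<open>T(r, f) is eventually at least 1 and hence not o of itself.\<close>

lemma not_small_f: "\<not> bw 0 f"
proof
  assume "bw 0 f"
  then have "nev_S (\<lambda>r. nev_T r f) f" by (simp add: bw_0_iff small_function_def)
  then have "\<forall>\<^sub>F r in exc_filter. \<bar>nev_T r f\<bar> \<le> 1 / 2 * \<bar>nev_T r f\<bar>"
    by (rule nev_S_eventually_le) simp
  then have "\<forall>\<^sub>F r in exc_filter. False"
    using T_ge[of 1] by eventually_elim auto
  then show False by (simp add: eventually_False)
qed

text \<open>The form in which non-algebraicity is used. From f^d (c f) = -h Clunie's argument makes
  c f small; a nonzero small \<open>c\<close> could be divided out, leaving \<open>f\<close>
  small.\<close>

lemma leading_coeff_zero: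
  assumes c: "bw 0 c" and h: "bw d h" and eq: "\<forall>\<^sub>\<approx>z. c z * f z ^ Suc d + h z = 0"
  shows "\<forall>\<^sub>\<approx>z. c z = 0"
proof (rule ccontr)
  assume "\<not> (\<forall>\<^sub>\<approx>z. c z = 0)"
  then have nz: "nonz c" using nonz_or_zero[OF bw_mero[OF c]] by blast
  have "\<forall>\<^sub>\<approx>z. f z ^ d * (c z * f z) = - h z"
    using eq by eventually_elim (simp add: eq_neg_iff_add_eq_0 mult_ac)
  then have "bw 0 (\<lambda>z. c z * f z)"
    by (rule clunie[OF bw_uminus[OF h] bw_small_mult[OF c bw_f]])
  then have "bw 0 (\<lambda>z. inverse (c z) * (c z * f z))"
    by (rule bw_small_mult[OF bw_inverse[OF c]])
  moreover have "\<forall>\<^sub>\<approx>z. inverse (c z) * (c z * f z) = f z"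
    using nz by eventually_elim simp
  ultimately have "bw 0 f" by (rule bw_cong)
  then show False using not_small_f by blast
qed

end

subsection \<open>Differential polynomials\<close>

text \<open>Stated for an arbitrary graded class \<open>X\<close> because it is applied twice: to
  \<open>bw\<close>, and to \<open>small_poly f\<close> once the derivatives of \<open>f\<close> are
  known to be linear in \<open>f\<close>.\<close>

lemma dp_eval_closed:
  assumes small: "\<And>a. small_function a f \<Longrightarrow> X 0 a" "X 0 (\<lambda>_. 0)" "X 0 (\<lambda>_. 1)"
    and d: "\<And>k. X 1 ((deriv ^^ k) f)"
    and mult: "\<And>d e g h. X d g \<Longrightarrow> X e h \<Longrightarrow> X (d + e) (\<lambda>z. g z * h z)"
    and add: "\<And>d g h. X d g \<Longrightarrow> X d h \<Longrightarrow> X d (\<lambda>z. g z + h z)"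
    and mono: "\<And>d e g. X d g \<Longrightarrow> d \<le> e \<Longrightarrow> X e g"
    and coeffs: "\<forall>(a, l)\<in>set P. small_function a f"
  shows "X (dp_degree P) (dp_eval P f)"
proof -
  have pow: "X n (\<lambda>z. (deriv ^^ k) f z ^ n)" for n k
    by (induction n) (use small(3) mult[OF d] in auto)
  have prod: "X (\<Sum>j<k. l ! j) (\<lambda>z. \<Prod>j<k. ((deriv ^^ j) f z) ^ (l ! j))" for k and l :: "nat list"
  proof (induction k)
    case 0 then show ?case using small(3) by simp
  next
    case (Suc k) then show ?case using mult[OF Suc pow] by simp
  qed
  have "\<forall>(a, l)\<in>set P. small_function a f \<and> sum_list l \<le> dp_degree P"
    using coeffs by (force simp: dp_degree_def intro!: Max_ge)
  then have "X (dp_degree P) (\<lambda>z. \<Sum>(a, l)\<leftarrow>Q. a z * (\<Prod>j<length l. ((deriv ^^ j) f z) ^ (l ! j)))"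
    if "set Q \<subseteq> set P" for Q using that
  proof (induction Q)
    case Nil then show ?case using mono[OF small(2)] by simp
  next
    case (Cons q Q)
    obtain a l where q: "q = (a, l)" by (cases q)
    have al: "small_function a f" "sum_list l \<le> dp_degree P" using Cons.prems q by auto
    have "sum_list l = (\<Sum>j<length l. l ! j)" by (simp add: sum_list_sum_nth atLeast0LessThan)
    then have "X (sum_list l) (\<lambda>z. a z * (\<Prod>j<length l. ((deriv ^^ j) f z) ^ (l ! j)))"
      using mult[OF small(1)[OF al(1)] prod[of l "length l"]] by simp
    from add[OF mono[OF this al(2)] Cons.IH] show ?case using Cons.prems by (simp add: q)
  qed
  then show ?thesis by (simp add: dp_eval_def[abs_def])
qed

text \<open>Ordinary polynomials in \<open>f\<close> of degree at most \<open>d\<close> over the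
  small functions, up to sparse sets. Peeling off the top term makes the leading coefficient
  directly available for comparison.\<close>

primrec small_poly :: "(complex \<Rightarrow> complex) \<Rightarrow> nat \<Rightarrow> (complex \<Rightarrow> complex) \<Rightarrow> bool" where
  "small_poly f 0 g \<longleftrightarrow> small_function g f"
| "small_poly f (Suc d) g \<longleftrightarrow>
     (\<exists>b h. small_function b f \<and> small_poly f d h \<and> (\<forall>\<^sub>\<approx>z. g z = b z * f z ^ Suc d + h z))"

lemma deriv_ae_mult: "mero g \<Longrightarrow> mero h \<Longrightarrow> \<forall>\<^sub>\<approx>z. deriv (\<lambda>z. g z * h z) z = g z * deriv h z + deriv g z * h z"
  using eventually_conj[OF meromorphic_on_imp_analytic_cosparse[of g UNIV] meromorphic_on_imp_analytic_cosparse[of h UNIV]]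
  by (auto elim!: eventually_mono intro!: deriv_mult analytic_on_imp_differentiable_at)

lemma deriv_ae_monom_add:
  assumes "mero c" "mero f" "mero h"
  shows "\<forall>\<^sub>\<approx>z. deriv (\<lambda>z. c z * f z ^ Suc d + h z) z =
           deriv c z * f z ^ Suc d + of_nat (Suc d) * c z * f z ^ d * deriv f z + deriv h z"
  using meromorphic_on_imp_analytic_cosparse[OF assms(1)] meromorphic_on_imp_analytic_cosparse[OF assms(2)]
    meromorphic_on_imp_analytic_cosparse[OF assms(3)]
proof eventually_elim
  case (elim z)
  note d = elim[THEN analytic_derivI, where A = UNIV]
  have "((\<lambda>z. c z * f z ^ Suc d + h z) has_field_derivative
      deriv c z * f z ^ Suc d + (1 + of_nat d) * (deriv f z * f z ^ d) * c z + deriv h z) (at z)"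
    by (intro DERIV_add DERIV_mult DERIV_power_Suc d)
  then show ?case by (simp add: DERIV_imp_deriv mult_ac)
qed

text \<open>The plane minus a sparse set is open and still connected, so a vanishing derivative
  there forces a single constant.\<close>

lemma deriv_ae_zero_const:
  assumes "mero u" "\<forall>\<^sub>\<approx>z. deriv u z = 0"
  shows "\<exists>c. \<forall>\<^sub>\<approx>z. u z = c"
proof -
  define D where "D = {z. u analytic_on {z} \<and> deriv u z = 0}"
  have ev: "\<forall>\<^sub>\<approx>z. z \<in> D"
    unfolding D_def using assms(2) meromorphic_on_imp_analytic_cosparse[OF assms(1)] by eventually_elim simp
  then have sp: "- D sparse_in UNIV" by (simp add: eventually_cosparse Compl_eq)
  have "open D" using open_diff_sparse_pts[OF open_UNIV sp] by (simp add: Diff_eq)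
  have "connected D"
    using sparse_imp_connected[of UNIV "- D"] sp connected_UNIV by (simp add: Diff_eq)
  have der: "(u has_field_derivative 0) (at z)" if "z \<in> D" for z
    using that analytic_derivI[of u z UNIV] by (auto simp: D_def)
  have "continuous_on D u"
    by (rule DERIV_continuous_on[OF has_field_derivative_at_within[OF der]])
  then have "u constant_on D"
    by (rule DERIV_zero_connected_constant_on[OF \<open>connected D\<close> \<open>open D\<close> finite.emptyI]) (simp add: der)
  then obtain c where "\<And>z. z \<in> D \<Longrightarrow> u z = c" unfolding constant_on_def by blast
  then show ?thesis using ev by (auto elim!: eventually_mono)
qed

context nev_setting
begin

lemma small_poly_bw: "small_poly f d g \<Longrightarrow> bw d g"
proof (induction d arbitrary: g)
  case 0 then show ?case by (simp add: bw_0_iff)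
next
  case (Suc d)
  then obtain b h where bh: "small_function b f" "small_poly f d h" "\<forall>\<^sub>\<approx>z. g z = b z * f z ^ Suc d + h z" by auto
  have "bw (Suc d) (\<lambda>z. f z ^ Suc d)" using bw_power[OF bw_f, of "Suc d"] by simp
  then have "bw (Suc d) (\<lambda>z. b z * f z ^ Suc d + h z)"
    using bh(1) by (intro bw_add[OF bw_small_mult bw_mono[OF Suc.IH[OF bh(2)]]]) (simp_all add: bw_0_iff)
  then show ?case by (rule bw_cong) (use bh(3) in \<open>auto elim: eventually_mono\<close>)
qed

lemma small_poly_cong:
  assumes "small_poly f d g" "\<forall>\<^sub>\<approx>z. g z = h z"
  shows "small_poly f d h"
proof (cases d)
  case 0
  then show ?thesis using assms bw_cong[of 0 g h] by (simp add: bw_0_iff)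
next
  case (Suc e)
  then obtain b k where bk: "small_function b f" "small_poly f e k" "\<forall>\<^sub>\<approx>z. g z = b z * f z ^ Suc e + k z"
    using assms(1) by auto
  have "\<forall>\<^sub>\<approx>z. h z = b z * f z ^ Suc e + k z"
    using bk(3) assms(2) by eventually_elim simp
  then show ?thesis using bk Suc by auto
qed

lemma small_const: "small_function (\<lambda>_. c) f"
  using bw_const bw_0_iff by blast

lemma small_poly_Suc: "small_poly f d g \<Longrightarrow> small_poly f (Suc d) g"
  unfolding small_poly.simps using small_const[of 0]
  by (intro exI[of _ "\<lambda>_. 0"] exI[of _ g]) simp

lemma small_poly_mono: "small_poly f d g \<Longrightarrow> d \<le> e \<Longrightarrow> small_poly f e g"
proof (induction e)
  case (Suc e)
  then show ?case using small_poly_Suc[of e g] by (cases "d = Suc e") (auto simp del: small_poly.simps)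
qed auto

lemma small_poly_monom: "small_function b f \<Longrightarrow> small_poly f d (\<lambda>z. b z * f z ^ d)"
proof (cases d)
  case (Suc e)
  assume "small_function b f"
  moreover have "small_poly f e (\<lambda>_. 0)"
    by (rule small_poly_mono[of 0]) (simp_all add: small_const)
  ultimately show ?thesis unfolding Suc small_poly.simps by (intro exI[of _ b] exI[of _ "\<lambda>_. 0"]) simp
qed simp

lemma small_poly_add: "small_poly f d g \<Longrightarrow> small_poly f d h \<Longrightarrow> small_poly f d (\<lambda>z. g z + h z)"
proof (induction d arbitrary: g h)
  case 0 then show ?case using bw_add[of 0 g h] by (simp add: bw_0_iff)
next
  case (Suc d)
  obtain b g1 where g1: "small_function b f" "small_poly f d g1" "\<forall>\<^sub>\<approx>z. g z = b z * f z ^ Suc d + g1 z"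
    using Suc.prems(1) by auto
  obtain c h1 where h1: "small_function c f" "small_poly f d h1" "\<forall>\<^sub>\<approx>z. h z = c z * f z ^ Suc d + h1 z"
    using Suc.prems(2) by auto
  have "small_function (\<lambda>z. b z + c z) f" using bw_add[of 0 b c] g1 h1 by (simp add: bw_0_iff)
  moreover have "small_poly f d (\<lambda>z. g1 z + h1 z)" by (rule Suc.IH[OF g1(2) h1(2)])
  moreover have "\<forall>\<^sub>\<approx>z. g z + h z = (b z + c z) * f z ^ Suc d + (g1 z + h1 z)"
    using g1(3) h1(3) by eventually_elim (simp add: algebra_simps)
  ultimately show ?case unfolding small_poly.simps by blast
qed

lemma small_poly_mult_monom:
  "small_function b f \<Longrightarrow> small_poly f d g \<Longrightarrow> small_poly f (k + d) (\<lambda>z. b z * f z ^ k * g z)"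
proof (induction d arbitrary: g)
  case 0
  then have "small_function (\<lambda>z. b z * g z) f" using bw_mult[of 0 b 0 g] by (simp add: bw_0_iff)
  from small_poly_monom[OF this, of k] show ?case by (simp add: mult_ac)
next
  case (Suc d)
  obtain c h where h: "small_function c f" "small_poly f d h" "\<forall>\<^sub>\<approx>z. g z = c z * f z ^ Suc d + h z"
    using Suc.prems(2) by auto
  have "small_function (\<lambda>z. b z * c z) f" using bw_mult[of 0 b 0 c] Suc.prems(1) h(1) by (simp add: bw_0_iff)
  moreover have "small_poly f (k + d) (\<lambda>z. b z * f z ^ k * h z)" using Suc.IH[OF Suc.prems(1) h(2)] .
  moreover have "\<forall>\<^sub>\<approx>z. b z * f z ^ k * g z = (b z * c z) * f z ^ Suc (k + d) + b z * f z ^ k * h z"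
    using h(3) by eventually_elim (simp add: algebra_simps power_add)
  ultimately show ?case unfolding add_Suc_right small_poly.simps by blast
qed

lemma small_poly_mult:
  "small_poly f d g \<Longrightarrow> small_poly f e h \<Longrightarrow> small_poly f (d + e) (\<lambda>z. g z * h z)"
proof (induction d arbitrary: g)
  case 0 then show ?case using small_poly_mult_monom[of g e h 0] by simp
next
  case (Suc d)
  obtain c k where k: "small_function c f" "small_poly f d k" "\<forall>\<^sub>\<approx>z. g z = c z * f z ^ Suc d + k z"
    using Suc.prems(1) by auto
  have "small_poly f (Suc d + e) (\<lambda>z. c z * f z ^ Suc d * h z + k z * h z)"
    using small_poly_mono[OF Suc.IH[OF k(2) Suc.prems(2)], of "Suc d + e"]
    by (intro small_poly_add small_poly_mult_monom k Suc.prems) auto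
  then show ?case
    by (rule small_poly_cong) (use k(3) in \<open>auto elim!: eventually_mono simp: distrib_right\<close>)
qed

lemma small_poly_f: "small_poly f 1 f"
  using small_poly_monom[OF small_const[of 1], of 1] by simp

text \<open>Replacing f' by a f + b turns the derivative of f^(d+1) into (d + 1) f^d (a f + b), so
  differentiation preserves the degree.\<close>

lemma small_poly_deriv:
  assumes ab: "small_function a f" "small_function b f" "\<forall>\<^sub>\<approx>z. deriv f z = a z * f z + b z"
    and g: "small_poly f d g"
  shows "small_poly f d (deriv g)"
  using g
proof (induction d arbitrary: g)
  case 0 then show ?case using bw_deriv[of 0 g] by (simp add: bw_0_iff)
next
  case (Suc d)
  obtain c h where h: "small_function c f" "small_poly f d h" "\<forall>\<^sub>\<approx>z. g z = c z * f z ^ Suc d + h z"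
    using Suc.prems by auto
  have m: "mero c" "mero h" using h(1) bw_mero[OF small_poly_bw[OF h(2)]] by (auto simp: small_function_def)
  have dc: "small_function (deriv c) f" using bw_deriv[of 0 c] h(1) by (simp add: bw_0_iff)
  have 1: "small_poly f (Suc d) (\<lambda>z. deriv c z * f z ^ Suc d)" by (rule small_poly_monom[OF dc])
  have nc: "small_function (\<lambda>z. of_nat (Suc d) * c z) f"
    using bw_mult[OF bw_const, of 0 c "of_nat (Suc d)"] h(1) by (simp add: bw_0_iff)
  have "small_poly f 1 (\<lambda>z. a z * f z ^ 1 + b z)"
    using ab small_poly_Suc[of 0 b] by (intro small_poly_add small_poly_monom) auto
  from small_poly_mult_monom[OF nc this, of d]
  have 2: "small_poly f (Suc d) (\<lambda>z. of_nat (Suc d) * c z * f z ^ d * (a z * f z ^ 1 + b z))"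
    by (simp del: small_poly.simps)
  have 3: "small_poly f (Suc d) (deriv h)" using small_poly_Suc[OF Suc.IH[OF h(2)]] .
  have "small_poly f (Suc d) (\<lambda>z. deriv c z * f z ^ Suc d + of_nat (Suc d) * c z * f z ^ d * (a z * f z ^ 1 + b z) + deriv h z)"
    by (rule small_poly_add[OF small_poly_add[OF 1 2] 3])
  moreover have "\<forall>\<^sub>\<approx>z. deriv c z * f z ^ Suc d + of_nat (Suc d) * c z * f z ^ d * (a z * f z ^ 1 + b z) + deriv h z = deriv g z"
    using deriv_cosparse_cong[OF h(3)] ab(3) deriv_ae_monom_add[OF m(1) mf m(2), of d]
    by eventually_elim simp
  ultimately show ?case by (rule small_poly_cong)
qed

text \<open>The top powers of \<open>f\<close> cancel, which lowers the weight by one. The induction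
  uses (f + w)^(m+2) - f^(m+2) = (f + w) ((f + w)^(m+1) - f^(m+1)) + w f^(m+1).\<close>

lemma bw_power_shift:
  assumes "bw 0 w"
  shows "bw m (\<lambda>z. (f z + w z) ^ Suc m - f z ^ Suc m)"
proof (induction m)
  case 0 then show ?case using assms by simp
next
  case (Suc m)
  have "bw (1 + m) (\<lambda>z. (f z + w z) * ((f z + w z) ^ Suc m - f z ^ Suc m))"
    by (intro bw_mult bw_add bw_f Suc bw_mono[OF assms]) simp
  moreover have "bw (Suc m) (\<lambda>z. w z * f z ^ Suc m)"
    using bw_small_mult[OF assms bw_power[OF bw_f, of "Suc m"]] by simp
  ultimately have "bw (Suc m) (\<lambda>z. (f z + w z) * ((f z + w z) ^ Suc m - f z ^ Suc m) + w z * f z ^ Suc m)"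
    by (intro bw_add) simp_all
  then show ?case by (simp add: algebra_simps)
qed

text \<open>The \<open>log_plus\<close> of |R| is n + 1 times that of |s|, so the proximity function
  of \<open>s\<close> is controlled by that of \<open>R\<close>; \<open>ord\<close> does the same
  for the poles.\<close>

lemma bw_root:
  assumes s: "mero s" and R: "bw 0 R" and eq: "\<forall>\<^sub>\<approx>z. norm (s z) ^ Suc n = norm (R z)"
    and ord: "\<And>z. pmul s z \<le> pmul R z"
  shows "bw 0 s"
proof -
  have "wsmall 0 s"
  proof (rule wsmall_le[where c = 0])
    show "wsmall 0 R" "wsmall 0 (\<lambda>_. 0)" "mero R" "mero (\<lambda>_. 0)" "mero s"
      using R s wsmall_const_0 by (auto simp: bw_def)
    show "\<forall>\<^sub>\<approx>z. log_plus (wnorm f 0 s z) \<le> log_plus (wnorm f 0 R z) + log_plus (wnorm f 0 (\<lambda>_. 0) z) + 0"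
      using eq
    proof eventually_elim
      case (elim z)
      have "log_plus (norm (R z)) = real (Suc n) * log_plus (norm (s z))"
        unfolding elim[symmetric] by (rule log_plus_power) simp
      moreover have "1 * log_plus (norm (s z)) \<le> real (Suc n) * log_plus (norm (s z))"
        by (intro mult_right_mono) auto
      ultimately show ?case by (simp add: wnorm_def log_plus_def[of 0])
    qed
  qed
  moreover have "nsmall s"
    using R s ord by (intro nsmall_le[of R R s 1]) (auto simp: bw_def trans_le_add1)
  ultimately show ?thesis using s by (simp add: bw_def)
qed

section \<open>The differential equation\<close>

theorem tumura_clunie:
  assumes small_coeffs: "\<forall>(a, l)\<in>set P. small_function a f" and deg: "dp_degree P = Suc m"
    and \<alpha>: "\<alpha> holomorphic_on UNIV" and R: "small_function R f"
    and eq: "\<forall>\<^sub>\<approx>z. f z ^ Suc (Suc m) + dp_eval P f z = R z * exp (\<alpha> z)"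
  shows "\<exists>s \<gamma>. small_function s f \<and> small_function \<gamma> f \<and> (\<forall>\<^sub>\<approx>z. s z ^ Suc (Suc m) = R z) \<and>
           (\<forall>\<^sub>\<approx>z. f z = s z * exp (\<alpha> z / of_nat (Suc (Suc m))) + \<gamma> z)"
proof -
  define n where "n = Suc (Suc m)"
  define k where "k = complex_of_nat n"
  have k0: "k \<noteq> 0" unfolding k_def n_def of_nat_eq_0_iff by simp
  have sm: "small_function a f \<longleftrightarrow> bw 0 a" for a by (simp add: bw_0_iff)
  have ex: "mero (\<lambda>z. exp (c * \<alpha> z))" "mero \<alpha>" "\<alpha> analytic_on {z}" for c z
  proof -
    show an: "\<alpha> analytic_on {z}" for z using \<alpha> by (meson UNIV_I holomorphic_on_imp_analytic_at open_UNIV)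
    then have "\<alpha> analytic_on UNIV" using analytic_on_analytic_at by blast
    then show "mero (\<lambda>z. exp (c * \<alpha> z))" "mero \<alpha>"
      by (auto intro!: analytic_on_imp_meromorphic_on analytic_intros)
  qed
  define p where "p = dp_eval P f"
  have p: "bw (Suc m) p" unfolding p_def deg[symmetric]
    by (rule dp_eval_closed[where X = bw])
       (use small_coeffs sm bw_const bw_higher_deriv bw_mult bw_add bw_mono in auto)
  have mp: "mero p" by (rule bw_mero[OF p])
  \<comment> \<open>The factor \<open>1\<close> is kept so that \<open>leading_coeff_zero\<close>
    and \<open>deriv_ae_monom_add\<close> apply with a constant coefficient function.\<close>
  define G where "G = (\<lambda>z. 1 * f z ^ Suc (Suc m) + p z)"
  have fn: "bw n (\<lambda>z. f z ^ n)" using bw_power[OF bw_f, of n] by simp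
  have G: "bw n G" unfolding G_def using bw_add[OF fn bw_mono[OF p]] by (simp add: n_def)
  have eqG: "\<forall>\<^sub>\<approx>z. G z = R z * exp (\<alpha> z)" using eq by (simp add: G_def p_def)
  have R0: "bw 0 R" using R sm by simp
  have mR: "mero R" by (rule bw_mero[OF R0])
  have one_nz: "\<not> (\<forall>\<^sub>\<approx>z::complex. c = (0::complex))" if "c \<noteq> 0" for c
    using that by (simp add: eventually_False)
  \<comment> \<open>Were \<open>G\<close> zero, the relation f^n + p = 0 with \<open>p\<close> of
    weight n - 1 would force its leading coefficient 1 to vanish.\<close>
  have nzG: "nonz G"
  proof (rule ccontr)
    assume "\<not> nonz G"
    then have "\<forall>\<^sub>\<approx>z. G z = 0" using nonz_or_zero[OF bw_mero[OF G]] by blast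
    then have "\<forall>\<^sub>\<approx>z::complex. (1::complex) = 0"
      unfolding G_def by (rule leading_coeff_zero[OF bw_const p])
    then show False using one_nz[of 1] by simp
  qed
  have nzR: "nonz R" using nzG eqG by eventually_elim auto

  \<comment> \<open>As a logarithmic derivative of \<open>G\<close> it has a small proximity
    function; its poles are counted through the second description R'/R + \<alpha>' in
    \<open>A1\<close>.\<close>
  define A where "A = (\<lambda>z. deriv G z / G z)"
  have A1: "\<forall>\<^sub>\<approx>z. deriv R z * inverse (R z) + deriv \<alpha> z = A z"
    using deriv_cosparse_cong[OF eqG] deriv_ae_mult[OF mR ex(1)[of 1]] nzR eqG
      meromorphic_on_imp_analytic_cosparse[OF ex(2)]
  proof eventually_elim
    case (elim z)
    have "((\<lambda>z. exp (1 * \<alpha> z)) has_field_derivative exp (\<alpha> z) * deriv \<alpha> z) (at z)"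
      using analytic_derivI[OF elim(5)] by (auto intro!: derivative_eq_intros)
    then have "deriv (\<lambda>z. exp (1 * \<alpha> z)) z = exp (\<alpha> z) * deriv \<alpha> z" by (rule DERIV_imp_deriv)
    then show ?case using elim by (simp add: A_def field_simps)
  qed
  have mA: "mero A" unfolding A_def by (intro meromorphic_intros bw_mero[OF G])
  have "nsmall (\<lambda>z. deriv R z * inverse (R z))"
    using bw_mult[OF bw_deriv[OF R0] bw_inverse[OF R0]] by (simp add: bw_def)
  moreover have "nsmall (deriv \<alpha>)" by (intro nsmall_entire holomorphic_deriv \<alpha> open_UNIV)
  ultimately have "nsmall (\<lambda>z. deriv R z * inverse (R z) + deriv \<alpha> z)"
    by (rule nsmall_add) (intro meromorphic_intros mR ex)+
  then have "nsmall A"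
    by (rule nsmall_cong[OF _ _ mA A1]) (intro meromorphic_intros mR ex)
  then have A: "bw 0 A" using bw_log_deriv[OF G] mA by (simp add: bw_def A_def)
  have dG: "\<forall>\<^sub>\<approx>z. deriv G z = A z * G z" using nzG by eventually_elim (simp add: A_def)
  have dG2: "\<forall>\<^sub>\<approx>z. deriv G z = k * f z ^ Suc m * deriv f z + deriv p z"
    using deriv_ae_monom_add[OF _ mf mp, of "\<lambda>_. 1" "Suc m"] unfolding G_def
    by (auto elim!: eventually_mono simp: k_def n_def)

  \<comment> \<open>Equating the two expressions for G' cancels the terms of degree n: f^(n-1) Q = A
    p - p', with a right side of weight n - 1. This is the shape required by
    \<open>clunie\<close>.\<close>
  define Q where "Q = (\<lambda>z. k * deriv f z - A z * f z)"
  have Q1: "bw 1 Q" unfolding Q_def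
    by (intro bw_diff bw_small_mult A bw_f bw_const bw_deriv)
  have "\<forall>\<^sub>\<approx>z. f z ^ Suc m * Q z = A z * p z - deriv p z"
    using dG dG2 by eventually_elim (simp add: Q_def G_def algebra_simps)
  then have Q: "bw 0 Q"
    by (rule clunie[OF bw_diff[OF bw_small_mult[OF A p] bw_deriv[OF p]] Q1])

  have sa: "small_function (\<lambda>z. A z * inverse k) f" "small_function (\<lambda>z. Q z * inverse k) f"
    unfolding sm using bw_mult[OF A bw_const] bw_mult[OF Q bw_const] by simp_all
  \<comment> \<open>The identity only unfolds \<open>Q\<close>; its content is that both
    coefficients are now known to be small.\<close>
  have df: "\<forall>\<^sub>\<approx>z. deriv f z = A z * inverse k * f z + Q z * inverse k"
    using k0 by (intro always_eventually allI) (simp add: Q_def field_simps)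
  have der: "small_poly f 1 ((deriv ^^ j) f)" for j
    using small_poly_f small_poly_deriv[OF sa df] by (induction j) (simp_all del: small_poly.simps)
  have "small_poly f (Suc m) p" unfolding p_def deg[symmetric]
    by (rule dp_eval_closed[where X = "small_poly f"])
       (use small_coeffs small_const der small_poly_mult small_poly_add small_poly_mono in \<open>auto simp del: small_poly.simps(2)\<close>)
  then obtain b h where bh: "bw 0 b" "bw m h" "\<forall>\<^sub>\<approx>z. p z = b z * f z ^ Suc m + h z"
    using small_poly_bw sm by auto
  note mb = bw_mero[OF bh(1)] and mh = bw_mero[OF bh(2)]

  \<comment> \<open>After f' is replaced by (A f + Q) / n in G' = A G, the terms of degree n cancel,
    \<open>c\<close> below is the coefficient of f^(n-1), and \<open>h2\<close> collects the rest,
    of weight m.\<close>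
  define h2 where "h2 = (\<lambda>z. of_nat (Suc m) * inverse k * (b z * Q z) * f z ^ m + deriv h z - A z * h z)"
  have "bw m (\<lambda>z. f z ^ m)" using bw_power[OF bw_f, of m] by simp
  then have h2: "bw m h2" unfolding h2_def
    by (intro bw_diff bw_add bw_small_mult[OF bw_small_mult[OF bw_const bw_small_mult[OF bh(1) Q]]]
        bw_small_mult[OF A] bw_deriv bh)
  define c where "c = (\<lambda>z. Q z + deriv b z - inverse k * (A z * b z))"
  have c: "bw 0 c" unfolding c_def by (intro bw_diff bw_add Q bw_deriv bh bw_small_mult bw_const A)
  have "\<forall>\<^sub>\<approx>z. c z * f z ^ Suc m + h2 z = 0"
    using dG dG2 bh(3) deriv_cosparse_cong[OF bh(3)] deriv_ae_monom_add[OF mb mf mh, of m] df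
  proof eventually_elim
    case (elim z)
    have 1: "k * f z ^ Suc m * deriv f z + (deriv b z * f z ^ Suc m + of_nat (Suc m) * b z * f z ^ m * deriv f z + deriv h z)
      = A z * (f z ^ Suc (Suc m) + (b z * f z ^ Suc m + h z))"
      using elim(1-5) by (simp add: G_def)
    have 2: "k * deriv f z = A z * f z + Q z" by (simp add: Q_def)
    have 3: "deriv f z = inverse k * (A z * f z + Q z)" using elim(6) by (simp add: algebra_simps)
    have k1: "of_nat (Suc m) = k - 1" by (simp add: k_def n_def)
    define x where "x = f z ^ m"
    have x: "f z ^ Suc m = f z * x" "f z ^ Suc (Suc m) = f z * f z * x" by (simp_all add: x_def)
    have ik: "k * inverse k = 1" using k0 by simp
    have "(A z * f z + Q z) * (f z * x) + (deriv b z * (f z * x) + (k - 1) * b z * x * (inverse k * (A z * f z + Q z)) + deriv h z)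
      = A z * (f z * f z * x + (b z * (f z * x) + h z))"
      using 1 2 unfolding x k1 x_def[symmetric] 3[symmetric] by algebra
    then show ?case unfolding c_def h2_def x k1 x_def[symmetric] using ik by algebra
  qed
  then have c0: "\<forall>\<^sub>\<approx>z. c z = 0" by (rule leading_coeff_zero[OF c h2])

  \<comment> \<open>\<open>w\<close> is -\<gamma>. The vanishing of \<open>c\<close> says precisely
    that n (f + w)' = A (f + w).\<close>
  define w where "w = (\<lambda>z. inverse k * b z)"
  have w: "bw 0 w" unfolding w_def by (intro bw_small_mult bw_const bh)
  define g where "g = (\<lambda>z. f z + w z)"
  have mw: "mero w" by (rule bw_mero[OF w])
  have mg: "mero g" unfolding g_def by (intro meromorphic_intros mf mw)
  have dg: "\<forall>\<^sub>\<approx>z. k * deriv g z = A z * g z"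
    using c0 meromorphic_on_imp_analytic_cosparse[OF mf] meromorphic_on_imp_analytic_cosparse[OF mb]
  proof eventually_elim
    case (elim z)
    have "(g has_field_derivative deriv f z + inverse k * deriv b z) (at z)"
      unfolding g_def w_def using analytic_derivI[OF elim(2)] analytic_derivI[OF elim(3)]
      by (auto intro!: derivative_eq_intros)
    then have "k * deriv g z = k * deriv f z + deriv b z"
      using k0 by (simp add: DERIV_imp_deriv field_simps)
    then show ?case using elim(1) by (simp add: c_def Q_def g_def w_def algebra_simps)
  qed

  define v where "v = (\<lambda>z. exp ((-1) * \<alpha> z))"
  \<comment> \<open>Formally the logarithmic derivative of \<open>u\<close> is n g'/g - \<alpha>' -
    R'/R = A - A = 0. The computation is done with derivatives themselves, so that zeros of
    \<open>g\<close> need no separate treatment.\<close>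
  define u where "u = (\<lambda>z. g z ^ n * (v z * inverse (R z)))"
  have mu: "mero u" unfolding u_def v_def by (intro meromorphic_intros mg ex mR)
  have "\<forall>\<^sub>\<approx>z. deriv u z = 0"
    using dg A1 nzR meromorphic_on_imp_analytic_cosparse[OF mg] meromorphic_on_imp_analytic_cosparse[OF mR]
  proof eventually_elim
    case (elim z)
    note d = analytic_derivI[OF elim(4)] analytic_derivI[OF elim(5)] analytic_derivI[OF ex(3)[of z]]
    have "(u has_field_derivative (k * g z ^ Suc m * deriv g z) * (v z * inverse (R z))
        + g z ^ n * (v z * (- deriv \<alpha> z) * inverse (R z) + v z * (- (inverse (R z) * deriv R z * inverse (R z))))) (at z)"
    proof -
      have 1: "((\<lambda>z. g z ^ n) has_field_derivative k * g z ^ Suc m * deriv g z) (at z)"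
        using DERIV_power_Suc[OF d(1), of "Suc m"] by (simp add: k_def n_def mult_ac)
      have 2: "(v has_field_derivative v z * (- deriv \<alpha> z)) (at z)"
        unfolding v_def by (auto intro!: derivative_eq_intros d(3))
      show ?thesis unfolding u_def
        by (rule DERIV_cong[OF DERIV_mult[OF 1 DERIV_mult[OF 2 DERIV_inverse_fun[OF d(2) elim(3)]]]])
           (simp add: algebra_simps)
    qed
    then have "deriv u z = (k * g z ^ Suc m * deriv g z) * (v z * inverse (R z))
        + g z ^ n * (v z * (- deriv \<alpha> z) * inverse (R z) + v z * (- (inverse (R z) * deriv R z * inverse (R z))))"
      by (rule DERIV_imp_deriv)
    also have "k * g z ^ Suc m * deriv g z = g z ^ Suc m * (A z * g z)" using elim(1) by (simp add: mult_ac)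
    also have "\<dots> = A z * g z ^ n" by (simp add: n_def)
    also have "A z = deriv R z * inverse (R z) + deriv \<alpha> z" using elim(2) by simp
    finally show ?case by (simp add: algebra_simps)
  qed
  then obtain C where C: "\<forall>\<^sub>\<approx>z. u z = C" using deriv_ae_zero_const[OF mu] by blast
  have gC: "\<forall>\<^sub>\<approx>z. g z ^ n = C * (R z * exp (\<alpha> z))"
    using C nzR by eventually_elim (auto simp: u_def v_def exp_minus field_simps)
  \<comment> \<open>In (f + w)^n = C (f^n + p) the difference of both sides has leading coefficient
    1 - C and a remainder of weight n - 1.\<close>
  have "C = 1"
  proof (rule ccontr)
    assume "C \<noteq> 1"
    have "bw (Suc m) (\<lambda>z. ((f z + w z) ^ Suc (Suc m) - f z ^ Suc (Suc m)) - C * p z)"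
      by (intro bw_diff bw_power_shift w bw_small_mult bw_const p)
    moreover have "\<forall>\<^sub>\<approx>z. (1 - C) * f z ^ Suc (Suc m) + (((f z + w z) ^ Suc (Suc m) - f z ^ Suc (Suc m)) - C * p z) = 0"
      using gC eqG
    proof eventually_elim
      case (elim z)
      have "(f z + w z) ^ Suc (Suc m) = C * (f z ^ Suc (Suc m) + p z)"
        using elim by (simp only: g_def n_def G_def mult_1)
      then show ?case by (simp only:) (simp add: algebra_simps)
    qed
    ultimately have "\<forall>\<^sub>\<approx>z::complex. 1 - C = 0"
      by (intro leading_coeff_zero[OF bw_const])
    then show False using one_nz[of "1 - C"] \<open>C \<noteq> 1\<close> by simp
  qed

  \<comment> \<open>With C = 1, multiplying \<open>g\<close> by exp(-\<alpha>/n) leaves an n-th root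
    of R which is single-valued by construction.\<close>
  define s where "s = (\<lambda>z. g z * exp ((- 1 / k) * \<alpha> z))"
  have ms: "mero s" unfolding s_def by (intro meromorphic_intros mg ex)
  have sn: "\<forall>\<^sub>\<approx>z. s z ^ n = R z"
    using gC
  proof eventually_elim
    case (elim z)
    have "exp ((- 1 / k) * \<alpha> z) ^ n = exp (of_nat n * ((- 1 / k) * \<alpha> z))" by (rule exp_of_nat_mult[symmetric])
    also have "\<dots> = exp (- \<alpha> z)" using k0 by (simp add: k_def)
    finally show ?case using elim \<open>C = 1\<close> by (simp add: s_def power_mult_distrib exp_minus)
  qed
  have "bw 0 s"
  proof (rule bw_root[OF ms R0, of "Suc m"])
    show "\<forall>\<^sub>\<approx>z. norm (s z) ^ Suc (Suc m) = norm (R z)"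
      unfolding norm_power[symmetric] n_def[symmetric] using sn by eventually_elim simp
    fix z
    \<comment> \<open>Multiplicities are read off from s^n = R, so \<open>s\<close> has at most the
      poles of \<open>R\<close>.\<close>
    have "pmul R z = pmul (\<lambda>z. s z ^ n) z" using pmul_cong[OF sn] by simp
    also have "\<dots> = n * pmul s z" by (rule pmul_power[OF ms])
    finally show "pmul s z \<le> pmul R z" by (simp add: n_def)
  qed
  moreover have "f z = s z * exp (\<alpha> z / of_nat n) + (- w z)" for z
  proof -
    have "exp ((- 1 / k) * \<alpha> z) * exp (\<alpha> z / of_nat n) = 1"
      by (simp add: k_def flip: exp_add)
    then show ?thesis by (simp add: s_def g_def mult.assoc)
  qed
  ultimately show ?thesis
    using sn bw_uminus[OF w] unfolding sm n_def by (intro exI[of _ s] exI[of _ "\<lambda>z. - w z"]) auto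
qed

end

theorem theorem1p1:
  fixes n :: nat and f \<alpha> R :: "complex \<Rightarrow> complex" and P :: diff_poly
  assumes "n \<ge> 2"
    and "transcendental_meromorphic f"
    and "nev_S (\<lambda>r. nev_N r f) f"
    and "dp_degree P = n - 1"
    and "\<forall>(a, l)\<in>set P. small_function a f"
    and "\<alpha> holomorphic_on UNIV"
    and "small_function R f"
    and "\<forall>\<^sub>\<approx>z. f z ^ n + dp_eval P f z = R z * exp (\<alpha> z)"
  shows "\<exists>s \<gamma>. small_function s f \<and> small_function \<gamma> f \<and>
           (\<forall>\<^sub>\<approx>z. s z ^ n = R z) \<and>
           (\<forall>\<^sub>\<approx>z. f z = s z * exp (\<alpha> z / of_nat n) + \<gamma> z)"
proof -
  interpret nev_setting f
    using assms(2,3) by (rule nev_setting.intro)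
  define m where "m = n - 2"
  have n: "n = Suc (Suc m)"
    using assms(1) by (simp add: m_def)
  show ?thesis
    unfolding n
  proof (rule tumura_clunie[OF assms(5) _ assms(6,7)])
    show "dp_degree P = Suc m"
      using assms(4) n by simp
    show "\<forall>\<^sub>\<approx>z. f z ^ Suc (Suc m) + dp_eval P f z = R z * exp (\<alpha> z)"
      using assms(8) unfolding n .
  qed
qed

end
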